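(* Let $X=X^{(+)}+X^{(-)}$ be as in the context, with $-X^{(-)}$ not a subordinator, and let $a>0$. If $\kappa_{X^{(-)}}'(0^+)\ge0$, the map $\psi$ given on $\mathcal S$ by $$\psi(\boldsymbol\eta)=\frac{\lambda}{a+\lambda}\,(0,\boldsymbol\alpha)\int_{[0,\infty)}e^{x(\mathbf M+\mathbf m\boldsymbol\eta)}\;\mathbb P\bigl(-I^{(-)}_{e(a+\lambda)}\in dx\bigr)$$ is a contraction. If $\kappa_{X^{(-)}}'(0^+)<0$ and $\kappa(\Phi(0))<\infty$, the tilted map $\psi^{\Phi(0)}$ (defined in the context, with $\gamma=\Phi(0)$) is a contraction.
   Context: Phase-type distributions: $(m,\mathbf T,\boldsymbol\alpha)$ consists of a probability row vector $\boldsymbol\alpha$ of length $m$ and an invertible $m\times m$ matrix $\mathbf T$ with non-negative off-diagonal entries and non-positive row sums; $\mathbf t=-\mathbf T\mathbf 1$; the distribution $F$ on $(0,\infty)$ is $1-F(x)=\boldsymbol\alpha e^{\mathbf Tx}\mathbf 1$, with Laplace transform $\hat F[s]=\boldsymbol\alpha(s\mathbf I-\mathbf T)^{-1}\mathbf t$. The representation is assumed minimal: there are no $k<m$, $k$-vector $\mathbf b$ and $k\times k$ matrix $\mathbf G$ with $1-F(x)=\mathbf be^{\mathbf Gx}\mathbf 1$. $X=X^{(+)}+X^{(-)}$, where $X^{(-)}$ is a Lévy process without positive jumps, with Lévy exponent $\kappa_{X^{(-)}}(s)=\log\mathbb E[e^{sX^{(-)}_1}]$, and $X^{(+)}$ is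 an independent compound Poisson process with intensity $\lambda>0$ and jumps of phase type $(m,\mathbf T,\boldsymbol\alpha)$. $\kappa(s)=\log\mathbb E[e^{sX_1}]$ (so $\kappa(\Phi(0))<\infty$ means $\mathbb E[e^{\Phi(0)X_1}]<\infty$). $\Phi(q)$ is the largest real root of $\kappa_{X^{(-)}}(s)=q$. $I^{(-)}_t=\inf_{s\le t}(X^{(-)}_s\wedge0)$, and $e(q)$ is an independent exponential random variable with mean $1/q$. $\mathcal S$ is the set of sub-probability row vectors in $\mathbb R^{m+1}$ (non-negative entries with sum at most $1$), with distance from the norm $|\boldsymbol\eta|=\sum_i|\eta_i|$; a map $f$ on $\mathcal S$ is a contraction if for some $r<1$, $|f(\boldsymbol\eta)-f(\boldsymbol\eta')|\le r|\boldsymbol\eta-\boldsymbol\eta'|$ for all $\boldsymbol\eta,\boldsymbol\eta'\in\mathcal S$. Further $$\mathbf M=\begin{pmatrix}-\Phi(a+\lambda)&\mathbf 0\\ \mathbf t&\mathbf T\end{pmatrix},\qquad \mathbf m=-\mathbf M\mathbf 1=\begin{pmatrix}\Phi(a+\lambda)\\ \mathbf 0\end{pmatrix}.$$ Tilted map $\psi^\gamma$, for $\gamma=\Phi(0)$: it is the analogue of $\psi$ for $X$ under the measure $\mathbb P^\gamma$ with $\frac{d\mathbb P^\gamma}{d\mathbb P}\big|_{\mathcal F_t}=\exp(\gamma X_t-\kappa(\gamma)t)$, with $a$ replaced by $a^\gamma=a+\lambda(1-\hat F[-\gamma])$. Explicitly, let $\mathbf k=(-\gamma\mathbf I-\mathbf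 T)^{-1}\mathbf t$, $\boldsymbol\Delta=\operatorname{diag}(k_1,\dots,k_m)$, $\lambda^\gamma=\lambda\hat F[-\gamma]$, $\boldsymbol\alpha^\gamma=\boldsymbol\alpha\boldsymbol\Delta/\hat F[-\gamma]$ (so $a^\gamma+\lambda^\gamma=a+\lambda$), $$\mathbf M^\gamma=\begin{pmatrix}-\Phi(a+\lambda)+\gamma&\mathbf 0\\ \boldsymbol\Delta^{-1}\mathbf t&\boldsymbol\Delta^{-1}\mathbf T\boldsymbol\Delta+\gamma\mathbf I\end{pmatrix},\qquad\mathbf m^\gamma=-\mathbf M^\gamma\mathbf 1=\begin{pmatrix}\Phi(a+\lambda)-\gamma\\ \mathbf 0\end{pmatrix},$$ and $$\psi^\gamma(\boldsymbol\eta)=\frac{\lambda^\gamma}{a^\gamma+\lambda^\gamma}\,(0,\boldsymbol\alpha^\gamma)\int_{[0,\infty)}e^{x(\mathbf M^\gamma+\mathbf m^\gamma\boldsymbol\eta)}\;\mathbb P^\gamma\bigl(-I^{(-)}_{e(a+\lambda)}\in dx\bigr),$$ where under $\mathbb P^\gamma$ the process $X^{(-)}$ is a Lévy process with exponent $\kappa_{X^{(-)}}(s+\gamma)-\kappa_{X^{(-)}}(\gamma)$. *)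

theory Defs
  imports "HOL-Probability.Probability"
begin

section \<open>Matrices\<close>

(* vec multiplication in the library is componentwise, so powers have to be built from ** *)
definition matrix_exp :: "real^'n^'n \<Rightarrow> real^'n^'n" where
  "matrix_exp A = (\<Sum>n. (1 / fact n) *\<^sub>R (((**) A ^^ n) (mat 1)))"

definition diag_matrix :: "real^'n \<Rightarrow> real^'n^'n" where
  "diag_matrix v = (\<chi> i j. if i = j then v $ i else 0)"

definition outer_product :: "real^'n \<Rightarrow> real^'n \<Rightarrow> real^'n^'n" where
  "outer_product v w = (\<chi> i j. v $ i * w $ j)"

definition l1_norm :: "real^'n \<Rightarrow> real" where
  "l1_norm v = (\<Sum>i\<in>UNIV. \<bar>v $ i\<bar>)"

(* k x k matrices for a variable number k: only the entries with both indices < k matter *)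
primrec idx_matrix_pow :: "nat \<Rightarrow> (nat \<Rightarrow> nat \<Rightarrow> real) \<Rightarrow> nat \<Rightarrow> nat \<Rightarrow> nat \<Rightarrow> real" where
  "idx_matrix_pow k G 0 = (\<lambda>i j. if i = j then 1 else 0)"
| "idx_matrix_pow k G (Suc n) = (\<lambda>i j. \<Sum>l<k. G i l * idx_matrix_pow k G n l j)"

definition idx_matrix_exp :: "nat \<Rightarrow> (nat \<Rightarrow> nat \<Rightarrow> real) \<Rightarrow> nat \<Rightarrow> nat \<Rightarrow> real" where
  "idx_matrix_exp k G i j = (\<Sum>n. idx_matrix_pow k G n i j / fact n)"

section \<open>Phase-type distributions\<close>

definition exit_vector :: "real^'m^'m \<Rightarrow> real^'m" where
  "exit_vector T = - (T *v 1)"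

definition phase_type_params :: "real^'m \<Rightarrow> real^'m^'m \<Rightarrow> bool" where
  "phase_type_params \<alpha> T \<longleftrightarrow>
     (\<forall>i. 0 \<le> \<alpha> $ i) \<and> (\<Sum>i\<in>UNIV. \<alpha> $ i) = 1 \<and>
     invertible T \<and> (\<forall>i j. i \<noteq> j \<longrightarrow> 0 \<le> T $ i $ j) \<and> (\<forall>i. (\<Sum>j\<in>UNIV. T $ i $ j) \<le> 0)"

definition phase_type_tail :: "real^'m \<Rightarrow> real^'m^'m \<Rightarrow> real \<Rightarrow> real" where
  "phase_type_tail \<alpha> T x = (\<alpha> v* matrix_exp (x *\<^sub>R T)) \<bullet> 1"

definition phase_type_minimal :: "real^'m \<Rightarrow> real^'m^'m \<Rightarrow> bool" where
  "phase_type_minimal \<alpha> T \<longleftrightarrow>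
     \<not> (\<exists>k<CARD('m). \<exists>(b :: nat \<Rightarrow> real) (G :: nat \<Rightarrow> nat \<Rightarrow> real). \<forall>x\<ge>0.
          phase_type_tail \<alpha> T x = (\<Sum>i<k. \<Sum>j<k. b i * idx_matrix_exp k (\<lambda>i j. x * G i j) i j))"

(* the condition at x = 0 says that F is concentrated on the open half-line *)
definition phase_type_law :: "real^'m \<Rightarrow> real^'m^'m \<Rightarrow> real measure \<Rightarrow> bool" where
  "phase_type_law \<alpha> T F \<longleftrightarrow>
     prob_space F \<and> sets F = sets borel \<and> (\<forall>x\<ge>0. measure F {x<..} = phase_type_tail \<alpha> T x)"

definition phase_type_resolvent :: "real^'m^'m \<Rightarrow> real \<Rightarrow> real^'m" where
  "phase_type_resolvent T s = matrix_inv (mat s - T) *v exit_vector T"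

definition phase_type_transform :: "real^'m \<Rightarrow> real^'m^'m \<Rightarrow> real \<Rightarrow> real" where
  "phase_type_transform \<alpha> T s = \<alpha> \<bullet> phase_type_resolvent T s"

section \<open>Levy processes\<close>

definition cadlag_on_nonneg :: "(real \<Rightarrow> real) \<Rightarrow> bool" where
  "cadlag_on_nonneg f \<longleftrightarrow>
     (\<forall>t\<ge>0. (f \<longlongrightarrow> f t) (at_right t)) \<and> (\<forall>t>0. \<exists>l. (f \<longlongrightarrow> l) (at_left t))"

definition levy_process :: "'w measure \<Rightarrow> (real \<Rightarrow> 'w \<Rightarrow> real) \<Rightarrow> bool" where
  "levy_process P X \<longleftrightarrow>
     prob_space P \<and>
     (\<forall>t\<ge>0. X t \<in> borel_measurable P) \<and>
     (AE \<omega> in P. X 0 \<omega> = 0) \<and>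
     (\<forall>\<omega>\<in>space P. cadlag_on_nonneg (\<lambda>t. X t \<omega>)) \<and>
     (\<forall>n (t :: nat \<Rightarrow> real). 0 \<le> t 0 \<longrightarrow> (\<forall>i<n. t i \<le> t (Suc i)) \<longrightarrow>
        prob_space.indep_vars P (\<lambda>_. borel) (\<lambda>i \<omega>. X (t (Suc i)) \<omega> - X (t i) \<omega>) {..<n}) \<and>
     (\<forall>s t. 0 \<le> s \<longrightarrow> s \<le> t \<longrightarrow>
        distr P borel (\<lambda>\<omega>. X t \<omega> - X s \<omega>) = distr P borel (X (t - s)))"

definition no_positive_jumps :: "'w measure \<Rightarrow> (real \<Rightarrow> 'w \<Rightarrow> real) \<Rightarrow> bool" where
  "no_positive_jumps P X \<longleftrightarrow> (AE \<omega> in P. \<forall>t>0. X t \<omega> \<le> Lim (at_left t) (\<lambda>s. X s \<omega>))"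

definition subordinator :: "'w measure \<Rightarrow> (real \<Rightarrow> 'w \<Rightarrow> real) \<Rightarrow> bool" where
  "subordinator P X \<longleftrightarrow>
     levy_process P X \<and> (AE \<omega> in P. \<forall>s t. 0 \<le> s \<longrightarrow> s \<le> t \<longrightarrow> X s \<omega> \<le> X t \<omega>)"

definition poisson_process :: "'w measure \<Rightarrow> real \<Rightarrow> (real \<Rightarrow> 'w \<Rightarrow> nat) \<Rightarrow> bool" where
  "poisson_process P lam N \<longleftrightarrow>
     levy_process P (\<lambda>t \<omega>. real (N t \<omega>)) \<and>
     (\<forall>t>0. distr P (count_space UNIV) (N t) = measure_pmf (poisson_pmf (lam * t)))"

definition compound_poisson :: "'w measure \<Rightarrow> real \<Rightarrow> real measure \<Rightarrow> (real \<Rightarrow> 'w \<Rightarrow> real) \<Rightarrow> bool" where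
  "compound_poisson P lam F X \<longleftrightarrow>
     (\<exists>N U.
        poisson_process P lam N \<and>
        prob_space.indep_vars P (\<lambda>_. borel) U (UNIV :: nat set) \<and>
        (\<forall>i. distr P borel (U i) = F) \<and>
        prob_space.indep_var P
          (Pi\<^sub>M {0..} (\<lambda>_. count_space UNIV)) (\<lambda>\<omega>. \<lambda>t\<in>{0..}. N t \<omega>)
          (Pi\<^sub>M UNIV (\<lambda>_. borel)) (\<lambda>\<omega> i. U i \<omega>) \<and>
        (\<forall>t\<ge>0. \<forall>\<omega>\<in>space P. X t \<omega> = (\<Sum>i<N t \<omega>. U i \<omega>)))"

definition indep_processes ::
    "'w measure \<Rightarrow> (real \<Rightarrow> 'w \<Rightarrow> real) \<Rightarrow> (real \<Rightarrow> 'w \<Rightarrow> real) \<Rightarrow> bool" where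
  "indep_processes P X Y \<longleftrightarrow>
     prob_space.indep_var P
       (Pi\<^sub>M {0..} (\<lambda>_. borel)) (\<lambda>\<omega>. \<lambda>t\<in>{0..}. X t \<omega>)
       (Pi\<^sub>M {0..} (\<lambda>_. borel)) (\<lambda>\<omega>. \<lambda>t\<in>{0..}. Y t \<omega>)"

definition levy_exponent :: "'w measure \<Rightarrow> (real \<Rightarrow> 'w \<Rightarrow> real) \<Rightarrow> real \<Rightarrow> ereal" where
  "levy_exponent P X s =
     (let L = (\<integral>\<^sup>+ \<omega>. ennreal (exp (s * X 1 \<omega>)) \<partial>P)
      in if L = \<infinity> then \<infinity> else ereal (ln (enn2real L)))"

(* one-sided derivative at 0, possibly infinite: the exponent is convex with value 0 at 0, so the
   quotient is monotone in s *)
definition levy_exponent_deriv0 :: "'w measure \<Rightarrow> (real \<Rightarrow> 'w \<Rightarrow> real) \<Rightarrow> ereal" where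
  "levy_exponent_deriv0 P X =
     Lim (at_right 0) (\<lambda>s. (levy_exponent P X s - levy_exponent P X 0) / ereal s)"

definition largest_root :: "'w measure \<Rightarrow> (real \<Rightarrow> 'w \<Rightarrow> real) \<Rightarrow> real \<Rightarrow> real" where
  "largest_root P X q = (GREATEST s. levy_exponent P X s = ereal q)"

definition running_inf :: "(real \<Rightarrow> 'w \<Rightarrow> real) \<Rightarrow> real \<Rightarrow> 'w \<Rightarrow> real" where
  "running_inf X t \<omega> = (INF s\<in>{0..t}. min (X s \<omega>) 0)"

(* the law of minus the running infimum at an independent exponential time of rate q, which is
   realised as the second coordinate of a product space *)
definition exp_time_inf_law :: "'w measure \<Rightarrow> (real \<Rightarrow> 'w \<Rightarrow> real) \<Rightarrow> real \<Rightarrow> real measure" where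
  "exp_time_inf_law P X q =
     distr (P \<Otimes>\<^sub>M density lborel (exponential_density q)) borel (\<lambda>(\<omega>, t). - running_inf X t \<omega>)"

definition joint_filtration ::
    "'w measure \<Rightarrow> (real \<Rightarrow> 'w \<Rightarrow> real) \<Rightarrow> (real \<Rightarrow> 'w \<Rightarrow> real) \<Rightarrow> real \<Rightarrow> 'w measure" where
  "joint_filtration P X Y t =
     sigma (space P)
       ({X s -` B \<inter> space P | s B. s \<in> {0..t} \<and> B \<in> sets borel} \<union>
        {Y s -` B \<inter> space P | s B. s \<in> {0..t} \<and> B \<in> sets borel})"

(* Q only has to be defined on a sigma-algebra containing the filtration: on a larger one (for
   instance a P-completion) the change of measure need not extend *)
definition exponential_tilt ::
    "'w measure \<Rightarrow> (real \<Rightarrow> 'w \<Rightarrow> real) \<Rightarrow> (real \<Rightarrow> 'w \<Rightarrow> real) \<Rightarrow> real \<Rightarrow> 'w measure \<Rightarrow> bool" where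
  "exponential_tilt P Xp Xm \<gamma> Q \<longleftrightarrow>
     prob_space Q \<and> space Q = space P \<and>
     (\<forall>t\<ge>0. sets (joint_filtration P Xp Xm t) \<subseteq> sets Q \<and>
        (\<forall>A\<in>sets (joint_filtration P Xp Xm t).
           emeasure Q A =
             (\<integral>\<^sup>+ \<omega>\<in>A. ennreal (exp (\<gamma> * (Xp t \<omega> + Xm t \<omega>)
                - real_of_ereal (levy_exponent P (\<lambda>u \<omega>. Xp u \<omega> + Xm u \<omega>) \<gamma>) * t)) \<partial>P)))"

section \<open>The maps\<close>

definition subprob_vectors :: "(real^'n) set" where
  "subprob_vectors = {\<eta>. (\<forall>i. 0 \<le> \<eta> $ i) \<and> (\<Sum>i\<in>UNIV. \<eta> $ i) \<le> 1}"

definition l1_contraction_on :: "(real^'n) set \<Rightarrow> (real^'n \<Rightarrow> real^'n) \<Rightarrow> bool" where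
  "l1_contraction_on S f \<longleftrightarrow>
     (\<exists>r<1. \<forall>\<eta>\<in>S. \<forall>\<eta>'\<in>S. l1_norm (f \<eta> - f \<eta>') \<le> r * l1_norm (\<eta> - \<eta>'))"

(* the index type 'm option has m + 1 elements; None is the additional first coordinate *)
definition extend_row :: "real^'m \<Rightarrow> real^('m option)" where
  "extend_row \<alpha> = (\<chi> i. case i of None \<Rightarrow> 0 | Some j \<Rightarrow> \<alpha> $ j)"

definition block_generator :: "real \<Rightarrow> real^'m \<Rightarrow> real^'m^'m \<Rightarrow> real^('m option)^('m option)" where
  "block_generator \<phi> t T =
     (\<chi> i j. case i of
        None \<Rightarrow> (case j of None \<Rightarrow> - \<phi> | Some _ \<Rightarrow> 0)
      | Some i' \<Rightarrow> (case j of None \<Rightarrow> t $ i' | Some j' \<Rightarrow> T $ i' $ j'))"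

definition mixture_map ::
    "real \<Rightarrow> real^'n \<Rightarrow> real^'n^'n \<Rightarrow> real measure \<Rightarrow> real^'n \<Rightarrow> real^'n" where
  "mixture_map c \<beta> M \<mu> \<eta> =
     c *\<^sub>R (\<beta> v* (LINT x:{0..}|\<mu>. matrix_exp (x *\<^sub>R (M + outer_product (- (M *v 1)) \<eta>))))"

definition psi ::
    "'w measure \<Rightarrow> (real \<Rightarrow> 'w \<Rightarrow> real) \<Rightarrow> real^'m \<Rightarrow> real^'m^'m \<Rightarrow> real \<Rightarrow> real
      \<Rightarrow> real^('m option) \<Rightarrow> real^('m option)" where
  "psi P Xm \<alpha> T lam a =
     mixture_map (lam / (a + lam)) (extend_row \<alpha>)
       (block_generator (largest_root P Xm (a + lam)) (exit_vector T) T)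
       (exp_time_inf_law P Xm (a + lam))"

(* Q is the measure P tilted by \<gamma>; the root of the exponent is still taken under P *)
definition psi_tilted ::
    "'w measure \<Rightarrow> 'w measure \<Rightarrow> real \<Rightarrow> (real \<Rightarrow> 'w \<Rightarrow> real) \<Rightarrow> real^'m \<Rightarrow> real^'m^'m \<Rightarrow> real \<Rightarrow> real
      \<Rightarrow> real^('m option) \<Rightarrow> real^('m option)" where
  "psi_tilted P Q \<gamma> Xm \<alpha> T lam a =
     (let \<Delta> = diag_matrix (phase_type_resolvent T (- \<gamma>));
          fhat = phase_type_transform \<alpha> T (- \<gamma>);
          a\<gamma> = a + lam * (1 - fhat);
          lam\<gamma> = lam * fhat;
          \<alpha>\<gamma> = (1 / fhat) *\<^sub>R (\<alpha> v* \<Delta>);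
          M\<gamma> = block_generator (largest_root P Xm (a + lam) - \<gamma>)
                (matrix_inv \<Delta> *v exit_vector T) (matrix_inv \<Delta> ** T ** \<Delta> + mat \<gamma>)
      in mixture_map (lam\<gamma> / (a\<gamma> + lam\<gamma>)) (extend_row \<alpha>\<gamma>) M\<gamma> (exp_time_inf_law Q Xm (a + lam)))"

end

theory Submission
  imports Defs
begin

text \<open>
  Changing \<open>\<eta>\<close> perturbs the generator by a matrix of rank one, so by Duhamel's formula the two matrix
  exponentials at time \<open>x\<close>, started from the initial row, differ in the \<open>l\<^sub>1\<close>-norm by at most
  \<open>|\<eta> - \<eta>'|\<close> times the expected number of exits from the additional state up to time \<open>x\<close>. Let \<open>q = a + \<lambda>\<close>.

  In the untilted case the number of exits is at most \<open>\<Phi>(q) x\<close> and the factor becomes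
  \<open>(\<lambda> / q) \<Phi>(q) E[-I]\<close>, where \<open>\<Phi>(q) E[-I] \<le> 1\<close>. In the tilted case the chain first has to complete a tilted
  jump. The distribution of the jump cancels against \<open>P\<^sup>\<gamma>(-I > y) \<le> exp(-\<gamma> y) P(-I > y)\<close>, and the factor is
  at most \<open>(\<lambda> / q) (\<Phi>(q) - \<gamma>) / \<Phi>(q)\<close>. Minimality ensures that a finite exponential moment of the jumps forces
  \<open>exp(\<gamma> x) exp(x T)\<close> to vanish at infinity, so that the resolvent at \<open>-\<gamma>\<close> exists and is at least 1.

  Both cases rest on \<open>E[exp(\<theta> I)] \<ge> 1 - \<theta> / \<Phi>(q)\<close> for \<open>0 \<le> \<theta> \<le> \<Phi>(q)\<close> with nonnegative exponent at \<open>\<theta>\<close>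
  (used in the limit \<open>\<theta> \<rightarrow> 0\<close> in the first case and for \<open>\<theta> = \<gamma>\<close> in the second). For the random walk on a dyadic grid it
  follows from Lindley's recursion \<open>I' = min(0, \<xi> + I)\<close>: the loss \<open>(exp(\<theta> (\<xi> + I)) - 1)\<^sup>+\<close> of one step is at most
  \<open>\<theta> / \<Phi>(q)\<close> times the same loss for \<open>\<Phi>(q)\<close>, and the discounted sum of the latter is at most 1.
\<close>

text \<open>The obstacle in the tilted case is the weight of the map. With \<open>F\<close> =
  \<alpha> \<bullet> k \<ge> 1 it equals \<lambda> F / q, which may exceed 1, so bounding the exit
  rate by its maximum as in the untilted case proves nothing. The factor F has to be recovered from
  the time that the chain spends in the phases of the tilted jump before its first visit to the
  additional state.

  The estimate for the infimum is one half of the Wiener-Hopf identity E[exp(\<theta> I)] = (q / (q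
  - \<kappa>(\<theta>))) (1 - \<theta> / \<Phi>(q)), where \<kappa> is the exponent: for 0 \<le>
  \<kappa>(\<theta>) < q the first fraction is at least 1. It equals 1 at \<theta> = \<gamma>, so
  nothing is lost there. The grid is dyadic because the moment generating function at time 2^-n is
  then the 2^n-th root of the one at time 1. The tilted process enters only through its density with
  respect to P. In the untilted case the strict inequality comes entirely from \<lambda> < q, that
  is, from a > 0.\<close>

abbreviation mat_pow :: "real^'n^'n \<Rightarrow> nat \<Rightarrow> real^'n^'n" where
  "mat_pow A n \<equiv> ((**) A ^^ n) (mat 1)"

abbreviation mexp :: "real^'n^'n \<Rightarrow> real \<Rightarrow> real^'n^'n" where
  "mexp A x \<equiv> matrix_exp (x *\<^sub>R A)"

section \<open>Matrix products as bounded bilinear maps, and the matrix exponential\<close>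

lemma bounded_bilinear_matrix_matrix_mult:
  "bounded_bilinear ((**) :: real^'n^'m \<Rightarrow> real^'p^'n \<Rightarrow> real^'p^'m)"
proof (rule bilinear_conv_bounded_bilinear[THEN iffD1])
  show "bilinear ((**) :: real^'n^'m \<Rightarrow> real^'p^'n \<Rightarrow> real^'p^'m)"
    unfolding bilinear_def linear_iff
    by (auto simp: matrix_add_ldistrib matrix_scalar_ac scalar_matrix_assoc matrix_matrix_mult_def
        vec_eq_iff sum.distrib algebra_simps sum_distrib_left)
qed

lemma bounded_bilinear_matrix_vector_mult:
  "bounded_bilinear ((*v) :: real^'n^'m \<Rightarrow> real^'n \<Rightarrow> real^'m)"
proof (rule bilinear_conv_bounded_bilinear[THEN iffD1])
  show "bilinear ((*v) :: real^'n^'m \<Rightarrow> real^'n \<Rightarrow> real^'m)"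
    unfolding bilinear_def linear_iff
    by (auto simp: matrix_vector_mult_def vec_eq_iff sum.distrib algebra_simps sum_distrib_left)
qed

lemmas mm_scaleR_left = bounded_bilinear.scaleR_left[OF bounded_bilinear_matrix_matrix_mult]
lemmas mm_scaleR_right = bounded_bilinear.scaleR_right[OF bounded_bilinear_matrix_matrix_mult]
lemmas mv_scaleR_left = bounded_bilinear.scaleR_left[OF bounded_bilinear_matrix_vector_mult]
lemmas mv_scaleR_right = bounded_bilinear.scaleR_right[OF bounded_bilinear_matrix_vector_mult]
lemmas mv_add_left = bounded_bilinear.add_left[OF bounded_bilinear_matrix_vector_mult]
lemmas mv_add_right = bounded_bilinear.add_right[OF bounded_bilinear_matrix_vector_mult]
lemmas mv_diff_left = bounded_bilinear.diff_left[OF bounded_bilinear_matrix_vector_mult]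
lemmas mv_diff_right = bounded_bilinear.diff_right[OF bounded_bilinear_matrix_vector_mult]
lemmas mv_minus_left = bounded_bilinear.minus_left[OF bounded_bilinear_matrix_vector_mult]
lemmas mv_minus_right = bounded_bilinear.minus_right[OF bounded_bilinear_matrix_vector_mult]

lemma mat_mult_vector: "mat c *v v = c *\<^sub>R (v :: real^'n)"
  by (simp add: matrix_vector_mult_def mat_def vec_eq_iff if_distrib if_distribR sum.If_cases)

lemma mat_pow_commute: "A ** mat_pow A n = mat_pow A n ** A"
proof (induction n)
  case (Suc n)
  then have "A ** mat_pow A (Suc n) = A ** (mat_pow A n ** A)" by simp
  then show ?case by (simp add: matrix_mul_assoc)
qed simp

lemma mat_pow_scaleR: "mat_pow (x *\<^sub>R A) n = x ^ n *\<^sub>R mat_pow A n"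
  by (induction n) (auto simp: mm_scaleR_left mm_scaleR_right)

lemma summable_norm_mat_pow: "summable (\<lambda>n. norm ((1 / fact n) *\<^sub>R mat_pow (A :: real^'n^'n) n))"
proof -
  \<comment> \<open>\<open>K\<close> is the constant of the bounded bilinear product; it only
    rescales the ratio in the comparison with the exponential series.\<close>
  obtain K where K: "K > 0" "\<And>a b. norm ((a :: real^'n^'n) ** (b :: real^'n^'n)) \<le> norm a * norm b * K"
    using bounded_bilinear.pos_bounded[OF bounded_bilinear_matrix_matrix_mult] by blast
  have bound: "norm (mat_pow A n) \<le> (norm A * K) ^ n * norm (mat 1 :: real^'n^'n)" for n
  proof (induction n)
    case (Suc n)
    have "norm (mat_pow A (Suc n)) \<le> norm A * norm (mat_pow A n) * K"
      using K(2) by simp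
    also have "\<dots> \<le> norm A * ((norm A * K) ^ n * norm (mat 1 :: real^'n^'n)) * K"
      using Suc K(1) by (intro mult_right_mono mult_left_mono) auto
    finally show ?case by (simp add: algebra_simps)
  qed simp
  have "summable (\<lambda>n. norm (mat 1 :: real^'n^'n) * (inverse (fact n) * (norm A * K) ^ n))"
    by (intro summable_mult summable_exp)
  then show ?thesis
  proof (rule summable_comparison_test'[where N = 0])
    fix n
    have "norm (mat_pow A n) / fact n \<le> (norm A * K) ^ n * norm (mat 1 :: real^'n^'n) / fact n"
      by (intro divide_right_mono bound) simp
    then show "norm (norm ((1 / fact n) *\<^sub>R mat_pow A n))
        \<le> norm (mat 1 :: real^'n^'n) * (inverse (fact n) * (norm A * K) ^ n)"
      by (simp add: divide_inverse mult_ac)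
  qed
qed

lemma sums_matrix_exp: "(\<lambda>n. (1 / fact n) *\<^sub>R mat_pow A n) sums matrix_exp A"
  unfolding matrix_exp_def
  by (rule summable_sums[OF summable_norm_cancel[OF summable_norm_mat_pow]])

lemma sums_matrix_exp_nth:
  "(\<lambda>n. mat_pow A n $ i $ j / fact n * x ^ n) sums (mexp A x $ i $ j)"
proof -
  have "(\<lambda>n. ((1 / fact n) *\<^sub>R mat_pow (x *\<^sub>R A) n) $ i $ j) sums (mexp A x $ i $ j)"
    by (intro bounded_linear.sums[OF bounded_linear_vec_nth] sums_matrix_exp)
  then show ?thesis by (simp add: mat_pow_scaleR mult.commute)
qed

lemma matrix_exp_0 [simp]: "matrix_exp 0 = (mat 1 :: real^'n^'n)"
proof -
  have "(\<lambda>n. (1 / fact n) *\<^sub>R mat_pow (0 :: real^'n^'n) n) = (\<lambda>n. if n = 0 then mat 1 else 0)"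
  proof
    fix n show "(1 / fact n) *\<^sub>R mat_pow (0 :: real^'n^'n) n = (if n = 0 then mat 1 else 0)"
      by (cases n) auto
  qed
  moreover have "(\<lambda>n. if n = 0 then mat 1 else 0 :: real^'n^'n) sums mat 1"
    using sums_single[of 0 "\<lambda>_. mat 1 :: real^'n^'n"] by simp
  ultimately show ?thesis
    using sums_matrix_exp[of "0 :: real^'n^'n"] by (simp add: sums_unique2)
qed

lemma has_vector_derivative_vec:
  fixes f :: "real \<Rightarrow> 'a::real_normed_vector^'n"
  assumes "\<And>i. ((\<lambda>x. f x $ i) has_vector_derivative f' $ i) (at x)"
  shows "(f has_vector_derivative f') (at x)"
proof -
  have "((\<lambda>y. (f y - f x - (y - x) *\<^sub>R f') /\<^sub>R norm (y - x)) \<longlongrightarrow> 0) (at x)"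
  proof (rule vec_tendstoI)
    fix i
    have "((\<lambda>y. (f y $ i - f x $ i - (y - x) *\<^sub>R f' $ i) /\<^sub>R norm (y - x)) \<longlongrightarrow> 0) (at x)"
      using assms[of i] by (auto simp: has_vector_derivative_def has_derivative_at_within)
    then show "((\<lambda>y. ((f y - f x - (y - x) *\<^sub>R f') /\<^sub>R norm (y - x)) $ i) \<longlongrightarrow> 0 $ i) (at x)"
      by simp
  qed
  then show ?thesis
    by (auto simp: has_vector_derivative_def has_derivative_at_within
        intro: bounded_linear_scaleR_left)
qed

text \<open>Each entry is a power series that converges everywhere and can be differentiated term by
  term. Shifting the index by one splits off a left factor \<open>A\<close>, because
  \<open>mat_pow\<close> multiplies from the left.\<close>

lemma matrix_exp_has_vector_derivative:
  "((\<lambda>x. mexp A x) has_vector_derivative A ** mexp A x) (at x)"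
proof (intro has_vector_derivative_vec)
  fix i j
  let ?c = "\<lambda>i j n. mat_pow A n $ i $ j / fact n"
  have eq: "(\<lambda>x. mexp A x $ i $ j) = (\<lambda>x. \<Sum>n. ?c i j n * x ^ n)" for i j
    using sums_matrix_exp_nth[of A i j] by (auto simp: sums_iff)
  have diffs: "diffs (?c i j) n * x ^ n = (\<Sum>l\<in>UNIV. A $ i $ l * (?c l j n * x ^ n))" for n
  proof -
    have "diffs (?c i j) n = mat_pow A (Suc n) $ i $ j / fact n"
      by (simp add: diffs_def del: funpow.simps of_nat_Suc)
    then show ?thesis
      by (simp add: matrix_matrix_mult_def sum_divide_distrib sum_distrib_right mult.assoc)
  qed
  have "((\<lambda>x. \<Sum>n. ?c i j n * x ^ n) has_field_derivative (\<Sum>n. diffs (?c i j) n * x ^ n)) (at x)"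
    using sums_matrix_exp_nth[of A i j]
    by (intro termdiffs_strong_converges_everywhere) (auto simp: sums_iff)
  also have "(\<Sum>n. diffs (?c i j) n * x ^ n) = (\<Sum>l\<in>UNIV. A $ i $ l * mexp A x $ l $ j)"
    unfolding diffs by (intro sums_unique[symmetric] sums_sum sums_mult sums_matrix_exp_nth)
  also have "\<dots> = (A ** mexp A x) $ i $ j"
    by (simp add: matrix_matrix_mult_def)
  finally show "((\<lambda>x. mexp A x $ i $ j) has_vector_derivative
      (A ** mexp A x) $ i $ j) (at x)"
    by (simp add: eq has_real_derivative_iff_has_vector_derivative)
qed

lemma matrix_exp_commute: "A ** mexp A x = mexp A x ** A"
proof -
  have "(\<lambda>n. A ** ((1 / fact n) *\<^sub>R mat_pow (x *\<^sub>R A) n)) sums (A ** mexp A x)"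
    by (intro bounded_linear.sums[OF bounded_bilinear.bounded_linear_right[OF bounded_bilinear_matrix_matrix_mult]]
        sums_matrix_exp)
  moreover have "(\<lambda>n. ((1 / fact n) *\<^sub>R mat_pow (x *\<^sub>R A) n) ** A) sums (mexp A x ** A)"
    by (intro bounded_linear.sums[OF bounded_bilinear.bounded_linear_left[OF bounded_bilinear_matrix_matrix_mult]]
        sums_matrix_exp)
  moreover have "A ** ((1 / fact n) *\<^sub>R mat_pow (x *\<^sub>R A) n) = ((1 / fact n) *\<^sub>R mat_pow (x *\<^sub>R A) n) ** A" for n
    by (simp add: mat_pow_scaleR bounded_bilinear.scaleR_left[OF bounded_bilinear_matrix_matrix_mult]
       bounded_bilinear.scaleR_right[OF bounded_bilinear_matrix_matrix_mult] mat_pow_commute)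
  ultimately show ?thesis by (simp add: sums_iff)
qed

lemma matrix_exp_form_deriv:
  "((\<lambda>x. u \<bullet> (mexp A x *v v)) has_real_derivative u \<bullet> (mexp A x *v (A *v v))) (at x)"
proof -
  have bl: "bounded_linear (\<lambda>M. u \<bullet> (M *v v))"
    by (intro bounded_linear_compose[OF bounded_linear_inner_right, unfolded o_def]
        bounded_bilinear.bounded_linear_left[OF bounded_bilinear_matrix_vector_mult])
  show ?thesis
    using bounded_linear.has_vector_derivative[OF bl matrix_exp_has_vector_derivative[of A x]]
    by (simp add: has_real_derivative_iff_has_vector_derivative matrix_exp_commute matrix_vector_mul_assoc)
qed

text \<open>Serves the comparison arguments in which the vector varies. Commuting \<open>A\<close>
  past the exponential leaves the kernel exp(yA) applied to A w + w', so for Metzler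
  \<open>A\<close>, nonnegative \<open>u\<close> and y \<ge> 0 the sign of the derivative can be
  read off from the entries of that vector.\<close>

lemma matrix_exp_product_deriv:
  fixes w :: "real \<Rightarrow> real^'n"
  assumes "(w has_vector_derivative w') (at y)"
  shows "((\<lambda>y. u \<bullet> (mexp A y *v w y)) has_real_derivative
      u \<bullet> (mexp A y *v (A *v w y + w'))) (at y)"
proof -
  have "((\<lambda>y. mexp A y *v w y) has_vector_derivative
      (mexp A y *v w' + (A ** mexp A y) *v w y)) (at y)"
    by (intro bounded_bilinear.has_vector_derivative[OF bounded_bilinear_matrix_vector_mult]
        matrix_exp_has_vector_derivative assms)
  from bounded_linear.has_vector_derivative[OF bounded_linear_inner_right[of u] this] show ?thesis
    by (simp add: has_real_derivative_iff_has_vector_derivative matrix_exp_commute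
        matrix_vector_mul_assoc matrix_vector_right_distrib add.commute)
qed

lemma continuous_on_matrix_exp: "continuous_on S (\<lambda>x. mexp A x)"
  by (rule continuous_at_imp_continuous_on)
     (use matrix_exp_has_vector_derivative has_vector_derivative_continuous in blast)

subsection \<open>Subgenerators\<close>

definition metzler :: "real^'n^'n \<Rightarrow> bool" where
  "metzler A \<longleftrightarrow> (\<forall>i j. i \<noteq> j \<longrightarrow> 0 \<le> A $ i $ j)"

lemma matrix_exp_entry: "axis i 1 \<bullet> (M *v axis j 1) = (M :: real^'n^'m) $ i $ j"
  unfolding matrix_vector_mult_basis inner_axis' by (simp add: column_def)

lemma matrix_exp_backward_deriv:
  "((\<lambda>y. mexp B (x - y) *v v) has_vector_derivative - (B *v (mexp B (x - y) *v v))) (at y)"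
proof -
  have "((\<lambda>y. mexp B (x - y)) has_vector_derivative (- 1) *\<^sub>R (B ** mexp B (x - y))) (at y)"
    by (rule vector_diff_chain_at[unfolded o_def, OF _ matrix_exp_has_vector_derivative])
       (auto intro!: derivative_eq_intros)
  then show ?thesis
    using bounded_linear.has_vector_derivative[OF bounded_bilinear.bounded_linear_left[OF
          bounded_bilinear_matrix_vector_mult, of v]]
    by (fastforce simp: matrix_vector_mul_assoc mv_minus_left)
qed

text \<open>The curve exp(y(A + c)) exp(-cy) exp((x - y)A) joins the two sides as y runs from 0 to
  x. Its derivative vanishes because the \<open>c\<close> from the shifted matrix cancels the one
  from the scalar factor.\<close>

lemma matrix_exp_scaled_shift: "mexp A x $ i $ j = exp (- c * x) * mexp (A + mat c) x $ i $ j"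
proof -
  define g where "g = (\<lambda>y. axis i 1 \<bullet> (mexp (A + mat c) y *v
      (exp (- c * y) *\<^sub>R (mexp A (x - y) *v axis j 1))))"
  have "(g has_real_derivative 0) (at y)" for y
  proof -
    let ?E = "mexp A (x - y) *v axis j 1"
    have d2: "((\<lambda>y. exp (- c * y)) has_real_derivative (- c * exp (- c * y))) (at y)"
      by (auto intro!: derivative_eq_intros)
    have "((\<lambda>y. exp (- c * y) *\<^sub>R (mexp A (x - y) *v axis j 1)) has_vector_derivative
         (exp (- c * y) *\<^sub>R (- (A *v ?E)) + (- c * exp (- c * y)) *\<^sub>R ?E)) (at y)"
      by (rule has_vector_derivative_scaleR[OF d2 matrix_exp_backward_deriv])
    from matrix_exp_product_deriv[OF this, of "axis i 1" "A + mat c"] show ?thesis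
      unfolding g_def
      by (simp add: mv_add_left mv_scaleR_right mat_mult_vector mult.commute scaleR_add_right)
  qed
  then have "g 0 = g x" by (metis DERIV_isconst_all)
  moreover have "g 0 = mexp A x $ i $ j"
    by (simp add: g_def matrix_exp_entry)
  moreover have "g x = exp (- c * x) * mexp (A + mat c) x $ i $ j"
    by (simp add: g_def matrix_exp_entry mv_scaleR_right)
  ultimately show ?thesis by simp
qed

lemma mat_pow_nonneg:
  assumes "\<And>i j. 0 \<le> A $ i $ j" shows "0 \<le> mat_pow A n $ i $ j"
  using assms by (induction n arbitrary: i j) (auto simp: mat_def matrix_matrix_mult_def intro!: sum_nonneg)

lemma matrix_exp_nonneg:
  fixes A :: "real^'n^'n"
  assumes "metzler A" "0 \<le> x"
  shows "0 \<le> mexp A x $ i $ j"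
proof -
  \<comment> \<open>The sum of the absolute diagonal entries is a shift that makes the whole
    diagonal nonnegative. Then every term of the series is nonnegative, and undoing the shift only
    multiplies by a positive number.\<close>
  define c where "c = (\<Sum>i\<in>UNIV. \<bar>A $ i $ i\<bar>)"
  have c: "\<bar>A $ i $ i\<bar> \<le> c" for i
    unfolding c_def by (rule member_le_sum) auto
  have "0 \<le> (A + mat c) $ i $ j" for i j
    using assms(1) c[of i] by (auto simp: metzler_def mat_def)
  then have "0 \<le> mat_pow (A + mat c) n $ i $ j" for n i j
    using mat_pow_nonneg by blast
  then have "0 \<le> mexp (A + mat c) x $ i $ j"
    using sums_matrix_exp_nth[of "A + mat c" i j x] assms(2)
    by (elim sums_le[OF _ sums_zero, rotated]) simp
  then show ?thesis using matrix_exp_scaled_shift[of x A i j c] by simp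
qed

lemma matrix_exp_vector_nonneg:
  assumes "metzler A" "0 \<le> x" "\<And>i. 0 \<le> v $ i"
  shows "0 \<le> (mexp A x *v v) $ i"
  unfolding matrix_vector_mult_def
  using matrix_exp_nonneg[OF assms(1,2)] assms(3) by (auto intro!: sum_nonneg)

lemma matrix_exp_form_nonneg:
  assumes "metzler A" "0 \<le> x" "\<And>i. 0 \<le> u $ i" "\<And>i. 0 \<le> v $ i"
  shows "0 \<le> u \<bullet> (mexp A x *v v)"
  unfolding inner_vec_def
  using matrix_exp_vector_nonneg[OF assms(1,2,4)] assms(3) by (auto intro!: sum_nonneg)

definition subgenerator :: "real^'n^'n \<Rightarrow> bool" where
  "subgenerator A \<longleftrightarrow> metzler A \<and> (\<forall>i. (A *v 1) $ i \<le> 0)"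

text \<open>The row sums start at 1, and their derivative is exp(yA)(A 1), a nonnegative matrix
  applied to a nonpositive vector.\<close>

lemma subgenerator_exp_row_sum:
  assumes "subgenerator A" "0 \<le> x"
  shows "(mexp A x *v 1) $ i \<le> 1"
proof -
  define g where "g = (\<lambda>x. axis i 1 \<bullet> (mexp A x *v 1))"
  have "g x \<le> g 0"
  proof (rule DERIV_nonpos_imp_nonincreasing[OF assms(2)])
    fix y assume "0 \<le> y" "y \<le> x"
    have "0 \<le> axis i 1 \<bullet> (mexp A y *v (- (A *v 1)))"
      using assms \<open>0 \<le> y\<close> by (intro matrix_exp_form_nonneg) (auto simp: subgenerator_def axis_def)
    then have "axis i 1 \<bullet> (mexp A y *v (A *v 1)) \<le> 0"
      by (simp add: mv_minus_right)
    then show "\<exists>d. (g has_real_derivative d) (at y) \<and> d \<le> 0"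
      unfolding g_def using matrix_exp_form_deriv by blast
  qed
  then show ?thesis by (simp add: g_def inner_axis')
qed

lemma subgenerator_exp_abs_le:
  assumes "subgenerator A" "0 \<le> x" "\<And>j. \<bar>v $ j\<bar> \<le> 1"
  shows "\<bar>(mexp A x *v v) $ i\<bar> \<le> 1"
proof -
  have nn: "0 \<le> mexp A x $ i $ j" for j
    using assms by (intro matrix_exp_nonneg) (auto simp: subgenerator_def)
  have "\<bar>(mexp A x *v v) $ i\<bar> \<le> (\<Sum>j\<in>UNIV. \<bar>mexp A x $ i $ j * v $ j\<bar>)"
    by (simp add: matrix_vector_mult_def sum_abs)
  also have "\<dots> \<le> (\<Sum>j\<in>UNIV. mexp A x $ i $ j * 1)"
    using nn assms(3) by (intro sum_mono) (auto simp: abs_mult intro!: mult_left_le)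
  also have "\<dots> = (mexp A x *v 1) $ i"
    by (simp add: matrix_vector_mult_def)
  also have "\<dots> \<le> 1" by (rule subgenerator_exp_row_sum[OF assms(1,2)])
  finally show ?thesis .
qed

lemma subgenerator_exp_le_1:
  assumes "subgenerator A" "0 \<le> x"
  shows "\<bar>mexp A x $ i $ j\<bar> \<le> 1"
proof -
  have "\<bar>(mexp A x *v axis j 1) $ i\<bar> \<le> 1"
    by (rule subgenerator_exp_abs_le[OF assms]) (simp add: axis_def)
  then show ?thesis unfolding matrix_vector_mult_basis by (simp add: column_def)
qed

text \<open>The vector of signs turns the norm into a linear functional, which commutes with the
  integral over the law of the infimum.\<close>

lemma l1_norm_conv_inner: "l1_norm v = v \<bullet> (\<chi> j. sgn (v $ j))"
  by (auto simp: l1_norm_def inner_vec_def abs_sgn mult.commute intro!: sum.cong)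

lemma abs_inner_le_l1_norm: "(\<And>j. \<bar>z $ j\<bar> \<le> 1) \<Longrightarrow> \<bar>d \<bullet> z\<bar> \<le> l1_norm d"
  unfolding l1_norm_def inner_vec_def
  by (rule order_trans[OF sum_abs], rule sum_mono) (auto simp: abs_mult intro: mult_left_le)

lemma vector_matrix_diff_right: "(u :: real^'n) v* (A - B) = u v* A - u v* B"
  by (simp add: vector_matrix_mult_def vec_eq_iff sum_subtractf algebra_simps)

lemma outer_product_mult_vector: "outer_product v w *v z = (w \<bullet> z) *\<^sub>R v"
  by (simp add: outer_product_def matrix_vector_mult_def vec_eq_iff inner_vec_def sum_distrib_left
      mult_ac)

text \<open>In \<open>y\<close>, the derivative of \<open>u exp(y A) exp((x - y) B) s\<close> is \<open>u exp(y A) (A - B) exp((x - y) B) s\<close>, and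
  here \<open>A - B\<close> has rank one.\<close>

lemma exp_rank_one_perturbation:
  fixes A B :: "real^'n^'n"
  assumes A: "subgenerator A" and B: "subgenerator B" and AB: "A - B = outer_product m d"
    and u: "\<And>i. 0 \<le> u $ i" and m: "\<And>i. 0 \<le> m $ i"
    and h: "\<And>y. 0 \<le> y \<Longrightarrow> (h has_real_derivative h' y) (at y)"
    and h': "\<And>y. 0 \<le> y \<Longrightarrow> u \<bullet> (mexp A y *v m) \<le> h' y"
    and h0: "h 0 = 0" and x: "0 \<le> x" and s: "\<And>j. \<bar>s $ j\<bar> \<le> 1"
  shows "u \<bullet> (mexp A x *v s) - u \<bullet> (mexp B x *v s) \<le> h x * l1_norm d"
proof -
  \<comment> \<open>Subtracting the bound turns the integral form of the estimate into monotonicity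
    in \<open>y\<close>. The vector \<open>z\<close> below stays in the unit ball of the maximum
    norm because \<open>B\<close> is a subgenerator, so its pairing with \<open>d\<close> costs only
    \<open>l1_norm d\<close>.\<close>
  define g where "g = (\<lambda>y. u \<bullet> (mexp A y *v (mexp B (x - y) *v s)) - h y * l1_norm d)"
  have "g x \<le> g 0"
  proof (rule DERIV_nonpos_imp_nonincreasing[OF x])
    fix y assume y: "0 \<le> y" "y \<le> x"
    define z where "z = mexp B (x - y) *v s"
    have z: "\<bar>z $ j\<bar> \<le> 1" for j
      unfolding z_def using y s by (intro subgenerator_exp_abs_le[OF B]) auto
    let ?p = "u \<bullet> (mexp A y *v m)"
    have "(g has_real_derivative (u \<bullet> (mexp A y *v (A *v z + - (B *v z))) - h' y * l1_norm d)) (at y)"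
      unfolding g_def z_def
      by (intro DERIV_diff matrix_exp_product_deriv matrix_exp_backward_deriv DERIV_cmult_right h y)
    also have "A *v z + - (B *v z) = (A - B) *v z" by (simp add: mv_diff_left)
    also have "\<dots> = (d \<bullet> z) *\<^sub>R m" unfolding AB by (rule outer_product_mult_vector)
    also have "u \<bullet> (mexp A y *v ((d \<bullet> z) *\<^sub>R m)) = (d \<bullet> z) * ?p"
      by (simp add: mv_scaleR_right)
    finally have der: "(g has_real_derivative (d \<bullet> z) * ?p - h' y * l1_norm d) (at y)" .
    have p: "0 \<le> ?p"
      using A u m y by (intro matrix_exp_form_nonneg) (auto simp: subgenerator_def)
    have "(d \<bullet> z) * ?p \<le> l1_norm d * ?p"
      using abs_inner_le_l1_norm[OF z, of d] p by (intro mult_right_mono) auto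
    also have "\<dots> \<le> l1_norm d * h' y"
      using h'[OF y(1)] by (intro mult_left_mono) (auto simp: l1_norm_def sum_nonneg)
    finally show "\<exists>D. (g has_real_derivative D) (at y) \<and> D \<le> 0"
      using der by (intro exI[of _ "(d \<bullet> z) * ?p - h' y * l1_norm d"]) (auto simp: mult.commute)
  qed
  then show ?thesis by (simp add: g_def h0)
qed

lemma norm_matrix_le:
  fixes A :: "real^'n^'m"
  assumes "\<And>i j. \<bar>A $ i $ j\<bar> \<le> B"
  shows "norm A \<le> real CARD('m) * (real CARD('n) * B)"
proof -
  have "norm A \<le> (\<Sum>i\<in>UNIV. norm (A $ i))"
    unfolding norm_vec_def by (rule L2_set_le_sum) simp
  also have "\<dots> \<le> (\<Sum>i\<in>(UNIV :: 'm set). real CARD('n) * B)"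
  proof (rule sum_mono)
    fix i
    have "norm (A $ i) \<le> (\<Sum>j\<in>UNIV. \<bar>A $ i $ j\<bar>)" by (rule norm_le_l1_cart)
    also have "\<dots> \<le> (\<Sum>j\<in>(UNIV :: 'n set). B)" by (intro sum_mono assms)
    finally show "norm (A $ i) \<le> real CARD('n) * B" by simp
  qed
  finally show ?thesis by simp
qed

text \<open>The generator \<open>M\<close> with the killing replaced by a jump to a state drawn from \<open>\<eta>\<close>.\<close>

abbreviation recycled :: "real^'n^'n \<Rightarrow> real^'n \<Rightarrow> real^'n^'n" where
  "recycled M \<eta> \<equiv> M + outer_product (- (M *v 1)) \<eta>"

lemma subgenerator_recycled:
  fixes M :: "real^'n^'n"
  assumes M: "metzler M" and m: "\<And>i. (M *v 1) $ i \<le> 0" and \<eta>: "\<eta> \<in> subprob_vectors"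
  shows "subgenerator (recycled M \<eta>)"
  unfolding subgenerator_def
proof (intro conjI allI)
  show "metzler (recycled M \<eta>)"
    unfolding metzler_def
  proof (intro allI impI)
    fix i j :: 'n assume "i \<noteq> j"
    then have "0 \<le> M $ i $ j" "(M *v 1) $ i * \<eta> $ j \<le> 0"
      using M m[of i] \<eta> by (auto simp: metzler_def subprob_vectors_def intro!: mult_nonpos_nonneg)
    then show "0 \<le> (recycled M \<eta>) $ i $ j"
      by (simp add: outer_product_def)
  qed
  fix i
  have "((recycled M \<eta>) *v 1) $ i = (M *v 1) $ i * (1 - (\<Sum>j\<in>UNIV. \<eta> $ j))"
    by (simp add: mv_add_left outer_product_mult_vector inner_vec_def algebra_simps)
  also have "\<dots> \<le> 0"
    using m[of i] \<eta> by (intro mult_nonpos_nonneg) (auto simp: subprob_vectors_def)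
  finally show "((recycled M \<eta>) *v 1) $ i \<le> 0" .
qed

lemma set_integrable_matrix_exp:
  assumes "finite_measure \<mu>" "sets \<mu> = sets borel" "subgenerator A"
  shows "set_integrable \<mu> {0..} (\<lambda>x. mexp A x)"
  unfolding set_integrable_def
proof (rule finite_measure.integrable_const_bound[OF assms(1)])
  show "AE x in \<mu>. norm (indicator {0..} x *\<^sub>R mexp A x) \<le> real CARD('a) * (real CARD('a) * 1)"
    using norm_matrix_le[OF subgenerator_exp_le_1[OF assms(3)]]
    by (intro AE_I2) (auto simp: indicator_def)
  have "(\<lambda>x. mexp A x) \<in> borel_measurable borel"
    by (intro borel_measurable_continuous_onI continuous_on_matrix_exp)
  then show "(\<lambda>x. indicator {0..} x *\<^sub>R mexp A x) \<in> borel_measurable \<mu>"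
    using assms(2) by (auto simp: measurable_cong_sets[OF assms(2) refl])
qed

text \<open>\<open>h'\<close> bounds, for all \<eta> at once, the rate of exits at time y of the
  recycled chain started from \<open>u\<close>, so \<open>h x\<close> bounds the expected number of
  exits up to x. Integrating the perturbation estimate over \<mu> gives the factor \<open>C\<close>;
  what distinguishes the two cases of the theorem is the choice of \<open>h\<close>.\<close>

lemma l1_contraction_mixture_map:
  fixes M :: "real^'n^'n"
  assumes M: "metzler M" and m: "\<And>i. (M *v 1) $ i \<le> 0"
    and \<mu>: "finite_measure \<mu>" "sets \<mu> = sets borel"
    and u: "\<And>i. 0 \<le> u $ i" and c: "0 \<le> c"
    and h: "\<And>y. 0 \<le> y \<Longrightarrow> (h has_real_derivative h' y) (at y)"
    and h': "\<And>\<eta> y. \<eta> \<in> subprob_vectors \<Longrightarrow> 0 \<le> y \<Longrightarrow>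
      u \<bullet> (mexp (recycled M \<eta>) y *v (- (M *v 1))) \<le> h' y"
    and h0: "h 0 = 0" and hm: "h \<in> borel_measurable borel"
    and C: "(\<integral>\<^sup>+x\<in>{0..}. ennreal (h x) \<partial>\<mu>) \<le> ennreal C" "0 \<le> C" "c * C < 1"
  shows "l1_contraction_on subprob_vectors (mixture_map c u M \<mu>)"
  unfolding l1_contraction_on_def
proof (intro exI[of _ "c * C"] conjI ballI C(3))
  fix \<eta> \<eta>' :: "real^'n" assume \<eta>: "\<eta> \<in> subprob_vectors" "\<eta>' \<in> subprob_vectors"
  define F where "F = (\<lambda>\<eta> x. mexp (recycled M \<eta>) x)"
  have sg: "subgenerator (recycled M \<eta>)" if "\<eta> \<in> subprob_vectors" for \<eta>
    by (rule subgenerator_recycled[OF M m that])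
  have int: "set_integrable \<mu> {0..} (F \<eta>)" if "\<eta> \<in> subprob_vectors" for \<eta>
    unfolding F_def by (rule set_integrable_matrix_exp[OF \<mu> sg[OF that]])
  let ?d = "\<eta> - \<eta>'"
  define D where "D = (LINT x:{0..}|\<mu>. F \<eta> x - F \<eta>' x)"
  define w where "w = u v* D"
  \<comment> \<open>A single test vector, taken from the integrated difference, is used at every x;
    this is what reduces the l1-norm of the integral to scalar estimates of the integrand.\<close>
  define s :: "real^'n" where "s = (\<chi> j. sgn (w $ j))"
  have s: "\<bar>s $ j\<bar> \<le> 1" for j by (simp add: s_def sgn_if)
  \<comment> \<open>\<open>h'\<close> dominates a nonnegative form, so \<open>h\<close> grows from
    0. This lets the bound on the nonnegative integral control the Bochner integral of
    \<open>h\<close>.\<close>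
  have h_nonneg: "0 \<le> h x" if "0 \<le> x" for x
  proof -
    have "h 0 \<le> h x"
    proof (rule DERIV_nonneg_imp_nondecreasing[OF that])
      fix y assume y: "0 \<le> y" "y \<le> x"
      have "0 \<le> u \<bullet> (F \<eta> y *v (- (M *v 1)))"
        unfolding F_def using sg[OF \<eta>(1)] u y m
        by (intro matrix_exp_form_nonneg) (auto simp: subgenerator_def)
      then show "\<exists>d. (h has_real_derivative d) (at y) \<and> 0 \<le> d"
        using h[OF y(1)] h'[OF \<eta>(1) y(1)] unfolding F_def by force
    qed
    then show ?thesis by (simp add: h0)
  qed
  have hint: "integrable \<mu> (\<lambda>x. indicator {0..} x * h x)"
  proof (rule integrableI_nonneg)
    show "(\<lambda>x. indicator {0..} x * h x) \<in> borel_measurable \<mu>"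
      using hm \<mu>(2) by (auto simp: measurable_cong_sets[OF \<mu>(2) refl])
    show "AE x in \<mu>. 0 \<le> indicator {0..} x * h x"
      using h_nonneg by (auto simp: indicator_def)
    have "(\<integral>\<^sup>+x. ennreal (indicator {0..} x * h x) \<partial>\<mu>) = (\<integral>\<^sup>+x\<in>{0..}. ennreal (h x) \<partial>\<mu>)"
      by (intro nn_integral_cong) (auto simp: indicator_def)
    then show "(\<integral>\<^sup>+x. ennreal (indicator {0..} x * h x) \<partial>\<mu>) < \<infinity>"
      using C(1) by (metis ennreal_less_top infinity_ennreal_def order_le_less_trans)
  qed
  have hC: "(LINT x|\<mu>. indicator {0..} x * h x) \<le> C"
  proof -
    have "(\<integral>\<^sup>+x. ennreal (indicator {0..} x * h x) \<partial>\<mu>) = (\<integral>\<^sup>+x\<in>{0..}. ennreal (h x) \<partial>\<mu>)"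
      by (intro nn_integral_cong) (auto simp: indicator_def)
    then have "ennreal (LINT x|\<mu>. indicator {0..} x * h x) \<le> ennreal C"
      using C(1) by (subst nn_integral_eq_integral[symmetric, OF hint]) (auto simp: indicator_def h_nonneg)
    then show ?thesis using C(2) by (simp add: ennreal_le_iff)
  qed
  have bl: "bounded_linear (\<lambda>X :: real^'n^'n. u \<bullet> (X *v s))"
    by (intro bounded_linear_compose[OF bounded_linear_inner_right, unfolded o_def]
        bounded_bilinear.bounded_linear_left[OF bounded_bilinear_matrix_vector_mult])
  have intD: "integrable \<mu> (\<lambda>x. indicator {0..} x *\<^sub>R (F \<eta> x - F \<eta>' x))"
    using set_integral_diff(1)[OF int[OF \<eta>(1)] int[OF \<eta>(2)]] by (simp add: set_integrable_def)
  have "l1_norm w = u \<bullet> (D *v s)"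
    by (simp add: l1_norm_conv_inner w_def s_def dot_lmul_matrix)
  also have "\<dots> = (LINT x|\<mu>. u \<bullet> ((indicator {0..} x *\<^sub>R (F \<eta> x - F \<eta>' x)) *v s))"
    unfolding D_def set_lebesgue_integral_def
    by (rule integral_bounded_linear[OF bl intD, symmetric])
  also have "\<dots> \<le> (LINT x|\<mu>. (indicator {0..} x * h x) * l1_norm ?d)"
  proof (rule integral_mono)
    show "integrable \<mu> (\<lambda>x. u \<bullet> ((indicator {0..} x *\<^sub>R (F \<eta> x - F \<eta>' x)) *v s))"
      by (rule integrable_bounded_linear[OF bl intD])
    show "integrable \<mu> (\<lambda>x. indicator {0..} x * h x * l1_norm ?d)"
      using hint by simp
    fix x :: real
    have "u \<bullet> (F \<eta> x *v s) - u \<bullet> (F \<eta>' x *v s) \<le> h x * l1_norm ?d" if "0 \<le> x"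
      unfolding F_def
    proof (rule exp_rank_one_perturbation[OF sg[OF \<eta>(1)] sg[OF \<eta>(2)] _ u _ h h'[OF \<eta>(1)] h0 that s])
      show "recycled M \<eta> - (recycled M \<eta>')
          = outer_product (- (M *v 1)) ?d"
        by (simp add: outer_product_def vec_eq_iff algebra_simps)
    qed (use m in auto)
    then show "u \<bullet> ((indicator {0..} x *\<^sub>R (F \<eta> x - F \<eta>' x)) *v s) \<le> indicator {0..} x * h x * l1_norm ?d"
      by (auto simp: indicator_def mv_diff_left inner_diff_right)
  qed
  also have "\<dots> = (LINT x|\<mu>. indicator {0..} x * h x) * l1_norm ?d"
    by simp
  also have "\<dots> \<le> C * l1_norm ?d"
    using hC by (intro mult_right_mono) (auto simp: l1_norm_def sum_nonneg)
  finally have le: "l1_norm w \<le> C * l1_norm ?d" .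
  have "mixture_map c u M \<mu> \<eta> - mixture_map c u M \<mu> \<eta>' = c *\<^sub>R w"
  proof -
    have "D = (LINT x:{0..}|\<mu>. F \<eta> x) - (LINT x:{0..}|\<mu>. F \<eta>' x)"
      unfolding D_def by (rule set_integral_diff(2)[OF int[OF \<eta>(1)] int[OF \<eta>(2)]])
    then show ?thesis
      unfolding mixture_map_def w_def F_def by (simp add: vector_matrix_diff_right scaleR_diff_right)
  qed
  then have "l1_norm (mixture_map c u M \<mu> \<eta> - mixture_map c u M \<mu> \<eta>') = c * l1_norm w"
    using c by (simp add: l1_norm_def abs_mult sum_distrib_left)
  also have "\<dots> \<le> c * (C * l1_norm ?d)"
    using le c by (rule mult_left_mono)
  finally show "l1_norm (mixture_map c u M \<mu> \<eta> - mixture_map c u M \<mu> \<eta>') \<le> c * C * l1_norm ?d"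
    by simp
qed

subsection \<open>Block generators\<close>

lemma sum_UNIV_option:
  "(\<Sum>i\<in>UNIV. f i) = f None + (\<Sum>j\<in>UNIV. f (Some (j :: 'm::finite)))"
  by (simp add: UNIV_option_conv sum.reindex)

lemma block_generator_mult_vector:
  "(block_generator \<phi> t T *v v) $ None = - \<phi> * v $ None"
  "(block_generator \<phi> t T *v v) $ Some i = t $ i * v $ None + (T *v (\<chi> j. v $ Some j)) $ i"
  by (simp_all add: block_generator_def matrix_vector_mult_def sum_UNIV_option)

lemma metzler_block_generator:
  assumes "metzler T" "\<And>i. 0 \<le> t $ i"
  shows "metzler (block_generator \<phi> t T)"
  using assms by (auto simp: metzler_def block_generator_def split: option.splits)

lemma vec_lambda_one: "(\<chi> j. 1) = (1 :: real^'m)"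
  by (simp add: vec_eq_iff)

text \<open>The rows of (t, T) sum to 0, so the chain can be left only from the additional
  state.\<close>

lemma block_generator_exit:
  assumes "\<And>i. t $ i + (T *v 1) $ i = 0"
  shows "- (block_generator \<phi> t T *v 1) = \<phi> *\<^sub>R axis None 1"
proof -
  have "(block_generator \<phi> t T *v 1) $ i = (- (\<phi> *\<^sub>R axis None 1)) $ i" for i
    using assms by (cases i) (auto simp: block_generator_mult_vector vec_lambda_one axis_def)
  then show ?thesis by (simp add: vec_eq_iff)
qed

lemma phase_type_params_metzler:
  assumes "phase_type_params \<alpha> T"
  shows "metzler T" "\<And>i. 0 \<le> exit_vector T $ i" "subgenerator T"
  using assms
  by (auto simp: phase_type_params_def metzler_def exit_vector_def matrix_vector_mult_def subgenerator_def)

text \<open>The additional state is occupied with probability at most 1 at any time, so exits occur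
  at rate at most \<phi>, and their expected number up to x is at most \<phi> x. With the bound 1 /
  \<phi> on the mean of \<mu> the contraction factor is \<open>c\<close> itself.\<close>

lemma l1_contraction_block_generator:
  assumes par: "phase_type_params \<alpha> T" and \<phi>: "0 < \<phi>"
    and \<mu>: "finite_measure \<mu>" "sets \<mu> = sets borel" and c: "0 \<le> c" "c < 1"
    and mean: "(\<integral>\<^sup>+x\<in>{0..}. ennreal x \<partial>\<mu>) \<le> ennreal (1 / \<phi>)"
  shows "l1_contraction_on subprob_vectors
      (mixture_map c (extend_row \<alpha>) (block_generator \<phi> (exit_vector T) T) \<mu>)"
proof -
  let ?M = "block_generator \<phi> (exit_vector T) T"
  have ex: "- (?M *v 1) = \<phi> *\<^sub>R axis None 1"
    by (rule block_generator_exit) (simp add: exit_vector_def)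
  have M: "metzler ?M"
    by (intro metzler_block_generator phase_type_params_metzler[OF par])
  have m: "(?M *v 1) $ i \<le> 0" for i
    using arg_cong[OF ex, of "\<lambda>v. v $ i"] \<phi> by (cases i) (auto simp: axis_def)
  have u: "0 \<le> extend_row \<alpha> $ i" for i
    using par by (auto simp: extend_row_def phase_type_params_def split: option.splits)
  have u1: "(\<Sum>i\<in>UNIV. extend_row \<alpha> $ i) = 1"
    using par by (simp add: sum_UNIV_option) (simp add: extend_row_def phase_type_params_def)
  show ?thesis
  proof (rule l1_contraction_mixture_map[OF M m \<mu> u c(1), where h = "\<lambda>x. \<phi> * x" and h' = "\<lambda>_. \<phi>" and C = 1])
    fix \<eta> :: "real^('a option)" and y :: real assume \<eta>: "\<eta> \<in> subprob_vectors" "0 \<le> y"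
    let ?E = "mexp (recycled ?M \<eta>) y"
    have "\<bar>(?E *v axis None 1) $ i\<bar> \<le> 1" for i
      by (rule subgenerator_exp_abs_le[OF subgenerator_recycled[OF M m \<eta>(1)] \<eta>(2)]) (simp add: axis_def)
    then have "extend_row \<alpha> \<bullet> (?E *v axis None 1) \<le> (\<Sum>i\<in>UNIV. extend_row \<alpha> $ i * 1)"
      unfolding inner_vec_def using u by (intro sum_mono) (auto intro!: mult_left_le simp: abs_le_iff)
    then have "extend_row \<alpha> \<bullet> (?E *v axis None 1) \<le> 1" by (simp add: u1)
    then show "extend_row \<alpha> \<bullet> (?E *v (- (?M *v 1))) \<le> \<phi>"
      using \<phi> unfolding ex by (simp add: mv_scaleR_right)
  next
    have "(\<integral>\<^sup>+x\<in>{0..}. ennreal (\<phi> * x) \<partial>\<mu>) = (\<integral>\<^sup>+x. ennreal \<phi> * (ennreal x * indicator {0..} x) \<partial>\<mu>)"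
      using \<phi> by (intro nn_integral_cong) (auto simp: ennreal_mult indicator_def)
    also have "\<dots> = ennreal \<phi> * (\<integral>\<^sup>+x\<in>{0..}. ennreal x \<partial>\<mu>)"
      by (intro nn_integral_cmult) (auto simp: measurable_cong_sets[OF \<mu>(2) refl])
    also have "\<dots> \<le> ennreal \<phi> * ennreal (1 / \<phi>)" by (intro mult_left_mono mean) auto
    also have "\<dots> = ennreal 1" using \<phi> by (simp add: ennreal_mult[symmetric])
    finally show "(\<integral>\<^sup>+x\<in>{0..}. ennreal (\<phi> * x) \<partial>\<mu>) \<le> ennreal 1" .
  qed (use c in \<open>auto intro!: derivative_eq_intros\<close>)
qed

subsection \<open>Layer cake formula\<close>

text \<open>F x is the integral of \<open>f\<close> over [0, x], and the two integrals are
  exchanged. An open or a closed tail changes the inner integral only at the point y = x, a null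
  set. Both forms occur because the tilted tail comparison has an open tail on one side and a closed
  one on the other.\<close>

lemma nn_integral_layer_cake:
  fixes f F :: "real \<Rightarrow> real"
  assumes \<mu>: "finite_measure \<mu>" "sets \<mu> = sets borel"
    and f: "f \<in> borel_measurable borel" "\<And>y. 0 \<le> y \<Longrightarrow> 0 \<le> f y"
    and F: "\<And>y. 0 \<le> y \<Longrightarrow> (F has_real_derivative f y) (at y)" "F 0 = 0"
  shows nn_integral_layer_cake_closed:
      "(\<integral>\<^sup>+x\<in>{0..}. ennreal (F x) \<partial>\<mu>) = (\<integral>\<^sup>+y\<in>{0..}. ennreal (f y) * emeasure \<mu> {y..} \<partial>lborel)"
    and nn_integral_layer_cake_open:
      "(\<integral>\<^sup>+x\<in>{0..}. ennreal (F x) \<partial>\<mu>) = (\<integral>\<^sup>+y\<in>{0..}. ennreal (f y) * emeasure \<mu> {y<..} \<partial>lborel)"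
proof -
  interpret finite_measure \<mu> by (rule \<mu>(1))
  interpret pair_sigma_finite \<mu> lborel ..
  note [measurable_cong] = \<mu>(2)
  note [measurable] = f(1)
  have FTC: "ennreal (F x) = (\<integral>\<^sup>+y. ennreal (f y) * indicator {0..x} y \<partial>lborel)" if "0 \<le> x" for x
    using nn_integral_FTC_Icc[of f 0 x F] f F that by (auto simp: has_field_derivative_at_within)
  have main: "(\<integral>\<^sup>+x\<in>{0..}. ennreal (F x) \<partial>\<mu>) = (\<integral>\<^sup>+y\<in>{0..}. ennreal (f y) * emeasure \<mu> (R y) \<partial>lborel)"
    if R: "\<And>y. {y<..} \<subseteq> R y" "\<And>y. R y \<subseteq> {y..}" "\<And>y. R y \<in> sets borel"
      and meas: "(\<lambda>(y, x). indicator (R y) x :: ennreal) \<in> borel_measurable (lborel \<Otimes>\<^sub>M \<mu>)"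
    for R :: "real \<Rightarrow> real set"
  proof -
    have meas': "(\<lambda>(x, y). indicator (R y) x :: ennreal) \<in> borel_measurable (\<mu> \<Otimes>\<^sub>M lborel)"
      using measurable_pair_swap[OF meas] by (simp add: split_beta')
    let ?k = "\<lambda>x y. ennreal (f y) * indicator {0..} y * indicator (R y) x"
    have "(\<integral>\<^sup>+x\<in>{0..}. ennreal (F x) \<partial>\<mu>) = (\<integral>\<^sup>+x. (\<integral>\<^sup>+y. ?k x y \<partial>lborel) \<partial>\<mu>)"
    proof (intro nn_integral_cong)
      fix x :: real
      have "AE y in lborel. y \<noteq> x" by (rule AE_lborel_singleton)
      then have "(\<integral>\<^sup>+y. ennreal (f y) * indicator {0..x} y \<partial>lborel) = (\<integral>\<^sup>+y. ?k x y \<partial>lborel)"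
        using R(1,2) by (intro nn_integral_cong_AE) (auto simp: indicator_def subset_eq)
      moreover have "(\<integral>\<^sup>+y. ?k x y \<partial>lborel) = 0" if "x < 0"
      proof -
        have "?k x y = 0" for y using that R(2)[of y] by (auto simp: indicator_def subset_eq)
        then show ?thesis by (simp only: nn_integral_const mult_zero_left)
      qed
      ultimately show "ennreal (F x) * indicator {0..} x = (\<integral>\<^sup>+y. ?k x y \<partial>lborel)"
        using FTC[of x] by (cases "0 \<le> x") auto
    qed
    also have "\<dots> = (\<integral>\<^sup>+y. (\<integral>\<^sup>+x. ?k x y \<partial>\<mu>) \<partial>lborel)"
      using meas' by (intro Fubini'[symmetric]) (simp add: split_beta')
    also have "\<dots> = (\<integral>\<^sup>+y\<in>{0..}. ennreal (f y) * emeasure \<mu> (R y) \<partial>lborel)"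
    proof (intro nn_integral_cong)
      fix y :: real
      have "(\<integral>\<^sup>+x. ?k x y \<partial>\<mu>) = ennreal (f y) * indicator {0..} y * emeasure \<mu> (R y)"
        using R(3)[of y] \<mu>(2) by (intro nn_integral_cmult_indicator) simp
      then show "(\<integral>\<^sup>+x. ?k x y \<partial>\<mu>) = ennreal (f y) * emeasure \<mu> (R y) * indicator {0..} y"
        by (simp only: mult_ac)
    qed
    finally show ?thesis .
  qed
  have eq: "(\<lambda>(y :: real, x). indicator {y..} x :: ennreal) = (\<lambda>(y, x). if y \<le> x then 1 else 0)"
    "(\<lambda>(y :: real, x). indicator {y<..} x :: ennreal) = (\<lambda>(y, x). if y < x then 1 else 0)"
    by (auto simp: fun_eq_iff indicator_def)
  show "(\<integral>\<^sup>+x\<in>{0..}. ennreal (F x) \<partial>\<mu>) = (\<integral>\<^sup>+y\<in>{0..}. ennreal (f y) * emeasure \<mu> {y..} \<partial>lborel)"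
    by (rule main) (auto simp: eq)
  show "(\<integral>\<^sup>+x\<in>{0..}. ennreal (F x) \<partial>\<mu>) = (\<integral>\<^sup>+y\<in>{0..}. ennreal (f y) * emeasure \<mu> {y<..} \<partial>lborel)"
    by (rule main) (auto simp: eq)
qed

lemma matrix_inv_eqI:
  assumes "A ** B = mat 1" "B ** A = mat 1"
  shows "matrix_inv A = (B :: real^'n^'n)"
proof -
  have "A ** matrix_inv A = mat 1 \<and> matrix_inv A ** A = mat 1"
    unfolding matrix_inv_def by (rule someI[of _ B]) (use assms in auto)
  then have "B ** (A ** matrix_inv A) = B" by simp
  then show ?thesis by (simp add: matrix_mul_assoc assms)
qed

text \<open>The weighted exponential exp(gy) exp(yA) has the generator A + g, so derivatives become
  explicit for vectors on which A + g acts simply, such as \<open>k\<close>, \<open>l\<close> and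
  \<open>k - 1\<close> below.\<close>

lemma scaled_form_deriv:
  "((\<lambda>y. exp (g * y) * (u \<bullet> (mexp A y *v v))) has_real_derivative
     exp (g * y) * (u \<bullet> (mexp A y *v (A *v v + g *\<^sub>R v)))) (at y)"
proof -
  have "((\<lambda>y. exp (g * y)) has_real_derivative g * exp (g * y)) (at y)"
    by (auto intro!: derivative_eq_intros)
  from DERIV_mult[OF this matrix_exp_form_deriv[of u A v y]] show ?thesis
    by (simp add: mv_add_right mv_scaleR_right inner_add_right algebra_simps)
qed

subsection \<open>The tilted block generator\<close>

lemma diag_matrix_mult:
  "(diag_matrix k ** A) $ i $ j = k $ i * A $ i $ j" "(A ** diag_matrix k) $ i $ j = A $ i $ j * k $ j"
  by (simp_all add: diag_matrix_def matrix_matrix_mult_def if_distrib if_distribR sum.delta' sum.delta cong: if_cong)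

lemma diag_matrix_mult_vector: "(diag_matrix k *v v) $ i = k $ i * v $ i"
  by (simp add: diag_matrix_def matrix_vector_mult_def if_distrib if_distribR sum.delta' cong: if_cong)

lemma vector_mult_diag_matrix: "(v v* diag_matrix k) $ i = v $ i * k $ i"
  by (simp add: diag_matrix_def vector_matrix_mult_def if_distrib if_distribR sum.delta' sum.delta mult.commute cong: if_cong)

lemma matrix_inv_diag_matrix:
  fixes k :: "real^'n"
  assumes "\<And>i. k $ i \<noteq> 0"
  shows "matrix_inv (diag_matrix k) = diag_matrix (\<chi> i. 1 / k $ i)"
proof (rule matrix_inv_eqI)
  show "diag_matrix k ** diag_matrix (\<chi> i. 1 / k $ i) = mat 1"
    unfolding vec_eq_iff diag_matrix_mult using assms by (auto simp: diag_matrix_def mat_def)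
  show "diag_matrix (\<chi> i. 1 / k $ i) ** diag_matrix k = mat 1"
    unfolding vec_eq_iff diag_matrix_mult using assms by (auto simp: diag_matrix_def mat_def)
qed

text \<open>The survival function of the tilted jump bounds the probability of not having reached the
  additional state: \<open>w\<close> solves the backward equation of the chain killed there.\<close>

lemma tilted_occupation_bound:
  fixes T :: "real^'m^'m" and \<gamma> \<phi> :: real
  assumes par: "phase_type_params \<alpha> T" and \<phi>: "0 < \<phi>"
    and k1: "\<And>i. 1 \<le> k $ i" and Tk: "T *v k = - exit_vector T - \<gamma> *\<^sub>R k"
    and M_def: "M = block_generator \<phi> (diag_matrix (\<chi> i. 1 / k $ i) *v exit_vector T)
                (diag_matrix (\<chi> i. 1 / k $ i) ** T ** diag_matrix k + mat \<gamma>)"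
  shows "- (M *v 1) = \<phi> *\<^sub>R axis None 1" "metzler M" "\<And>i. (M *v 1) $ i \<le> 0"
    and "\<eta> \<in> subprob_vectors \<Longrightarrow> 0 \<le> y \<Longrightarrow>
      extend_row ((1 / (\<alpha> \<bullet> k)) *\<^sub>R (\<alpha> v* diag_matrix k)) \<bullet>
        (mexp (recycled M \<eta>) y *v (- (M *v 1)))
      \<le> \<phi> / (\<alpha> \<bullet> k) * (\<alpha> \<bullet> k - exp (\<gamma> * y) * (\<alpha> \<bullet> (mexp T y *v k)))"
proof -
  have k0: "k $ i > 0" for i using k1[of i] by simp
  define t' where "t' = diag_matrix (\<chi> i. 1 / k $ i) *v exit_vector T"
  define T' where "T' = diag_matrix (\<chi> i. 1 / k $ i) ** T ** diag_matrix k + mat \<gamma>"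
  have M: "M = block_generator \<phi> t' T'" by (simp add: M_def t'_def T'_def)
  have t': "t' $ i = exit_vector T $ i / k $ i" for i by (simp add: t'_def diag_matrix_mult_vector)
  have T'v: "(T' *v v) $ i = (T *v (\<chi> j. k $ j * v $ j)) $ i / k $ i + \<gamma> * v $ i" for v i
  proof -
    have "diag_matrix k *v v = (\<chi> j. k $ j * v $ j)" by (simp add: vec_eq_iff diag_matrix_mult_vector)
    then have "T' *v v = diag_matrix (\<chi> i. 1 / k $ i) *v (T *v (\<chi> j. k $ j * v $ j)) + \<gamma> *\<^sub>R v"
      by (simp add: T'_def mv_add_left mat_mult_vector matrix_vector_mul_assoc[symmetric])
    then show ?thesis by (simp add: diag_matrix_mult_vector)
  qed
  have kone: "(\<chi> j. k $ j * 1) = k" by (simp add: vec_eq_iff)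
  show ex: "- (M *v 1) = \<phi> *\<^sub>R axis None 1"
    unfolding M
  proof (rule block_generator_exit)
    fix i
    have "(T *v k) $ i = - exit_vector T $ i - \<gamma> * k $ i" by (simp add: Tk)
    then show "t' $ i + (T' *v 1) $ i = 0"
      using k0[of i] kone by (simp add: t' T'v field_simps)
  qed
  note met = phase_type_params_metzler(1)[OF par] and t0 = phase_type_params_metzler(2)[OF par]
  have "metzler T'"
    unfolding metzler_def
  proof (intro allI impI)
    fix i j :: 'm assume "i \<noteq> j"
    then show "0 \<le> T' $ i $ j"
      using met k0[of i] k0[of j]
      by (auto simp: T'_def diag_matrix_mult mat_def metzler_def intro!: mult_nonneg_nonneg divide_nonneg_pos)
  qed
  then show metM: "metzler M"
    unfolding M using k0 t0 by (intro metzler_block_generator) (auto simp: t' less_imp_le)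
  show m: "(M *v 1) $ i \<le> 0" for i
    using arg_cong[OF ex, of "\<lambda>v. v $ i"] \<phi> by (cases i) (auto simp: axis_def)
  assume \<eta>: "\<eta> \<in> subprob_vectors" and y: "0 \<le> y"
  define F where "F = \<alpha> \<bullet> k"
  have \<alpha>: "0 \<le> \<alpha> $ i" "(\<Sum>i\<in>UNIV. \<alpha> $ i) = 1" for i
    using par by (auto simp: phase_type_params_def)
  have "(\<Sum>i\<in>UNIV. \<alpha> $ i * 1) \<le> F"
    unfolding F_def inner_vec_def using \<alpha> k1 by (auto intro!: sum_mono mult_left_mono simp del: mult_1_right)
  then have F: "1 \<le> F" using \<alpha> by simp
  define u where "u = extend_row ((1 / F) *\<^sub>R (\<alpha> v* diag_matrix k))"
  have u_Some: "u $ Some j = \<alpha> $ j * k $ j / F" and u_None: "u $ None = 0" for j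
    by (simp_all add: u_def extend_row_def vector_mult_diag_matrix)
  have u: "0 \<le> u $ i" for i
    using \<alpha> k0 F by (cases i) (auto simp: u_None u_Some less_imp_le)
  have u1: "(\<Sum>i\<in>UNIV. u $ i) = 1"
    using F by (simp add: sum_UNIV_option u_None u_Some sum_divide_distrib[symmetric])
       (simp add: F_def inner_vec_def)
  define A where "A = recycled M \<eta>"
  have sg: "subgenerator A" unfolding A_def by (rule subgenerator_recycled[OF metM m \<eta>])
  \<comment> \<open>With k $ j read as the exponential moment at \<gamma> of a jump started in phase
    j, the entry \<open>Some j\<close> is the probability that this jump, tilted by \<gamma>,
    exceeds s. Division by k $ j undoes the diagonal similarity in the generator.\<close>
  define w :: "real \<Rightarrow> real^('m option)" where "w = (\<lambda>s. \<chi> i. case i of None \<Rightarrow> 0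
      | Some j \<Rightarrow> exp (\<gamma> * s) * (axis j 1 \<bullet> (mexp T s *v k)) / k $ j)"
  define w' :: "real \<Rightarrow> real^('m option)" where "w' = (\<lambda>s. \<chi> i. case i of None \<Rightarrow> 0
      | Some j \<Rightarrow> exp (\<gamma> * s) * (axis j 1 \<bullet> (mexp T s *v (T *v k + \<gamma> *\<^sub>R k))) / k $ j)"
  have wd: "(w has_vector_derivative w' s) (at s)" for s
  proof (rule has_vector_derivative_vec)
    fix i show "((\<lambda>x. w x $ i) has_vector_derivative w' s $ i) (at s)"
      unfolding w_def w'_def has_real_derivative_iff_has_vector_derivative[symmetric]
      by (cases i) (auto intro!: DERIV_cdivide scaled_form_deriv)
  qed
  have w_nonneg: "0 \<le> w s $ i" if "0 \<le> s" for s i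
    using matrix_exp_vector_nonneg[OF met that, of k] k0
    by (cases i) (auto simp: w_def inner_axis' less_imp_le)
  \<comment> \<open>In the jump phases equality holds. In the additional state recycling by \<eta>
    can only return mass to these phases, so the left side is nonnegative there while
    \<open>w'\<close> is 0.\<close>
  have Aw: "(A *v w s) $ i \<ge> w' s $ i" if "0 \<le> s" for s i
  proof (cases i)
    case None
    have "\<eta> \<bullet> w s \<ge> 0"
      using \<eta> w_nonneg[OF that] by (auto simp: inner_vec_def subprob_vectors_def intro!: sum_nonneg)
    moreover have "(A *v w s) $ None = \<phi> * (\<eta> \<bullet> w s)"
      unfolding A_def ex mv_add_left outer_product_mult_vector
      by (simp add: M block_generator_mult_vector axis_def) (simp add: w_def)
    ultimately show ?thesis using \<phi> None by (simp add: w'_def)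
  next
    case (Some j)
    have kw: "(\<chi> j. k $ j * w s $ Some j) = exp (\<gamma> * s) *\<^sub>R (mexp T s *v k)"
    proof -
      have "k $ j * w s $ Some j = exp (\<gamma> * s) * (mexp T s *v k) $ j" for j
        using k0[of j] by (simp add: w_def inner_axis')
      then show ?thesis by (simp add: vec_eq_iff)
    qed
    have "(A *v w s) $ Some j = (T' *v (\<chi> j. w s $ Some j)) $ j"
      unfolding A_def ex mv_add_left outer_product_mult_vector
      by (simp add: M block_generator_mult_vector axis_def) (simp add: w_def)
    also have "\<dots> = exp (\<gamma> * s) * (T *v (mexp T s *v k)) $ j / k $ j + \<gamma> * w s $ Some j"
      using kw by (simp add: T'v mv_scaleR_right)
    also have "T *v (mexp T s *v k) = mexp T s *v (T *v k)"
      by (simp add: matrix_vector_mul_assoc matrix_exp_commute)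
    finally have "(A *v w s) $ Some j = w' s $ Some j"
      by (simp add: w_def w'_def inner_axis' mv_add_right mv_scaleR_right algebra_simps add_divide_distrib)
    then show ?thesis by (simp add: Some)
  qed
  \<comment> \<open>At z = 0 this is the survival function at y of the whole tilted jump, at z = y
    the probability that the recycled chain is in a jump phase at time y.\<close>
  define g where "g = (\<lambda>z. u \<bullet> (mexp A z *v w (y - z)))"
  have "g 0 \<le> g y"
  proof (rule DERIV_nonneg_imp_nondecreasing[OF y])
    fix z assume z: "0 \<le> z" "z \<le> y"
    have "((\<lambda>z. w (y - z)) has_vector_derivative (- 1) *\<^sub>R w' (y - z)) (at z)"
      by (rule vector_diff_chain_at[unfolded o_def, OF _ wd]) (auto intro!: derivative_eq_intros)
    from matrix_exp_product_deriv[OF this]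
    have "(g has_real_derivative u \<bullet> (mexp A z *v (A *v w (y - z) + (- 1) *\<^sub>R w' (y - z)))) (at z)"
      unfolding g_def .
    moreover have "0 \<le> u \<bullet> (mexp A z *v (A *v w (y - z) + (- 1) *\<^sub>R w' (y - z)))"
      using sg u z Aw[of "y - z"] by (intro matrix_exp_form_nonneg) (auto simp: subgenerator_def)
    ultimately show "\<exists>d. (g has_real_derivative d) (at z) \<and> 0 \<le> d" by blast
  qed
  moreover have "g 0 = exp (\<gamma> * y) * (\<alpha> \<bullet> (mexp T y *v k)) / F"
  proof -
    have "g 0 = (\<Sum>j\<in>UNIV. \<alpha> $ j * k $ j / F * (exp (\<gamma> * y) * (mexp T y *v k) $ j / k $ j))"
    proof -
      have "w y $ Some j = exp (\<gamma> * y) * (mexp T y *v k) $ j / k $ j" for j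
        by (simp add: w_def inner_axis')
      moreover have "g 0 = (\<Sum>j\<in>UNIV. u $ Some j * w y $ Some j)"
        unfolding g_def by (simp add: inner_vec_def sum_UNIV_option u_None)
      ultimately show ?thesis by (simp only: u_Some times_divide_eq_right)
    qed
    also have "\<dots> = (\<Sum>j\<in>UNIV. exp (\<gamma> * y) / F * (\<alpha> $ j * (mexp T y *v k) $ j))"
    proof (intro sum.cong refl)
      fix j
      show "\<alpha> $ j * k $ j / F * (exp (\<gamma> * y) * (mexp T y *v k) $ j / k $ j)
          = exp (\<gamma> * y) / F * (\<alpha> $ j * (mexp T y *v k) $ j)"
        using k0[of j] by simp
    qed
    also have "\<dots> = exp (\<gamma> * y) * (\<alpha> \<bullet> (mexp T y *v k)) / F"
      by (simp add: inner_vec_def sum_distrib_left sum_divide_distrib)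
    finally show ?thesis .
  qed
  moreover have "g y + u \<bullet> (mexp A y *v axis None 1) \<le> 1"
  proof -
    \<comment> \<open>\<open>w 0\<close> is the indicator of the jump phases, so the two
      probabilities add up to a total row mass, which is at most 1.\<close>
    have "w 0 + axis None 1 = (1 :: real^('m option))"
      unfolding vec_eq_iff
    proof
      fix i show "(w 0 + axis None 1) $ i = (1 :: real^('m option)) $ i"
      proof (cases i)
        case None
        then show ?thesis by (simp add: w_def axis_def)
      next
        case (Some j)
        then show ?thesis using k0[of j] by (simp add: w_def inner_axis') (simp add: axis_def)
      qed
    qed
    then have "g y + u \<bullet> (mexp A y *v axis None 1) = u \<bullet> (mexp A y *v 1)"
      by (simp add: g_def inner_add_right[symmetric] mv_add_right[symmetric])
    also have "\<dots> \<le> (\<Sum>i\<in>UNIV. u $ i * 1)"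
      unfolding inner_vec_def using u subgenerator_exp_row_sum[OF sg y]
      by (auto intro!: sum_mono mult_left_mono simp del: mult_1_right)
    finally show ?thesis using u1 by simp
  qed
  ultimately have "u \<bullet> (mexp A y *v axis None 1) \<le> 1 - exp (\<gamma> * y) * (\<alpha> \<bullet> (mexp T y *v k)) / F"
    by simp
  then have "\<phi> * (u \<bullet> (mexp A y *v axis None 1))
      \<le> \<phi> * (1 - exp (\<gamma> * y) * (\<alpha> \<bullet> (mexp T y *v k)) / F)"
    using \<phi> by (intro mult_left_mono) auto
  also have "\<dots> = \<phi> / F * (F - exp (\<gamma> * y) * (\<alpha> \<bullet> (mexp T y *v k)))"
    using F by (simp add: field_simps)
  finally show "extend_row ((1 / (\<alpha> \<bullet> k)) *\<^sub>R (\<alpha> v* diag_matrix k)) \<bullet>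
        (mexp (recycled M \<eta>) y *v (- (M *v 1)))
      \<le> \<phi> / (\<alpha> \<bullet> k) * (\<alpha> \<bullet> k - exp (\<gamma> * y) * (\<alpha> \<bullet> (mexp T y *v k)))"
    unfolding A_def[symmetric] u_def[symmetric] F_def[symmetric]
    unfolding ex by (simp add: mv_scaleR_right)
qed

text \<open>\<open>H'\<close> is F times the distribution function of the tilted jump. Passing from
  the tail of \<nu> to that of \<mu> multiplies it by exp(-\<gamma>y), which gives \<open>K\<close>.
  The primitive \<open>N\<close> of \<open>K\<close> is at most (1 - exp(-\<gamma>x)) / \<gamma>,
  where the jump distribution no longer appears, and the transform of \<mu> then yields 1 / (\<phi>
  + \<gamma>).\<close>

lemma l1_contraction_tilted_block_generator:
  fixes T :: "real^'m^'m" and \<gamma> \<phi> :: real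
  assumes par: "phase_type_params \<alpha> T" and \<phi>: "0 < \<phi>" and \<gamma>: "0 < \<gamma>"
    and k1: "\<And>i. 1 \<le> k $ i" and Tk: "T *v k = - exit_vector T - \<gamma> *\<^sub>R k"
    and l: "T *v l + \<gamma> *\<^sub>R l = k"
    and \<nu>: "finite_measure \<nu>" "sets \<nu> = sets borel" and \<mu>: "finite_measure \<mu>" "sets \<mu> = sets borel"
    and tail: "\<And>y. 0 \<le> y \<Longrightarrow> emeasure \<nu> {y<..} \<le> ennreal (exp (- \<gamma> * y)) * emeasure \<mu> {y..}"
    and transf: "(\<integral>\<^sup>+x\<in>{0..}. ennreal (1 - exp (- \<gamma> * x)) \<partial>\<mu>) \<le> ennreal (\<gamma> / (\<phi> + \<gamma>))"
    and lam: "0 < lam" "lam < q"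
  shows "l1_contraction_on subprob_vectors (mixture_map (lam * (\<alpha> \<bullet> k) / q)
      (extend_row ((1 / (\<alpha> \<bullet> k)) *\<^sub>R (\<alpha> v* diag_matrix k)))
      (block_generator \<phi> (matrix_inv (diag_matrix k) *v exit_vector T)
                (matrix_inv (diag_matrix k) ** T ** diag_matrix k + mat \<gamma>)) \<nu>)"
proof -
  have k0: "k $ i > 0" for i using k1[of i] by simp
  define D where "D = diag_matrix (\<chi> i. 1 / k $ i)"
  have D: "matrix_inv (diag_matrix k) = D"
    unfolding D_def using k0 by (intro matrix_inv_diag_matrix) (simp add: less_imp_neq[THEN not_sym])
  define M where "M = block_generator \<phi> (D *v exit_vector T) (D ** T ** diag_matrix k + mat \<gamma>)"
  note occ = tilted_occupation_bound[OF par \<phi> k1 Tk M_def[unfolded D_def]]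
  note met = phase_type_params_metzler(1)[OF par] and t0 = phase_type_params_metzler(2)[OF par]
  have \<alpha>: "0 \<le> \<alpha> $ i" "(\<Sum>i\<in>UNIV. \<alpha> $ i) = 1" for i
    using par by (auto simp: phase_type_params_def)
  define F where "F = \<alpha> \<bullet> k"
  have "(\<Sum>i\<in>UNIV. \<alpha> $ i * 1) \<le> F"
    unfolding F_def inner_vec_def using \<alpha> k1 by (auto intro!: sum_mono mult_left_mono simp del: mult_1_right)
  then have F: "1 \<le> F" using \<alpha> by simp
  have Tk': "T *v k + \<gamma> *\<^sub>R k = - exit_vector T" by (simp add: Tk)
  define e where "e = (\<lambda>y v. \<alpha> \<bullet> (mexp T y *v v))"
  have e_nonneg: "0 \<le> e y v" if "0 \<le> y" "\<And>i. 0 \<le> v $ i" for y v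
    unfolding e_def using \<alpha> met that by (intro matrix_exp_form_nonneg) auto
  \<comment> \<open>\<open>l\<close> serves to integrate \<open>H'\<close> in closed form: T l +
    \<gamma> l = k makes exp(\<gamma>y) \<open>e y l\<close> a primitive of exp(\<gamma>y)
    \<open>e y k\<close>. The constant \<alpha> \<bullet> l gives H 0 = 0.\<close>
  define H where "H = (\<lambda>y. y * F - exp (\<gamma> * y) * e y l + \<alpha> \<bullet> l)"
  define H' where "H' = (\<lambda>y. F - exp (\<gamma> * y) * e y k)"
  have H: "(H has_real_derivative H' y) (at y)" for y
    unfolding H_def H'_def e_def
    by (rule derivative_eq_intros scaled_form_deriv refl)+ (simp add: l)
  have H0: "H 0 = 0" by (simp add: H_def e_def)
  have H'_nonneg: "0 \<le> H' y" if "0 \<le> y" for y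
  proof -
    have "exp (\<gamma> * y) * e y k \<le> exp (\<gamma> * 0) * e 0 k"
    proof (rule DERIV_nonpos_imp_nonincreasing[OF that])
      fix z assume z: "0 \<le> z" "z \<le> y"
      have "((\<lambda>z. exp (\<gamma> * z) * e z k) has_real_derivative exp (\<gamma> * z) * e z (- exit_vector T)) (at z)"
        unfolding e_def using scaled_form_deriv[of \<gamma> \<alpha> T k z] by (simp add: Tk')
      moreover have "e z (- exit_vector T) = - e z (exit_vector T)"
        by (simp add: e_def mv_minus_right)
      ultimately show "\<exists>d. ((\<lambda>z. exp (\<gamma> * z) * e z k) has_real_derivative d) (at z) \<and> d \<le> 0"
        using e_nonneg[OF z(1) t0] by (auto intro!: exI mult_nonneg_nonpos)
    qed
    then show ?thesis by (simp add: H'_def e_def F_def)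
  qed
  have cont: "continuous_on UNIV (\<lambda>y. e y v)" for v
    unfolding e_def by (intro DERIV_continuous_on) (auto intro: matrix_exp_form_deriv has_field_derivative_at_within)
  have [measurable]: "H' \<in> borel_measurable borel" "H \<in> borel_measurable borel"
    unfolding H'_def H_def by (intro borel_measurable_continuous_onI continuous_intros cont)+
  define K where "K = (\<lambda>y. exp (- \<gamma> * y) * H' y)"
  have K_eq: "K = (\<lambda>y. exp (- \<gamma> * y) * F - e y k)"
  proof
    fix y
    have "exp (- \<gamma> * y) * exp (\<gamma> * y) = 1" by (simp add: mult_exp_exp)
    then have "exp (- \<gamma> * y) * (exp (\<gamma> * y) * e y k) = e y k" by (simp only: mult.assoc[symmetric] mult_1_left)
    then show "K y = exp (- \<gamma> * y) * F - e y k" by (simp add: K_def H'_def right_diff_distrib)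
  qed
  \<comment> \<open>Differentiating \<open>e y k\<close> and \<open>e y 1\<close> produces the same
    term in the exit vector. It cancels in the difference and leaves -\<gamma> \<open>e y k\<close>,
    which makes this quotient a primitive of \<open>K\<close>.\<close>
  define N where "N = (\<lambda>x. (1 - e x 1 - K x) / \<gamma>)"
  have e_d: "((\<lambda>y. e y v) has_real_derivative e y (T *v v)) (at y)" for y v
    unfolding e_def by (rule matrix_exp_form_deriv)
  have e_lin: "e y (T *v k) = - e y (exit_vector T) - \<gamma> * e y k" "e y (T *v 1) = - e y (exit_vector T)" for y
    unfolding Tk by (simp_all add: e_def exit_vector_def mv_diff_right mv_minus_right mv_scaleR_right
        inner_diff_right)
  have N: "(N has_real_derivative K y) (at y)" for y
  proof -
    have "((\<lambda>x. exp (- \<gamma> * x) * F) has_real_derivative - \<gamma> * exp (- \<gamma> * y) * F) (at y)"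
      by (auto intro!: derivative_eq_intros)
    then have "(N has_real_derivative
        (0 - e y (T *v 1) - (- \<gamma> * exp (- \<gamma> * y) * F - e y (T *v k))) / \<gamma>) (at y)"
      unfolding N_def K_eq by (intro DERIV_cdivide DERIV_diff DERIV_const e_d)
    also have "(0 - e y (T *v 1) - (- \<gamma> * exp (- \<gamma> * y) * F - e y (T *v k))) / \<gamma> = K y"
      using \<gamma> by (simp add: K_eq e_lin diff_divide_distrib field_simps)
    finally show ?thesis .
  qed
  have e0: "e 0 v = \<alpha> \<bullet> v" for v by (simp add: e_def)
  have e01: "e 0 1 = 1" using \<alpha> by (simp add: e0 inner_vec_def)
  have N0: "N 0 = 0" by (simp add: N_def K_eq e0 e01[unfolded e0] F_def)
  have N_le: "N x \<le> (1 - exp (- \<gamma> * x)) / \<gamma>" if "0 \<le> x" for x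
  proof -
    \<comment> \<open>The claim amounts to \<open>e x (k - 1)\<close> \<le> exp(-\<gamma>x)(F - 1).
      The weighted form decreases because (T + \<gamma>)(k - 1) = -\<gamma> 1.\<close>
    have "exp (\<gamma> * x) * e x (k - 1) \<le> exp (\<gamma> * 0) * e 0 (k - 1)"
    proof (rule DERIV_nonpos_imp_nonincreasing[OF that])
      fix z assume z: "0 \<le> z" "z \<le> x"
      have "T *v (k - 1) + \<gamma> *\<^sub>R (k - 1) = - (\<gamma> *\<^sub>R 1)"
        by (simp add: mv_diff_right Tk exit_vector_def scaleR_diff_right)
      then have "((\<lambda>z. exp (\<gamma> * z) * e z (k - 1)) has_real_derivative exp (\<gamma> * z) * e z (- (\<gamma> *\<^sub>R 1))) (at z)"
        unfolding e_def using scaled_form_deriv[of \<gamma> \<alpha> T "k - 1" z] by simp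
      moreover have "e z (- (\<gamma> *\<^sub>R 1)) = - (\<gamma> * e z 1)"
        by (simp add: e_def mv_minus_right mv_scaleR_right)
      moreover have "0 \<le> \<gamma> * e z 1" using e_nonneg[OF z(1), of 1] \<gamma> by simp
      ultimately show "\<exists>d. ((\<lambda>z. exp (\<gamma> * z) * e z (k - 1)) has_real_derivative d) (at z) \<and> d \<le> 0"
        by (auto intro!: exI mult_nonneg_nonpos)
    qed
    also have "\<dots> = F - 1" using e01 by (simp add: e0 inner_diff_right F_def)
    finally have "exp (\<gamma> * x) * (e x k - e x 1) \<le> F - 1"
      by (simp add: e_def mv_diff_right inner_diff_right)
    then have "exp (- \<gamma> * x) * (exp (\<gamma> * x) * (e x k - e x 1)) \<le> exp (- \<gamma> * x) * (F - 1)"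
      by (intro mult_left_mono) auto
    then have "e x k - e x 1 \<le> exp (- \<gamma> * x) * (F - 1)"
      by (simp add: mult.assoc[symmetric] mult_exp_exp)
    then have "1 - e x 1 - K x \<le> 1 - exp (- \<gamma> * x)" by (simp add: K_eq algebra_simps)
    then show ?thesis using \<gamma> by (simp add: N_def divide_right_mono)
  qed
  have [measurable]: "K \<in> borel_measurable borel" unfolding K_def by measurable
  have "(\<integral>\<^sup>+x\<in>{0..}. ennreal (H x) \<partial>\<nu>) = (\<integral>\<^sup>+y\<in>{0..}. ennreal (H' y) * emeasure \<nu> {y<..} \<partial>lborel)"
    by (rule nn_integral_layer_cake_open[OF \<nu>]) (use H H0 H'_nonneg in auto)
  also have "\<dots> \<le> (\<integral>\<^sup>+y\<in>{0..}. ennreal (K y) * emeasure \<mu> {y..} \<partial>lborel)"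
  proof (rule nn_integral_mono)
    fix y :: real
    have "ennreal (H' y) * emeasure \<nu> {y<..} \<le> ennreal (K y) * emeasure \<mu> {y..}" if "0 \<le> y"
    proof -
      have "ennreal (H' y) * emeasure \<nu> {y<..} \<le> ennreal (H' y) * (ennreal (exp (- \<gamma> * y)) * emeasure \<mu> {y..})"
        by (intro mult_left_mono tail that) simp
      also have "\<dots> = ennreal (K y) * emeasure \<mu> {y..}"
        using H'_nonneg[OF that] by (simp add: K_def ennreal_mult mult_ac)
      finally show ?thesis .
    qed
    then show "ennreal (H' y) * emeasure \<nu> {y<..} * indicator {0..} y
        \<le> ennreal (K y) * emeasure \<mu> {y..} * indicator {0..} y"
      by (auto simp: indicator_def)
  qed
  also have "\<dots> = (\<integral>\<^sup>+x\<in>{0..}. ennreal (N x) \<partial>\<mu>)"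
    by (rule nn_integral_layer_cake_closed[OF \<mu>, symmetric]) (use N N0 H'_nonneg in \<open>auto simp: K_def\<close>)
  also have "\<dots> \<le> (\<integral>\<^sup>+x. ennreal (1 / \<gamma>) * (ennreal (1 - exp (- \<gamma> * x)) * indicator {0..} x) \<partial>\<mu>)"
    using N_le \<gamma> by (intro nn_integral_mono)
      (auto simp: indicator_def ennreal_mult[symmetric] intro!: ennreal_leI)
  also have "\<dots> = ennreal (1 / \<gamma>) * (\<integral>\<^sup>+x\<in>{0..}. ennreal (1 - exp (- \<gamma> * x)) \<partial>\<mu>)"
    by (intro nn_integral_cmult) (auto simp: measurable_cong_sets[OF \<mu>(2) refl])
  also have "\<dots> \<le> ennreal (1 / \<gamma>) * ennreal (\<gamma> / (\<phi> + \<gamma>))"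
    by (intro mult_left_mono transf) simp
  also have "\<dots> = ennreal (1 / (\<phi> + \<gamma>))"
    using \<gamma> \<phi> by (simp add: ennreal_mult[symmetric])
  finally have H_int: "(\<integral>\<^sup>+x\<in>{0..}. ennreal (H x) \<partial>\<nu>) \<le> ennreal (1 / (\<phi> + \<gamma>))" .
  show ?thesis
    unfolding D F_def[symmetric] M_def[symmetric]
  proof (rule l1_contraction_mixture_map[OF occ(2) occ(3) \<nu>, where h = "\<lambda>x. \<phi> / F * H x"
        and h' = "\<lambda>x. \<phi> / F * H' x" and C = "\<phi> / F * (1 / (\<phi> + \<gamma>))"])
    show "0 \<le> extend_row ((1 / F) *\<^sub>R (\<alpha> v* diag_matrix k)) $ i" for i
      using \<alpha> k0 F by (auto simp: extend_row_def vector_mult_diag_matrix less_imp_le split: option.splits)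
    show "((\<lambda>x. \<phi> / F * H x) has_real_derivative \<phi> / F * H' y) (at y)" for y
      by (intro DERIV_cmult H)
    show "extend_row ((1 / F) *\<^sub>R (\<alpha> v* diag_matrix k)) \<bullet>
        (mexp (recycled M \<eta>) y *v (- (M *v 1))) \<le> \<phi> / F * H' y"
      if "\<eta> \<in> subprob_vectors" "0 \<le> y" for \<eta> y
      using occ(4)[OF that] by (simp add: F_def H'_def e_def)
    have "(\<integral>\<^sup>+x\<in>{0..}. ennreal (\<phi> / F * H x) \<partial>\<nu>) = (\<integral>\<^sup>+x. ennreal (\<phi> / F) * (ennreal (H x) * indicator {0..} x) \<partial>\<nu>)"
      using \<phi> F by (intro nn_integral_cong) (auto simp: ennreal_mult' indicator_def simp del: times_divide_eq_left times_divide_eq_right)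
    also have "\<dots> = ennreal (\<phi> / F) * (\<integral>\<^sup>+x\<in>{0..}. ennreal (H x) \<partial>\<nu>)"
      by (intro nn_integral_cmult) (auto simp: measurable_cong_sets[OF \<nu>(2) refl])
    also have "\<dots> \<le> ennreal (\<phi> / F) * ennreal (1 / (\<phi> + \<gamma>))"
      by (intro mult_left_mono H_int) simp
    also have "\<dots> = ennreal (\<phi> / F * (1 / (\<phi> + \<gamma>)))"
      using \<phi> F \<gamma> by (simp add: ennreal_mult[symmetric] del: times_divide_eq_left times_divide_eq_right)
    finally show "(\<integral>\<^sup>+x\<in>{0..}. ennreal (\<phi> / F * H x) \<partial>\<nu>) \<le> ennreal (\<phi> / F * (1 / (\<phi> + \<gamma>)))" .
    \<comment> \<open>The normalisation F of the tilted jump cancels against the weight of the map.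
      In the application \<phi> + \<gamma> is the untilted root \<Phi>(q).\<close>
    have "lam * F / q * (\<phi> / F * (1 / (\<phi> + \<gamma>))) = (lam / q) * (\<phi> / (\<phi> + \<gamma>))"
      using F by simp
    also have "\<dots> < 1 * 1"
      using lam \<phi> \<gamma> by (intro mult_strict_mono) auto
    finally show "lam * F / q * (\<phi> / F * (1 / (\<phi> + \<gamma>))) < 1" by simp
  qed (use lam F \<phi> \<gamma> H0 in auto)
qed

subsection \<open>Minimal representations\<close>

lemma idx_matrix_pow_scale: "idx_matrix_pow k (\<lambda>i j. x * G i j) n i j = x ^ n * idx_matrix_pow k G n i j"
  by (induction n arbitrary: i j) (auto simp: sum_distrib_left mult_ac)

lemma idx_matrix_pow_bound:
  assumes "\<And>i j. i < k \<Longrightarrow> j < k \<Longrightarrow> \<bar>G i j\<bar> \<le> g" "i < k" "j < k"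
  shows "\<bar>idx_matrix_pow k G n i j\<bar> \<le> (real k * g) ^ n"
  using assms(2,3)
proof (induction n arbitrary: i j)
  case (Suc n)
  have "\<bar>idx_matrix_pow k G (Suc n) i j\<bar> \<le> (\<Sum>l<k. \<bar>G i l\<bar> * \<bar>idx_matrix_pow k G n l j\<bar>)"
    by (simp add: abs_mult[symmetric] sum_abs)
  also have "\<dots> \<le> (\<Sum>l<k. g * (real k * g) ^ n)"
    using Suc assms(1) assms(1)[OF Suc.prems, THEN order_trans[OF abs_ge_zero]]
    by (intro sum_mono mult_mono) auto
  finally show ?case by simp
qed auto

lemma sums_idx_matrix_exp:
  assumes "i < k" "j < k"
  shows "(\<lambda>n. x ^ n * idx_matrix_pow k G n i j / fact n) sums idx_matrix_exp k (\<lambda>i j. x * G i j) i j"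
proof -
  define g where "g = (\<Sum>i<k. \<Sum>j<k. \<bar>G i j\<bar>)"
  have g: "\<bar>G i j\<bar> \<le> g" if "i < k" "j < k" for i j
  proof -
    have "\<bar>G i j\<bar> \<le> (\<Sum>j<k. \<bar>G i j\<bar>)" using that by (intro member_le_sum) auto
    also have "\<dots> \<le> g" unfolding g_def using that
      by (intro member_le_sum[of i _ "\<lambda>i. \<Sum>j<k. \<bar>G i j\<bar>"]) (auto intro: sum_nonneg)
    finally show ?thesis .
  qed
  have "summable (\<lambda>n. x ^ n * idx_matrix_pow k G n i j / fact n)"
  proof (rule summable_comparison_test'[where N = 0, OF summable_exp[of "\<bar>x\<bar> * (real k * g)"]])
    fix n :: nat
    have bound: "\<bar>x ^ n * idx_matrix_pow k G n i j\<bar> \<le> \<bar>x\<bar> ^ n * (real k * g) ^ n"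
      unfolding abs_mult power_abs
      using idx_matrix_pow_bound[of k G g i j n] g assms by (intro mult_left_mono) auto
    show "norm (x ^ n * idx_matrix_pow k G n i j / fact n) \<le> inverse (fact n) * (\<bar>x\<bar> * (real k * g)) ^ n"
      using divide_right_mono[OF bound, of "fact n"]
      by (simp add: power_mult_distrib divide_inverse abs_mult mult_ac)
  qed
  then show ?thesis
    unfolding idx_matrix_exp_def idx_matrix_pow_scale by (rule summable_sums)
qed

text \<open>If the row space were smaller, a basis of it inside the hyperplane \<open>{v. v \<bullet> 1 = 1}\<close> would give a
  representation of lower order.\<close>

lemma phase_type_minimal_controllable:
  fixes T :: "real^'m^'m"
  assumes par: "phase_type_params \<alpha> T" and min: "phase_type_minimal \<alpha> T"
    and V: "subspace V" "\<alpha> \<in> V" "\<And>v. v \<in> V \<Longrightarrow> v v* T \<in> V"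
  shows "V = UNIV"
proof (rule ccontr)
  assume "V \<noteq> UNIV"
  then have dim: "dim V < CARD('m)"
    using dim_eq_full[of V] dim_subset_UNIV[of V] V(1) by (simp add: span_eq_iff[THEN iffD2])
  have \<alpha>1: "\<alpha> \<bullet> 1 = 1" using par by (simp add: phase_type_params_def inner_vec_def)
  \<comment> \<open>Basis vectors normalised by v \<bullet> 1 = 1 let the reduced representation end
    in the vector of ones, which is the form that minimality speaks of.\<close>
  define W where "W = V \<inter> {v. v \<bullet> 1 = 1}"
  obtain B where B: "B \<subseteq> W" "independent B" "W \<subseteq> span B" "card B = dim W"
    using basis_exists by blast
  have VB: "V \<subseteq> span B"
  proof
    fix v assume v: "v \<in> V"
    have \<alpha>: "\<alpha> \<in> span B" using V(2) \<alpha>1 B(3) by (auto simp: W_def)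
    show "v \<in> span B"
    \<comment> \<open>A vector with v \<bullet> 1 = 0 cannot be rescaled into the hyperplane; adding
      \<alpha>, which lies in it, moves it there.\<close>
    proof (cases "v \<bullet> 1 = 0")
      case True
      then have "v + \<alpha> \<in> span B" using v V(1,2) \<alpha>1 B(3) by (auto simp: W_def inner_add_left subspace_add)
      then show ?thesis using \<alpha> span_diff[of "v + \<alpha>" B \<alpha>] by simp
    next
      case False
      have "(1 / (v \<bullet> 1)) *\<^sub>R v \<in> W" using v False V(1) by (auto simp: W_def subspace_scale)
      then have "(1 / (v \<bullet> 1)) *\<^sub>R v \<in> span B" using B(3) by blast
      then have "(v \<bullet> 1) *\<^sub>R ((1 / (v \<bullet> 1)) *\<^sub>R v) \<in> span B" by (rule span_scale)
      then show ?thesis using False by simp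
    qed
  qed
  define k where "k = card B"
  have "dim W \<le> dim V" by (intro dim_subset) (auto simp: W_def)
  then have k: "k < CARD('m)" using dim B(4) by (simp add: k_def)
  have fin: "finite B" using B(2) by (rule independent_imp_finite)
  obtain e where e: "bij_betw e {..<k} B"
    using ex_bij_betw_nat_finite[OF fin] by (auto simp: k_def atLeast0LessThan)
  have e1: "e i \<bullet> 1 = 1" "e i \<in> V" if "i < k" for i
    using bij_betwE[OF e] B(1) that by (auto simp: W_def)
  have rep: "\<exists>c. v = (\<Sum>i<k. c i *\<^sub>R e i)" if "v \<in> V" for v
  proof -
    have "v \<in> span B" using VB that by auto
    then obtain u where "v = (\<Sum>b\<in>B. u b *\<^sub>R b)" using span_finite[OF fin] by auto
    then have "v = (\<Sum>i<k. u (e i) *\<^sub>R e i)" using sum.reindex_bij_betw[OF e, of "\<lambda>b. u b *\<^sub>R b"] by simp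
    then show ?thesis by (rule exI[of _ "\<lambda>i. u (e i)"])
  qed
  obtain b where b: "\<alpha> = (\<Sum>i<k. b i *\<^sub>R e i)" using rep[OF V(2)] by blast
  have "\<forall>i. \<exists>c. i < k \<longrightarrow> e i v* T = (\<Sum>j<k. c j *\<^sub>R e j)"
    using rep V(3) e1(2) by metis
  then obtain G where G: "\<And>i. i < k \<Longrightarrow> e i v* T = (\<Sum>j<k. G i j *\<^sub>R e j)" by metis
  have lin: "(\<Sum>i<k. c i *\<^sub>R f i) v* A = (\<Sum>i<k. c i *\<^sub>R (f i v* A))" for c and f :: "nat \<Rightarrow> real^'m" and A :: "real^'m^'m"
    by (induction k) (auto simp: vector_matrix_left_distrib scaleR_vector_matrix_assoc)
  have pow: "e i v* mat_pow T n = (\<Sum>j<k. idx_matrix_pow k G n i j *\<^sub>R e j)" if "i < k" for i n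
    using that
  proof (induction n arbitrary: i)
    case 0
    then show ?case by (simp add: if_distrib[of "\<lambda>c. c *\<^sub>R _"] sum.delta cong: if_cong)
  next
    case (Suc n)
    have "e i v* mat_pow T (Suc n) = (\<Sum>l<k. G i l *\<^sub>R e l) v* mat_pow T n"
      using G[OF Suc.prems] by (simp add: vector_matrix_mul_assoc[symmetric])
    also have "\<dots> = (\<Sum>l<k. G i l *\<^sub>R (\<Sum>j<k. idx_matrix_pow k G n l j *\<^sub>R e j))"
      unfolding lin using Suc.IH by (intro sum.cong refl) simp
    also have "\<dots> = (\<Sum>j<k. idx_matrix_pow k G (Suc n) i j *\<^sub>R e j)"
      by (simp add: scaleR_sum_right scaleR_sum_left) (rule sum.swap)
    finally show ?case .
  qed
  \<comment> \<open>The numbers \<alpha> T^n 1 are, up to factorials, the power series coefficients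
    of the tail, so matching them identifies the tails.\<close>
  have mom: "\<alpha> \<bullet> (mat_pow T n *v 1) = (\<Sum>i<k. \<Sum>j<k. b i * idx_matrix_pow k G n i j)" for n
  proof -
    have "\<alpha> \<bullet> (mat_pow T n *v 1) = (\<Sum>i<k. b i *\<^sub>R (e i v* mat_pow T n)) \<bullet> 1"
      by (simp add: dot_lmul_matrix[symmetric] b lin)
    also have "\<dots> = (\<Sum>i<k. b i * (\<Sum>j<k. idx_matrix_pow k G n i j * (e j \<bullet> 1)))"
      using pow by (simp add: inner_sum_left)
    also have "\<dots> = (\<Sum>i<k. \<Sum>j<k. b i * idx_matrix_pow k G n i j)"
      using e1 by (simp add: sum_distrib_left)
    finally show ?thesis .
  qed
  have "phase_type_tail \<alpha> T x = (\<Sum>i<k. \<Sum>j<k. b i * idx_matrix_exp k (\<lambda>i j. x * G i j) i j)" for x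
  proof -
    have bl: "bounded_linear (\<lambda>M :: real^'m^'m. \<alpha> \<bullet> (M *v 1))"
      by (intro bounded_linear_compose[OF bounded_linear_inner_right, unfolded o_def]
          bounded_bilinear.bounded_linear_left[OF bounded_bilinear_matrix_vector_mult])
    have "(\<lambda>n. x ^ n / fact n * (\<alpha> \<bullet> (mat_pow T n *v 1))) sums (\<alpha> \<bullet> (mexp T x *v 1))"
      using bounded_linear.sums[OF bl sums_matrix_exp[of "x *\<^sub>R T"]]
      by (simp add: mat_pow_scaleR mv_scaleR_left)
    moreover have "(\<lambda>n. \<Sum>i<k. \<Sum>j<k. b i * (x ^ n * idx_matrix_pow k G n i j / fact n))
        sums (\<Sum>i<k. \<Sum>j<k. b i * idx_matrix_exp k (\<lambda>i j. x * G i j) i j)"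
      by (intro sums_sum sums_mult sums_idx_matrix_exp) auto
    moreover have "x ^ n / fact n * (\<alpha> \<bullet> (mat_pow T n *v 1))
        = (\<Sum>i<k. \<Sum>j<k. b i * (x ^ n * idx_matrix_pow k G n i j / fact n))" for n
      unfolding mom by (simp add: sum_distrib_left mult_ac)
    ultimately show ?thesis
      by (simp add: phase_type_tail_def dot_lmul_matrix sums_iff)
  qed
  then show False using min k unfolding phase_type_minimal_def by blast
qed

text \<open>The vectors v for which exp(\<gamma>x) v exp(xT) vanishes at infinity form a T-invariant
  subspace containing \<alpha>, hence by minimality the whole space. A null vector of T + \<gamma>
  is fixed by exp(\<gamma>x) exp(xT) for all x, so it is 0 and the resolvent at -\<gamma> exists.
  Finally, exp(\<gamma>x) exp(xT)(k - 1) decreases to 0, so its initial value is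
  nonnegative.\<close>

lemma phase_type_resolvent_props:
  fixes T :: "real^'m^'m"
  assumes par: "phase_type_params \<alpha> T" and min: "phase_type_minimal \<alpha> T" and \<gamma>: "0 \<le> \<gamma>"
    and lim: "((\<lambda>x. exp (\<gamma> * x) * phase_type_tail \<alpha> T x) \<longlongrightarrow> 0) at_top"
  defines "k \<equiv> phase_type_resolvent T (- \<gamma>)"
  shows "\<And>i. 1 \<le> k $ i" "T *v k = - exit_vector T - \<gamma> *\<^sub>R k" "\<exists>l. T *v l + \<gamma> *\<^sub>R l = k"
proof -
  note met = phase_type_params_metzler(1)[OF par] and t0 = phase_type_params_metzler(2)[OF par]
  have \<alpha>: "0 \<le> \<alpha> $ i" for i using par by (auto simp: phase_type_params_def)
  define R where "R = (\<lambda>x (v :: real^'m). exp (\<gamma> * x) *\<^sub>R (v v* mexp T x))"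
  define V where "V = {v. \<forall>w. ((\<lambda>x. R x v \<bullet> w) \<longlongrightarrow> 0) at_top}"
  have V: "V = UNIV"
  proof (rule phase_type_minimal_controllable[OF par min])
    show "subspace V"
      unfolding subspace_def V_def R_def
      by (auto simp: vector_matrix_left_distrib scaleR_vector_matrix_assoc inner_add_left
          distrib_left intro!: tendsto_add_zero tendsto_mult_right_zero mult.left_commute
          intro: tendsto_mult_right_zero)
         (simp add: mult.left_commute[of "exp _"] tendsto_mult_right_zero)
    \<comment> \<open>The entries of \<alpha> exp(xT) are nonnegative and sum to the tail, so decay
      of the weighted tail controls the pairing with every \<open>w\<close>.\<close>
    show "\<alpha> \<in> V"
      unfolding V_def
    proof (intro CollectI allI)
      fix w :: "real^'m"
      define c where "c = (\<Sum>j\<in>UNIV. \<bar>w $ j\<bar>)"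
      have c: "\<bar>w $ j\<bar> \<le> c" for j unfolding c_def by (rule member_le_sum) auto
      have lim': "((\<lambda>x. c * (exp (\<gamma> * x) * phase_type_tail \<alpha> T x)) \<longlongrightarrow> 0) at_top"
        by (rule tendsto_mult_right_zero[OF lim])
      show "((\<lambda>x. R x \<alpha> \<bullet> w) \<longlongrightarrow> 0) at_top"
      proof (rule Lim_null_comparison[OF _ lim'])
        show "\<forall>\<^sub>F x in at_top. norm (R x \<alpha> \<bullet> w) \<le> c * (exp (\<gamma> * x) * phase_type_tail \<alpha> T x)"
        proof (rule eventually_at_top_linorderI)
          fix x :: real assume x: "0 \<le> x"
          have nn: "0 \<le> (\<alpha> v* mexp T x) $ j" for j
            unfolding vector_matrix_mult_def using \<alpha> matrix_exp_nonneg[OF met x]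
            by (auto intro!: sum_nonneg)
          have "\<bar>(\<alpha> v* mexp T x) \<bullet> w\<bar> \<le> (\<Sum>j\<in>UNIV. \<bar>(\<alpha> v* mexp T x) $ j * w $ j\<bar>)"
            unfolding inner_vec_def by (simp add: sum_abs)
          also have "\<dots> \<le> (\<Sum>j\<in>UNIV. c * (\<alpha> v* mexp T x) $ j)"
            using nn c by (intro sum_mono) (auto simp: abs_mult mult.commute[of c] intro!: mult_left_mono)
          also have "\<dots> = c * phase_type_tail \<alpha> T x"
            by (simp add: phase_type_tail_def inner_vec_def sum_distrib_left)
          finally show "norm (R x \<alpha> \<bullet> w) \<le> c * (exp (\<gamma> * x) * phase_type_tail \<alpha> T x)"
            by (simp add: R_def abs_mult mult.left_commute)
        qed
      qed
    qed
    fix v assume v: "v \<in> V"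
    show "v v* T \<in> V"
      unfolding V_def
    proof (intro CollectI allI)
      fix w :: "real^'m"
      have "R x (v v* T) \<bullet> w = R x v \<bullet> (T *v w)" for x
        by (simp add: R_def dot_lmul_matrix vector_matrix_mul_assoc matrix_exp_commute matrix_vector_mul_assoc)
      then show "((\<lambda>x. R x (v v* T) \<bullet> w) \<longlongrightarrow> 0) at_top"
        using v by (simp add: V_def)
    qed
  qed
  have decay: "((\<lambda>x. exp (\<gamma> * x) * (v \<bullet> (mexp T x *v w))) \<longlongrightarrow> 0) at_top" for v w
    using V unfolding V_def R_def by (auto simp: dot_lmul_matrix)
  have inj: "v = 0" if "(T + mat \<gamma>) *v v = 0" for v
  proof -
    have Tv: "T *v v + \<gamma> *\<^sub>R v = 0" using that by (simp add: mv_add_left mat_mult_vector)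
    have "v $ i = 0" for i
    proof -
      define f where "f = (\<lambda>x. exp (\<gamma> * x) * (axis i 1 \<bullet> (mexp T x *v v)))"
      have "(f has_real_derivative 0) (at x)" for x
        unfolding f_def using scaled_form_deriv[of \<gamma> "axis i 1" T v x] by (simp add: Tv)
      then have "f x = f 0" for x by (metis DERIV_isconst_all)
      then have "(f \<longlongrightarrow> f 0) at_top"
        by (intro tendsto_eventually always_eventually) simp
      then have "f 0 = 0" using decay[of "axis i 1" v] tendsto_unique[OF trivial_limit_at_top_linorder]
        unfolding f_def by blast
      then show ?thesis by (simp add: f_def inner_axis')
    qed
    then show "v = 0" by (simp add: vec_eq_iff)
  qed
  obtain L where L0: "L ** (T + mat \<gamma>) = mat 1"
    using matrix_left_invertible_ker[of "T + mat \<gamma>"] inj by blast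
  then have L: "(T + mat \<gamma>) ** L = mat 1" by (simp add: matrix_left_right_inverse)
  have "mat (- \<gamma>) - T = - (T + mat \<gamma>)" by (simp add: vec_eq_iff mat_def)
  moreover have "matrix_inv (- (T + mat \<gamma>)) = - L"
  proof (rule matrix_inv_eqI)
    show "- (T + mat \<gamma>) ** (- L) = mat 1" "(- L) ** (- (T + mat \<gamma>)) = mat 1"
      using L L0 by (simp_all add: bounded_bilinear.minus_left[OF bounded_bilinear_matrix_matrix_mult]
          bounded_bilinear.minus_right[OF bounded_bilinear_matrix_matrix_mult]
          del: minus_add_distrib)
  qed
  ultimately have k: "k = - (L *v exit_vector T)"
    by (simp only: k_def phase_type_resolvent_def mv_minus_left)
  have "(T + mat \<gamma>) *v k = - exit_vector T"
    using L by (simp add: k mv_minus_right matrix_vector_mul_assoc)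
  then have Tk: "T *v k + \<gamma> *\<^sub>R k = - exit_vector T" by (simp add: mv_add_left mat_mult_vector)
  then show "T *v k = - exit_vector T - \<gamma> *\<^sub>R k" by (simp add: algebra_simps)
  have "(T + mat \<gamma>) *v (L *v k) = k" using L by (simp add: matrix_vector_mul_assoc)
  then show "\<exists>l. T *v l + \<gamma> *\<^sub>R l = k" by (auto simp: mv_add_left mat_mult_vector)
  fix i
  define f where "f = (\<lambda>x. exp (\<gamma> * x) * (axis i 1 \<bullet> (mexp T x *v (k - 1))))"
  have fd: "(f has_real_derivative - \<gamma> * (exp (\<gamma> * x) * (axis i 1 \<bullet> (mexp T x *v 1)))) (at x)" for x
  proof -
    have "T *v (k - 1) + \<gamma> *\<^sub>R (k - 1) = - (\<gamma> *\<^sub>R 1)"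
      using Tk by (simp add: mv_diff_right exit_vector_def scaleR_diff_right algebra_simps)
    then show ?thesis
      unfolding f_def using scaled_form_deriv[of \<gamma> "axis i 1" T "k - 1" x]
      by (simp add: mv_minus_right mv_scaleR_right mult.left_commute)
  qed
  have "0 \<le> f 0"
  proof (rule tendsto_le[OF trivial_limit_at_top_linorder tendsto_const])
    show "(f \<longlongrightarrow> 0) at_top" unfolding f_def by (rule decay)
    show "\<forall>\<^sub>F x in at_top. f x \<le> f 0"
    proof (rule eventually_at_top_linorderI)
      fix x :: real assume x: "0 \<le> x"
      show "f x \<le> f 0"
      proof (rule DERIV_nonpos_imp_nonincreasing[OF x])
        fix z :: real assume z: "0 \<le> z" "z \<le> x"
        have "0 \<le> axis i 1 \<bullet> (mexp T z *v 1)"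
          using met z by (intro matrix_exp_form_nonneg) (auto simp: axis_def)
        then have "- \<gamma> * (exp (\<gamma> * z) * (axis i 1 \<bullet> (mexp T z *v 1))) \<le> 0"
          using \<gamma> by (simp add: mult_nonneg_nonneg)
        with fd[of z] show "\<exists>d. (f has_real_derivative d) (at z) \<and> d \<le> 0" by blast
      qed
    qed
  qed
  then show "1 \<le> k $ i" by (simp add: f_def inner_axis')
qed

subsection \<open>Random walks and their minima\<close>

text \<open>The components are the endpoint and the minimum including the start. Recursing on the
  first increment gives Lindley's recursion path by path; the offset \<open>k\<close> names the
  remaining increments, from which the first one is separated by independence.\<close>

primrec walk :: "(nat \<Rightarrow> real) \<Rightarrow> nat \<Rightarrow> nat \<Rightarrow> real \<times> real" where
  "walk x k 0 = (0, 0)"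
| "walk x k (Suc m) = (x k + fst (walk x (Suc k) m), min 0 (x k + snd (walk x (Suc k) m)))"

primrec walk_law :: "real measure \<Rightarrow> nat \<Rightarrow> (real \<times> real) measure" where
  "walk_law \<nu> 0 = return (borel \<Otimes>\<^sub>M borel) (0, 0)"
| "walk_law \<nu> (Suc m) = distr (\<nu> \<Otimes>\<^sub>M walk_law \<nu> m) (borel \<Otimes>\<^sub>M borel)
      (\<lambda>(x, p). (x + fst p, min 0 (x + snd p)))"

lemma walk_cong: "(\<And>i. k \<le> i \<Longrightarrow> i < k + m \<Longrightarrow> x i = y i) \<Longrightarrow> walk x k m = walk y k m"
proof (induction m arbitrary: k)
  case (Suc m)
  have "walk x (Suc k) m = walk y (Suc k) m" by (rule Suc.IH) (use Suc.prems in auto)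
  then show ?case using Suc.prems[of k] by simp
qed simp

lemma walk_measurable:
  assumes "{k..<k + m} \<subseteq> I"
  shows "(\<lambda>x. walk x k m) \<in> (\<Pi>\<^sub>M i\<in>I. borel) \<rightarrow>\<^sub>M borel \<Otimes>\<^sub>M borel"
  using assms
proof (induction m arbitrary: k)
  case (Suc m)
  have [measurable]: "(\<lambda>x. walk x (Suc k) m) \<in> (\<Pi>\<^sub>M i\<in>I. borel) \<rightarrow>\<^sub>M borel \<Otimes>\<^sub>M borel"
    by (rule Suc.IH) (use Suc.prems in auto)
  have [measurable]: "(\<lambda>x. x k) \<in> (\<Pi>\<^sub>M i\<in>I. borel :: real measure) \<rightarrow>\<^sub>M borel"
    by (rule measurable_component_singleton) (use Suc.prems in auto)
  show ?case by simp
qed simp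

lemma walk_increments:
  "walk (\<lambda>i. a (Suc i) - a i) k m = (a (k + m) - a k, Min ((\<lambda>j. a (k + j) - a k) ` {..m}))"
proof (induction m arbitrary: k)
  case (Suc m)
  have "(\<lambda>j. a (k + j) - a k) ` {..Suc m}
      = insert 0 ((\<lambda>x. (a (Suc k) - a k) + x) ` ((\<lambda>j. a (Suc k + j) - a (Suc k)) ` {..m}))"
    unfolding atMost_Suc_eq_insert_0 by (auto simp: image_image)
  then have "Min ((\<lambda>j. a (k + j) - a k) ` {..Suc m})
      = min 0 (Min ((\<lambda>x. (a (Suc k) - a k) + x) ` ((\<lambda>j. a (Suc k + j) - a (Suc k)) ` {..m})))"
    by simp
  also have "Min ((\<lambda>x. (a (Suc k) - a k) + x) ` ((\<lambda>j. a (Suc k + j) - a (Suc k)) ` {..m}))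
      = (a (Suc k) - a k) + Min ((\<lambda>j. a (Suc k + j) - a (Suc k)) ` {..m})"
    by (rule mono_Min_commute[symmetric]) (auto intro: monoI)
  finally show ?case by (simp add: Suc.IH)
qed simp

lemma walk_snd_le_fst: "snd (walk x k m) \<le> fst (walk x k m)"
proof (induction m arbitrary: k)
  case (Suc m) show ?case using Suc[of "Suc k"] by (simp add: min.coboundedI2)
qed simp

context
  fixes \<nu> :: "real measure"
  assumes \<nu>: "prob_space \<nu>" "sets \<nu> = sets borel"
begin

lemma walk_law_step_measurable:
  assumes "sets L = sets (borel \<Otimes>\<^sub>M borel)"
  shows "(\<lambda>(x, p). (x + fst p, min 0 (x + snd p))) \<in> \<nu> \<Otimes>\<^sub>M L \<rightarrow>\<^sub>M (borel :: real measure) \<Otimes>\<^sub>M (borel :: real measure)"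
proof -
  note [measurable_cong] = \<nu>(2) assms
  show ?thesis by measurable
qed

lemma sets_walk_law [simp]: "sets (walk_law \<nu> m) = sets (borel \<Otimes>\<^sub>M borel)"
  by (cases m) auto

lemma prob_space_walk_law: "prob_space (walk_law \<nu> m)"
proof (induction m)
  case 0
  then show ?case by (auto intro!: prob_space_return simp: space_pair_measure)
next
  case (Suc m)
  interpret a: prob_space \<nu> by (rule \<nu>)
  interpret b: prob_space "walk_law \<nu> m" by (rule Suc)
  interpret pair_prob_space \<nu> "walk_law \<nu> m" ..
  show ?case by (simp del: split_paired_All) (intro prob_space_distr walk_law_step_measurable sets_walk_law)
qed

lemma measurable_walk_law: "measurable (walk_law \<nu> m) N = measurable (borel \<Otimes>\<^sub>M borel) N"
  by (rule measurable_cong_sets) auto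

lemma nn_integral_walk_law_0: "f \<in> borel_measurable (borel \<Otimes>\<^sub>M borel) \<Longrightarrow> (\<integral>\<^sup>+p. f p \<partial>walk_law \<nu> 0) = f (0, 0)"
  by (simp add: nn_integral_return space_pair_measure)

lemma nn_integral_walk_law_Suc:
  assumes f[measurable]: "f \<in> borel_measurable (borel \<Otimes>\<^sub>M borel)"
  shows "(\<integral>\<^sup>+p. f p \<partial>walk_law \<nu> (Suc m))
      = (\<integral>\<^sup>+x. (\<integral>\<^sup>+p. f (x + fst p, min 0 (x + snd p)) \<partial>walk_law \<nu> m) \<partial>\<nu>)"
proof -
  interpret prob_space "walk_law \<nu> m" by (rule prob_space_walk_law)
  note [measurable_cong] = \<nu>(2) sets_walk_law
  have "(\<integral>\<^sup>+p. f p \<partial>walk_law \<nu> (Suc m))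
      = (\<integral>\<^sup>+z. f (case z of (x, p) \<Rightarrow> (x + fst p, min 0 (x + snd p))) \<partial>(\<nu> \<Otimes>\<^sub>M walk_law \<nu> m))"
    unfolding walk_law.simps
    by (rule nn_integral_distr[OF walk_law_step_measurable]) (simp_all add: f)
  also have "\<dots> = (\<integral>\<^sup>+x. (\<integral>\<^sup>+p. f (x + fst p, min 0 (x + snd p)) \<partial>walk_law \<nu> m) \<partial>\<nu>)"
    by (subst nn_integral_fst[symmetric]) auto
  finally show ?thesis .
qed

definition step_mgf :: "real \<Rightarrow> ennreal" where
  "step_mgf \<theta> = (\<integral>\<^sup>+x. ennreal (exp (\<theta> * x)) \<partial>\<nu>)"

definition min_transform :: "nat \<Rightarrow> real \<Rightarrow> ennreal" where
  "min_transform m \<theta> = (\<integral>\<^sup>+p. ennreal (exp (\<theta> * snd p)) \<partial>walk_law \<nu> m)"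

text \<open>The expected loss of one step in Lindley's recursion. The positive part is taken by
  \<open>ennreal\<close>, which sends negative numbers to 0.\<close>

definition overshoot :: "nat \<Rightarrow> real \<Rightarrow> ennreal" where
  "overshoot m \<theta> = (\<integral>\<^sup>+x. (\<integral>\<^sup>+p. ennreal (exp (\<theta> * (x + snd p)) - 1) \<partial>walk_law \<nu> m) \<partial>\<nu>)"

lemma nn_integral_product_walk_law:
  fixes f g :: "_ \<Rightarrow> ennreal"
  assumes [measurable]: "f \<in> borel_measurable borel" "g \<in> borel_measurable (borel \<Otimes>\<^sub>M borel)"
  shows "(\<integral>\<^sup>+x. (\<integral>\<^sup>+p. f x * g p \<partial>walk_law \<nu> m) \<partial>\<nu>) = (\<integral>\<^sup>+x. f x \<partial>\<nu>) * (\<integral>\<^sup>+p. g p \<partial>walk_law \<nu> m)"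
proof -
  note [measurable_cong] = \<nu>(2) sets_walk_law
  show ?thesis
    by (subst nn_integral_cmult, simp add: measurable_walk_law)
       (rule nn_integral_multc, simp)
qed

lemma walk_law_mgf: "(\<integral>\<^sup>+p. ennreal (exp (\<theta> * fst p)) \<partial>walk_law \<nu> m) = step_mgf \<theta> ^ m"
proof (induction m)
  case 0 show ?case by (subst nn_integral_walk_law_0) auto
next
  case (Suc m)
  have "(\<integral>\<^sup>+p. ennreal (exp (\<theta> * fst p)) \<partial>walk_law \<nu> (Suc m))
      = (\<integral>\<^sup>+x. (\<integral>\<^sup>+p. ennreal (exp (\<theta> * x)) * ennreal (exp (\<theta> * fst p)) \<partial>walk_law \<nu> m) \<partial>\<nu>)"
    by (subst nn_integral_walk_law_Suc) (auto simp: distrib_left exp_add ennreal_mult)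
  also have "\<dots> = step_mgf \<theta> * step_mgf \<theta> ^ m"
    by (subst nn_integral_product_walk_law) (auto simp: step_mgf_def Suc)
  finally show ?case by simp
qed

lemma min_transform_0: "min_transform 0 \<theta> = 1"
  unfolding min_transform_def by (subst nn_integral_walk_law_0) auto

text \<open>From \<open>exp(\<theta> min(0, z)) = exp(\<theta> z) - (exp(\<theta> z) - 1)\<^sup>+\<close>.\<close>

lemma min_transform_Suc:
  assumes "0 \<le> \<theta>"
  shows "min_transform (Suc m) \<theta> + overshoot m \<theta> = step_mgf \<theta> * min_transform m \<theta>"
proof -
  note [measurable_cong] = \<nu>(2) sets_walk_law
  interpret prob_space "walk_law \<nu> m" by (rule prob_space_walk_law)
  have split: "ennreal (exp (\<theta> * min 0 z)) + ennreal (exp (\<theta> * z) - 1) = ennreal (exp (\<theta> * z))" for z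
  proof (cases "0 \<le> z")
    case True
    then have "1 \<le> exp (\<theta> * z)" using assms by simp
    then show ?thesis using True by (simp add: min_absorb1 flip: ennreal_plus ennreal_1)
  next
    case False
    then have "exp (\<theta> * z) - 1 \<le> 0" using assms by (simp add: mult_nonneg_nonpos)
    then show ?thesis using False by (simp add: min_absorb2 ennreal_neg)
  qed
  have "min_transform (Suc m) \<theta> + overshoot m \<theta>
      = (\<integral>\<^sup>+x. (\<integral>\<^sup>+p. ennreal (exp (\<theta> * min 0 (x + snd p))) \<partial>walk_law \<nu> m) \<partial>\<nu>)
        + (\<integral>\<^sup>+x. (\<integral>\<^sup>+p. ennreal (exp (\<theta> * (x + snd p)) - 1) \<partial>walk_law \<nu> m) \<partial>\<nu>)"
    unfolding min_transform_def overshoot_def by (subst nn_integral_walk_law_Suc) auto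
  also have "\<dots> = (\<integral>\<^sup>+x. (\<integral>\<^sup>+p. ennreal (exp (\<theta> * min 0 (x + snd p))) + ennreal (exp (\<theta> * (x + snd p)) - 1)
        \<partial>walk_law \<nu> m) \<partial>\<nu>)"
    by (subst nn_integral_add[symmetric]; (measurable; fail)?)
       (intro nn_integral_cong nn_integral_add[symmetric]; measurable)
  also have "\<dots> = (\<integral>\<^sup>+x. (\<integral>\<^sup>+p. ennreal (exp (\<theta> * x)) * ennreal (exp (\<theta> * snd p)) \<partial>walk_law \<nu> m) \<partial>\<nu>)"
    unfolding split by (simp add: distrib_left exp_add ennreal_mult)
  also have "\<dots> = step_mgf \<theta> * min_transform m \<theta>"
    by (subst nn_integral_product_walk_law) (auto simp: step_mgf_def min_transform_def)
  finally show ?thesis .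
qed

text \<open>With a step factor of at least 1 the transform can shrink only through the truncation at
  0, so what is missing from 1 is at most the accumulated losses.\<close>

lemma min_transform_ge:
  assumes "0 \<le> \<theta>" "1 \<le> step_mgf \<theta>"
  shows "1 \<le> min_transform M \<theta> + (\<Sum>m<M. overshoot m \<theta>)"
proof (induction M)
  case 0 show ?case by (simp add: min_transform_0)
next
  case (Suc M)
  have "min_transform M \<theta> \<le> step_mgf \<theta> * min_transform M \<theta>"
    using mult_right_mono[OF assms(2), of "min_transform M \<theta>"] by simp
  then have "min_transform M \<theta> + (\<Sum>m<M. overshoot m \<theta>)
      \<le> (min_transform (Suc M) \<theta> + overshoot M \<theta>) + (\<Sum>m<M. overshoot m \<theta>)"
    unfolding min_transform_Suc[OF assms(1)] by (rule add_right_mono)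
  with Suc have "1 \<le> (min_transform (Suc M) \<theta> + overshoot M \<theta>) + (\<Sum>m<M. overshoot m \<theta>)"
    by (rule order_trans)
  then show ?case by (simp only: sum.lessThan_Suc add_ac)
qed

text \<open>At \<Phi> the discount compensates the step factor exp c exactly, and the recursion
  telescopes to an identity. In particular the discounted losses sum to at most 1. The weight m + 1
  belongs to the step from m to m + 1.\<close>

lemma discounted_overshoot:
  assumes "0 \<le> \<Phi>" "step_mgf \<Phi> = ennreal (exp c)"
  shows "(\<Sum>m<M. ennreal (exp (- c * (real m + 1))) * overshoot m \<Phi>)
      + ennreal (exp (- c * real M)) * min_transform M \<Phi> = 1"
proof (induction M)
  case 0 show ?case by (simp add: min_transform_0)
next
  case (Suc M)
  have "ennreal (exp (- c * real M)) * min_transform M \<Phi>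
      = ennreal (exp (- c * (real M + 1))) * (ennreal (exp c) * min_transform M \<Phi>)"
  proof -
    have "exp (- c * real M) = exp (- c * (real M + 1)) * exp c"
      by (simp add: mult_exp_exp algebra_simps)
    then show ?thesis by (simp only: ennreal_mult[OF exp_ge_zero exp_ge_zero] mult.assoc)
  qed
  also have "\<dots> = ennreal (exp (- c * (real M + 1))) * (min_transform (Suc M) \<Phi> + overshoot M \<Phi>)"
    unfolding min_transform_Suc[OF assms(1)] assms(2) ..
  finally show ?case using Suc by (simp add: distrib_left add_ac)
qed

text \<open>For z \<ge> 0 the value of exp at \<theta>z lies below the chord from 0 to \<Phi>z; for
  z < 0 the left side is 0.\<close>

lemma overshoot_le:
  assumes "0 \<le> \<theta>" "\<theta> \<le> \<Phi>" "0 < \<Phi>"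
  shows "overshoot m \<theta> \<le> ennreal (\<theta> / \<Phi>) * overshoot m \<Phi>"
proof -
  note [measurable_cong] = \<nu>(2) sets_walk_law
  interpret prob_space "walk_law \<nu> m" by (rule prob_space_walk_law)
  have le: "ennreal (exp (\<theta> * z) - 1) \<le> ennreal (\<theta> / \<Phi>) * ennreal (exp (\<Phi> * z) - 1)" for z
  proof (cases "0 \<le> z")
    case True
    have "exp ((1 - \<theta> / \<Phi>) *\<^sub>R 0 + (\<theta> / \<Phi>) *\<^sub>R (\<Phi> * z)) \<le> (1 - \<theta> / \<Phi>) * exp 0 + \<theta> / \<Phi> * exp (\<Phi> * z)"
      using assms by (intro convex_onD[OF exp_convex]) auto
    then have "exp (\<theta> * z) - 1 \<le> \<theta> / \<Phi> * (exp (\<Phi> * z) - 1)"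
      using assms by (simp add: algebra_simps)
    then show ?thesis using assms True by (simp add: ennreal_mult[symmetric] ennreal_leI)
  next
    case False
    then have "exp (\<theta> * z) - 1 \<le> 0" using assms by (simp add: mult_nonneg_nonpos)
    then show ?thesis by (simp add: ennreal_neg)
  qed
  have "overshoot m \<theta> \<le> (\<integral>\<^sup>+x. (\<integral>\<^sup>+p. ennreal (\<theta> / \<Phi>) * ennreal (exp (\<Phi> * (x + snd p)) - 1) \<partial>walk_law \<nu> m) \<partial>\<nu>)"
    unfolding overshoot_def by (intro nn_integral_mono le)
  also have "\<dots> = ennreal (\<theta> / \<Phi>) * overshoot m \<Phi>"
    unfolding overshoot_def
    by (subst nn_integral_cmult, measurable)+
  finally show ?thesis .
qed

definition min_tail :: "nat \<Rightarrow> real \<Rightarrow> ennreal" where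
  "min_tail m z = (\<integral>\<^sup>+p. indicator {p. snd p < - z} p \<partial>walk_law \<nu> m)"

lemma min_tail_neg: "z < 0 \<Longrightarrow> min_tail m z = 1"
proof (cases m)
  case 0
  assume "z < 0" then show ?thesis
    unfolding min_tail_def 0 by (subst nn_integral_walk_law_0) auto
next
  case (Suc n)
  assume "z < 0"
  interpret a: prob_space \<nu> by (rule \<nu>)
  interpret b: prob_space "walk_law \<nu> n" by (rule prob_space_walk_law)
  show ?thesis
    unfolding min_tail_def Suc using \<open>z < 0\<close>
    by (subst nn_integral_walk_law_Suc) (auto simp: b.emeasure_space_1 a.emeasure_space_1)
qed

lemma min_tail_0: "0 \<le> z \<Longrightarrow> min_tail 0 z = 0"
  unfolding min_tail_def by (subst nn_integral_walk_law_0) auto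

text \<open>For z \<ge> 0 the truncation at 0 does not affect whether the minimum lies below -z, so
  the first step merely shifts the level.\<close>

lemma min_tail_Suc: "0 \<le> z \<Longrightarrow> min_tail (Suc m) z = (\<integral>\<^sup>+x. min_tail m (z + x) \<partial>\<nu>)"
  unfolding min_tail_def
  by (subst nn_integral_walk_law_Suc) (auto simp: indicator_def intro!: nn_integral_cong)

lemma min_tail_mono: "z \<le> z' \<Longrightarrow> min_tail m z' \<le> min_tail m z"
  unfolding min_tail_def by (intro nn_integral_mono) (auto simp: indicator_def)

lemma measurable_min_tail [measurable]: "min_tail m \<in> borel_measurable borel"
proof -
  note [measurable_cong] = \<nu>(2) sets_walk_law
  interpret prob_space "walk_law \<nu> m" by (rule prob_space_walk_law)
  show ?thesis unfolding min_tail_def by measurable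
qed

text \<open>The bound has to be stated for all real \<open>z\<close>: the first step may carry the level to the other side of 0,
  where the minimal tail is 1.\<close>

lemma tilted_min_tail:
  assumes "0 \<le> \<gamma>" "step_mgf \<gamma> = 1"
  shows "(\<integral>\<^sup>+p. ennreal (exp (\<gamma> * fst p)) * indicator {p. snd p < - z} p \<partial>walk_law \<nu> m)
      \<le> ennreal (exp (- \<gamma> * z)) * min_tail m z"
proof (induction m arbitrary: z)
  case 0
  show ?case
  proof (cases "0 \<le> z")
    case True then show ?thesis by (subst nn_integral_walk_law_0) auto
  next
    case False
    then have "1 \<le> exp (- \<gamma> * z)" using assms(1) by (simp add: mult_nonneg_nonpos)
    then show ?thesis using False by (subst nn_integral_walk_law_0) (auto simp: min_tail_neg)
  qed
next
  case (Suc m)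
  note [measurable_cong] = \<nu>(2) sets_walk_law
  interpret prob_space "walk_law \<nu> m" by (rule prob_space_walk_law)
  show ?case
  proof (cases "0 \<le> z")
    case True
    have "(\<integral>\<^sup>+p. ennreal (exp (\<gamma> * fst p)) * indicator {p. snd p < - z} p \<partial>walk_law \<nu> (Suc m))
        = (\<integral>\<^sup>+x. (\<integral>\<^sup>+p. ennreal (exp (\<gamma> * x)) * (ennreal (exp (\<gamma> * fst p)) * indicator {p. snd p < - (z + x)} p)
            \<partial>walk_law \<nu> m) \<partial>\<nu>)"
      using True by (subst nn_integral_walk_law_Suc)
         (auto simp: indicator_def distrib_left exp_add ennreal_mult intro!: nn_integral_cong)
    also have "\<dots> = (\<integral>\<^sup>+x. ennreal (exp (\<gamma> * x)) * (\<integral>\<^sup>+p. ennreal (exp (\<gamma> * fst p)) * indicator {p. snd p < - (z + x)} p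
            \<partial>walk_law \<nu> m) \<partial>\<nu>)"
      by (intro nn_integral_cong nn_integral_cmult) measurable
    also have "\<dots> \<le> (\<integral>\<^sup>+x. ennreal (exp (\<gamma> * x)) * (ennreal (exp (- \<gamma> * (z + x))) * min_tail m (z + x)) \<partial>\<nu>)"
      by (intro nn_integral_mono mult_left_mono Suc) auto
    \<comment> \<open>The weight exp(\<gamma>x) of the first step cancels the x in the bound at
      level z + x, so the factor exp(-\<gamma>z) survives unchanged.\<close>
    also have "\<dots> = (\<integral>\<^sup>+x. ennreal (exp (- \<gamma> * z)) * min_tail m (z + x) \<partial>\<nu>)"
      by (intro nn_integral_cong) (simp add: mult.assoc[symmetric] ennreal_mult[symmetric] mult_exp_exp algebra_simps)
    also have "\<dots> = ennreal (exp (- \<gamma> * z)) * min_tail (Suc m) z"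
      unfolding min_tail_Suc[OF True] by (rule nn_integral_cmult) measurable
    finally show ?thesis .
  next
    case False
    have "(\<integral>\<^sup>+p. ennreal (exp (\<gamma> * fst p)) * indicator {p. snd p < - z} p \<partial>walk_law \<nu> (Suc m))
        \<le> (\<integral>\<^sup>+p. ennreal (exp (\<gamma> * fst p)) \<partial>walk_law \<nu> (Suc m))"
      by (intro nn_integral_mono) (auto simp: indicator_def)
    also have "\<dots> = ennreal 1" by (subst walk_law_mgf) (simp add: assms)
    also have "\<dots> \<le> ennreal (exp (- \<gamma> * z))"
      using False assms(1) by (intro ennreal_leI) (simp add: mult_nonneg_nonpos)
    finally show ?thesis using False by (simp add: min_tail_neg)
  qed
qed

text \<open>Each further descent by \<open>l + e\<close> costs a factor \<open>p\<close>, because a step goes down by at most \<open>e\<close>.\<close>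

lemma min_tail_geometric_step:
  assumes l: "0 \<le> l" "0 \<le> e" and step: "AE x in \<nu>. - e \<le> x"
    and p: "\<And>m. m \<le> N \<Longrightarrow> min_tail m l \<le> p"
    and "m \<le> N" "- e \<le> z"
  shows "min_tail m (z + (l + e)) \<le> p * min_tail m z"
  using assms(5,6)
proof (induction m arbitrary: z)
  case 0 then show ?case using l by (simp add: min_tail_0)
next
  case (Suc m)
  note [measurable_cong] = \<nu>(2)
  show ?case
  proof (cases "0 \<le> z")
    case True
    have "min_tail (Suc m) (z + (l + e)) = (\<integral>\<^sup>+x. min_tail m (z + x + (l + e)) \<partial>\<nu>)"
      using True l by (subst min_tail_Suc) (auto simp: add_ac)
    also have "\<dots> \<le> (\<integral>\<^sup>+x. p * min_tail m (z + x) \<partial>\<nu>)"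
      using step Suc True by (intro nn_integral_mono_AE) auto
    also have "\<dots> = p * min_tail (Suc m) z"
      unfolding min_tail_Suc[OF True] by (rule nn_integral_cmult) measurable
    finally show ?thesis .
  next
    case False
    have "min_tail (Suc m) (z + (l + e)) \<le> min_tail (Suc m) l"
      using Suc.prems by (intro min_tail_mono) auto
    also have "\<dots> \<le> p" using Suc.prems by (intro p)
    finally show ?thesis using False by (simp add: min_tail_neg)
  qed
qed

text \<open>The tail beyond \<open>l\<close> decays geometrically over layers of width l + e, and
  the condition on \<open>p\<close> makes this decay beat the growth of the exponential by a factor
  2 per layer. The constant is exp(sl) for the part up to \<open>l\<close> plus exp(sl)(1/2 + 1/4 +
  ...) for the layers.\<close>

lemma min_exp_moment:
  assumes l: "0 < l" "0 \<le> e" and step: "AE x in \<nu>. - e \<le> x"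
    and p: "\<And>m. m \<le> N \<Longrightarrow> min_tail m l \<le> ennreal p" "0 \<le> p" "p * exp (s * (l + e)) \<le> 1 / 2" and s: "0 \<le> s"
  shows "(\<integral>\<^sup>+q. ennreal (exp (- s * snd q)) \<partial>walk_law \<nu> N) \<le> ennreal (2 * exp (s * l))"
proof -
  note [measurable_cong] = \<nu>(2) sets_walk_law
  interpret prob_space "walk_law \<nu> N" by (rule prob_space_walk_law)
  define d where "d = l + e"
  have d: "0 < d" using l by (simp add: d_def)
  have geo: "min_tail N (l + real j * d) \<le> ennreal (p ^ Suc j)" for j
  proof (induction j)
    case 0 show ?case using p(1)[of N] by simp
  next
    case (Suc j)
    have "min_tail N (l + real (Suc j) * d) = min_tail N ((l + real j * d) + (l + e))"
      by (simp add: d_def algebra_simps)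
    also have "\<dots> \<le> ennreal p * min_tail N (l + real j * d)"
    proof (rule min_tail_geometric_step[OF _ _ step p(1)])
      have "0 \<le> l + real j * d" using l d by simp
      then show "- e \<le> l + real j * d" using l by linarith
    qed (use l in auto)
    also have "\<dots> \<le> ennreal p * ennreal (p ^ Suc j)" by (intro mult_left_mono Suc) simp
    finally show ?case using p(2) by (simp add: ennreal_mult[symmetric])
  qed
  define c where "c = (\<lambda>j. ennreal (exp (s * (l + (real j + 1) * d))))"
  define D where "D = (\<lambda>j (q :: real \<times> real). c j * indicator {p. snd p < - (l + real j * d)} q)"
  have [measurable]: "D j \<in> borel_measurable (borel \<Otimes>\<^sub>M borel)" for j
    unfolding D_def by measurable
  have pt: "ennreal (exp (- s * snd q)) \<le> ennreal (exp (s * l)) + (\<Sum>j. D j q)" for q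
  proof (cases "- snd q \<le> l")
    case True
    then have "exp (- s * snd q) \<le> exp (s * l)" using mult_left_mono[OF True s] by simp
    then have "ennreal (exp (- s * snd q)) \<le> ennreal (exp (s * l))" by (rule ennreal_leI)
    then show ?thesis by (rule order_trans) (rule add_increasing2, auto)
  next
    case False
    let ?t = "- snd q - l"
    \<comment> \<open>Ceiling minus one selects the layer that is open below and closed above,
      matching the strict inequality in \<open>min_tail\<close>.\<close>
    define j where "j = nat (\<lceil>?t / d\<rceil> - 1)"
    have "0 < ?t / d" using False d by simp
    then have "1 \<le> \<lceil>?t / d\<rceil>" by linarith
    then have j: "real j = of_int \<lceil>?t / d\<rceil> - 1" by (simp add: j_def)
    have "real j < ?t / d" "?t / d \<le> real j + 1" unfolding j by linarith+
    then have j1: "real j * d < ?t" and j2: "?t \<le> (real j + 1) * d"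
      using d by (simp_all add: field_simps)
    have "- snd q \<le> l + (real j + 1) * d" using j2 by linarith
    from mult_left_mono[OF this s]
    have "ennreal (exp (- s * snd q)) \<le> c j" by (simp add: c_def ennreal_leI)
    also have "\<dots> = D j q" using j1 by (simp add: D_def)
    also have "\<dots> \<le> (\<Sum>j. D j q)"
      using sum_le_suminf[of "\<lambda>j. D j q" "{j}"] by simp
    finally show ?thesis by (rule add_increasing[rotated]) simp
  qed
  have "(\<integral>\<^sup>+q. ennreal (exp (- s * snd q)) \<partial>walk_law \<nu> N)
      \<le> (\<integral>\<^sup>+q. ennreal (exp (s * l)) + (\<Sum>j. D j q) \<partial>walk_law \<nu> N)"
    by (intro nn_integral_mono pt)
  also have "\<dots> = (\<integral>\<^sup>+q. ennreal (exp (s * l)) \<partial>walk_law \<nu> N) + (\<integral>\<^sup>+q. (\<Sum>j. D j q) \<partial>walk_law \<nu> N)"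
    by (rule nn_integral_add) measurable
  also have "(\<integral>\<^sup>+q. ennreal (exp (s * l)) \<partial>walk_law \<nu> N) = ennreal (exp (s * l))"
    by (simp add: emeasure_space_1)
  also have "(\<integral>\<^sup>+q. (\<Sum>j. D j q) \<partial>walk_law \<nu> N) = (\<Sum>j. (\<integral>\<^sup>+q. D j q \<partial>walk_law \<nu> N))"
    by (rule nn_integral_suminf) measurable
  also have "\<dots> = (\<Sum>j. c j * min_tail N (l + real j * d))"
    unfolding D_def min_tail_def by (intro arg_cong[where f = suminf] ext nn_integral_cmult) measurable
  also have "\<dots> \<le> (\<Sum>j. ennreal (exp (s * l) * (1 / 2) ^ Suc j))"
  proof (rule suminf_le)
    fix j
    have "c j * min_tail N (l + real j * d) \<le> c j * ennreal (p ^ Suc j)"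
      by (intro mult_left_mono geo) simp
    also have "\<dots> = ennreal (exp (s * l) * (p * exp (s * d)) ^ Suc j)"
    proof -
      have "exp (s * (l + (real j + 1) * d)) = exp (s * l) * exp (s * d) ^ Suc j"
        by (simp only: exp_of_nat_mult[symmetric] mult_exp_exp) (simp add: algebra_simps)
      then show ?thesis
        using p(2) by (simp only: c_def power_mult_distrib) (simp add: ennreal_mult[symmetric] mult_ac)
    qed
    also have "\<dots> \<le> ennreal (exp (s * l) * (1 / 2) ^ Suc j)"
      using p d_def by (intro ennreal_leI mult_left_mono power_mono) auto
    finally show "c j * min_tail N (l + real j * d) \<le> ennreal (exp (s * l) * (1 / 2) ^ Suc j)" .
  qed (auto intro: summableI)
  also have "\<dots> = ennreal (exp (s * l))"
    using sums_mult[OF power_half_series, of "exp (s * l)"] by (intro suminf_ennreal_eq) auto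
  finally show ?thesis by (simp add: ennreal_plus[symmetric] del: ennreal_plus)
qed

end

section \<open>Independent variables: joint laws, products of expectations, laws of walks\<close>

lemma (in prob_space) indep_var_distr_Pair:
  assumes "indep_var S X T Y" and f: "f \<in> S \<rightarrow>\<^sub>M S'" and g: "g \<in> T \<rightarrow>\<^sub>M T'"
  shows "distr M (S' \<Otimes>\<^sub>M T') (\<lambda>\<omega>. (f (X \<omega>), g (Y \<omega>))) = distr M S' (\<lambda>\<omega>. f (X \<omega>)) \<Otimes>\<^sub>M distr M T' (\<lambda>\<omega>. g (Y \<omega>))"
proof -
  note [measurable] = f g
  have rv[measurable]: "random_variable S X" "random_variable T Y"
    and joint: "distr M S X \<Otimes>\<^sub>M distr M T Y = distr M (S \<Otimes>\<^sub>M T) (\<lambda>x. (X x, Y x))"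
    using assms(1) by (auto simp: indep_var_distribution_eq)
  interpret Y: prob_space "distr M T Y" by (rule prob_space_distr) measurable
  interpret gY: prob_space "distr (distr M T Y) T' g" by (rule Y.prob_space_distr) measurable
  have "distr M S' (\<lambda>\<omega>. f (X \<omega>)) \<Otimes>\<^sub>M distr M T' (\<lambda>\<omega>. g (Y \<omega>))
      = distr (distr M S X) S' f \<Otimes>\<^sub>M distr (distr M T Y) T' g"
    by (simp add: distr_distr o_def)
  also have "\<dots> = distr (distr M S X \<Otimes>\<^sub>M distr M T Y) (S' \<Otimes>\<^sub>M T') (\<lambda>(x, y). (f x, g y))"
    by (rule pair_measure_distr) (measurable, unfold_locales)
  also have "\<dots> = distr M (S' \<Otimes>\<^sub>M T') (\<lambda>\<omega>. (f (X \<omega>), g (Y \<omega>)))"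
    unfolding joint by (subst distr_distr) (auto simp: o_def)
  finally show ?thesis ..
qed

lemma (in prob_space) indep_var_nn_integral_mult:
  fixes f g :: "_ \<Rightarrow> ennreal"
  assumes iv: "indep_var S X T Y" and f[measurable]: "f \<in> borel_measurable S" and g[measurable]: "g \<in> borel_measurable T"
  shows "(\<integral>\<^sup>+\<omega>. f (X \<omega>) * g (Y \<omega>) \<partial>M) = (\<integral>\<^sup>+\<omega>. f (X \<omega>) \<partial>M) * (\<integral>\<^sup>+\<omega>. g (Y \<omega>) \<partial>M)"
proof -
  have rv[measurable]: "random_variable S X" "random_variable T Y"
    using iv by (auto simp: indep_var_distribution_eq)
  interpret gY: prob_space "distr M borel (\<lambda>\<omega>. g (Y \<omega>))" by (rule prob_space_distr) measurable
  have "(\<integral>\<^sup>+\<omega>. f (X \<omega>) * g (Y \<omega>) \<partial>M)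
      = (\<integral>\<^sup>+z. fst z * snd z \<partial>distr M (borel \<Otimes>\<^sub>M borel) (\<lambda>\<omega>. (f (X \<omega>), g (Y \<omega>))))"
    by (subst nn_integral_distr) auto
  also have "\<dots> = (\<integral>\<^sup>+x. (\<integral>\<^sup>+y. x * y \<partial>distr M borel (\<lambda>\<omega>. g (Y \<omega>))) \<partial>distr M borel (\<lambda>\<omega>. f (X \<omega>)))"
    unfolding indep_var_distr_Pair[OF iv f g] by (subst gY.nn_integral_fst[symmetric]) auto
  also have "\<dots> = (\<integral>\<^sup>+\<omega>. f (X \<omega>) \<partial>M) * (\<integral>\<^sup>+\<omega>. g (Y \<omega>) \<partial>M)"
    by (simp add: nn_integral_cmult nn_integral_multc nn_integral_distr)
  finally show ?thesis .
qed

text \<open>The walk from k + 1 uses only increments with larger indices and is therefore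
  independent of the k-th one; their joint law is the product that \<open>walk_law\<close> pushes
  forward.\<close>

lemma (in prob_space) distr_walk:
  assumes ind: "indep_vars (\<lambda>_. borel) \<xi> {..<N}" and law: "\<And>i. i < N \<Longrightarrow> distr M borel (\<xi> i) = \<nu>"
    and \<nu>: "prob_space \<nu>" "sets \<nu> = sets borel"
  shows "k + m \<le> N \<Longrightarrow> distr M (borel \<Otimes>\<^sub>M borel) (\<lambda>\<omega>. walk (\<lambda>i. \<xi> i \<omega>) k m) = walk_law \<nu> m"
proof (induction m arbitrary: k)
  case 0
  have "distr M (borel \<Otimes>\<^sub>M borel) (\<lambda>\<omega>. (0, 0)) = (return (borel \<Otimes>\<^sub>M borel) (0, 0) :: (real \<times> real) measure)"
    by (rule distr_const) (simp add: space_pair_measure)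
  then show ?case by simp
next
  case (Suc m)
  let ?B = "{Suc k..<Suc k + m}"
  let ?W = "\<lambda>\<omega>. walk (\<lambda>i. \<xi> i \<omega>) (Suc k) m"
  have "indep_var (\<Pi>\<^sub>M i\<in>{k}. borel) (\<lambda>\<omega>. \<lambda>i\<in>{k}. \<xi> i \<omega>) (\<Pi>\<^sub>M i\<in>?B. borel) (\<lambda>\<omega>. \<lambda>i\<in>?B. \<xi> i \<omega>)"
    using Suc.prems by (intro indep_var_restrict[OF ind]) auto
  note iv = this
  have rest: "walk (\<lambda>i\<in>?B. \<xi> i \<omega>) (Suc k) m = ?W \<omega>" for \<omega>
    by (rule walk_cong) auto
  have [measurable]: "random_variable borel (\<xi> k)"
    using ind Suc.prems by (auto simp: indep_vars_def)
  have "random_variable (\<Pi>\<^sub>M i\<in>?B. borel) (\<lambda>\<omega>. \<lambda>i\<in>?B. \<xi> i \<omega>)"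
    using iv by (auto simp: indep_var_distribution_eq)
  from measurable_compose[OF this walk_measurable[OF order_refl]]
  have [measurable]: "random_variable (borel \<Otimes>\<^sub>M borel) ?W" unfolding rest .
  have joint: "distr M (borel \<Otimes>\<^sub>M (borel \<Otimes>\<^sub>M borel)) (\<lambda>\<omega>. (\<xi> k \<omega>, ?W \<omega>)) = \<nu> \<Otimes>\<^sub>M walk_law \<nu> m"
    using indep_var_distr_Pair[OF iv measurable_component_singleton[of k] walk_measurable[OF order_refl]]
      Suc.IH[of "Suc k"] law[of k] Suc.prems unfolding rest by simp
  have "walk_law \<nu> (Suc m) = distr (distr M (borel \<Otimes>\<^sub>M (borel \<Otimes>\<^sub>M borel)) (\<lambda>\<omega>. (\<xi> k \<omega>, ?W \<omega>)))
      (borel \<Otimes>\<^sub>M borel) (\<lambda>(x, p). (x + fst p, min 0 (x + snd p)))"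
    unfolding joint by simp
  also have "\<dots> = distr M (borel \<Otimes>\<^sub>M borel) (\<lambda>\<omega>. walk (\<lambda>i. \<xi> i \<omega>) k (Suc m))"
    by (subst distr_distr) (auto simp: o_def)
  finally show ?case by simp
qed

subsection \<open>Minimum of a random walk at an independent exponential time\<close>

lemma emeasure_exponential_atLeast:
  assumes "0 < q" "0 \<le> c"
  shows "emeasure (density lborel (\<lambda>x. ennreal (exponential_density q x))) {c..} = ennreal (exp (- q * c))"
proof -
  have "emeasure (density lborel (\<lambda>x. ennreal (exponential_density q x))) {c..}
      = (\<integral>\<^sup>+x. ennreal (q * exp (- q * x)) * indicator {c..} x \<partial>lborel)"
    using assms by (subst emeasure_density) (auto simp: exponential_density_def mult_ac indicator_def intro!: nn_integral_cong)
  also have "\<dots> = ennreal (0 - (- exp (- q * c)))"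
  proof (rule nn_integral_FTC_atLeast)
    show "((\<lambda>x. - exp (- q * x)) has_real_derivative q * exp (- q * x)) (at x)" for x
      by (auto intro!: derivative_eq_intros)
    have "((\<lambda>x. exp (- q * x)) \<longlongrightarrow> 0) at_top"
      using assms(1) by real_asymp
    then show "((\<lambda>x. - exp (- q * x)) \<longlongrightarrow> 0) at_top"
      using tendsto_minus by fastforce
  qed (use assms in auto)
  finally show ?thesis by simp
qed

text \<open>By time t \<ge> 0 the walk has made floor(t / h) + 1 steps, so the loss with index m is
  counted exactly when t \<ge> m h, an event of probability exp(-qmh). This is the discount
  exp(-qh(m + 1)) up to the factor exp(qh), the trace of the discretisation, which tends to 1 with
  the mesh.\<close>

lemma min_transform_exponential_time:
  fixes \<nu> :: "real measure"
  assumes \<nu>: "prob_space \<nu>" "sets \<nu> = sets borel"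
    and h: "0 < h" and q: "0 < q" and \<theta>: "0 \<le> \<theta>" "\<theta> \<le> \<Phi>" "0 < \<Phi>"
    and b: "1 \<le> step_mgf \<nu> \<theta>" "step_mgf \<nu> \<Phi> = ennreal (exp (q * h))"
  shows "1 \<le> (\<integral>\<^sup>+t. min_transform \<nu> (nat \<lfloor>t / h\<rfloor> + 1) \<theta> \<partial>density lborel (\<lambda>x. ennreal (exponential_density q x)))
      + ennreal (exp (q * h) * (\<theta> / \<Phi>))"
proof -
  define E where "E = density lborel (\<lambda>x. ennreal (exponential_density q x))"
  interpret E: prob_space E unfolding E_def using q by (rule prob_space_exponential_density)
  have sets_E[measurable_cong]: "sets E = sets borel" by (simp add: E_def)
  have E_pos: "AE t in E. 0 \<le> t"
    unfolding E_def by (subst AE_density) (auto simp: exponential_density_def)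
  let ?M = "\<lambda>t. nat \<lfloor>t / h\<rfloor> + 1"
  let ?y = "\<lambda>t. min_transform \<nu> (?M t) \<theta>" and ?d = "\<lambda>m. overshoot \<nu> m \<theta>"
  have y_meas: "?y \<in> borel_measurable E" by measurable
  have "1 \<le> (\<integral>\<^sup>+t. ?y t + (\<Sum>m. ?d m * indicator {real m * h..} t) \<partial>E)"
  proof -
    have "1 = (\<integral>\<^sup>+t. 1 \<partial>E)" by (simp add: E.emeasure_space_1)
    also have "\<dots> \<le> (\<integral>\<^sup>+t. ?y t + (\<Sum>m. ?d m * indicator {real m * h..} t) \<partial>E)"
    proof (rule nn_integral_mono_AE, use E_pos in eventually_elim)
      case (elim t)
      have ind: "m < ?M t \<Longrightarrow> real m * h \<le> t" for m
        using elim h by (simp add: less_Suc_eq_le le_nat_floor field_simps le_nat_iff le_floor_iff)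
      have "1 \<le> ?y t + (\<Sum>m<?M t. ?d m)"
        by (rule min_transform_ge[OF \<nu> \<theta>(1) b(1)])
      also have "(\<Sum>m<?M t. ?d m) = (\<Sum>m<?M t. ?d m * indicator {real m * h..} t)"
        using ind by (intro sum.cong) auto
      also have "\<dots> \<le> (\<Sum>m. ?d m * indicator {real m * h..} t)"
        by (rule sum_le_suminf) auto
      finally show ?case by (simp add: add_left_mono)
    qed
    finally show ?thesis .
  qed
  also have "\<dots> = (\<integral>\<^sup>+t. ?y t \<partial>E) + (\<integral>\<^sup>+t. (\<Sum>m. ?d m * indicator {real m * h..} t) \<partial>E)"
    by (rule nn_integral_add[OF y_meas]) measurable
  also have "(\<integral>\<^sup>+t. (\<Sum>m. ?d m * indicator {real m * h..} t) \<partial>E) = (\<Sum>m. (\<integral>\<^sup>+t. ?d m * indicator {real m * h..} t \<partial>E))"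
    by (rule nn_integral_suminf) measurable
  also have "\<dots> = (\<Sum>m. ?d m * ennreal (exp (- q * (real m * h))))"
    using q h by (intro arg_cong[where f = suminf] ext)
      (subst nn_integral_cmult_indicator, auto simp: E_def emeasure_exponential_atLeast)
  also have "\<dots> \<le> (\<Sum>m. ennreal (exp (q * h) * (\<theta> / \<Phi>)) * (ennreal (exp (- (q * h) * (real m + 1))) * overshoot \<nu> m \<Phi>))"
  proof (rule suminf_le)
    fix m
    have ex: "exp (- q * (real m * h)) = exp (q * h) * exp (- (q * h) * (real m + 1))"
      by (simp add: mult_exp_exp algebra_simps)
    have "?d m * ennreal (exp (- q * (real m * h)))
        \<le> (ennreal (\<theta> / \<Phi>) * overshoot \<nu> m \<Phi>) * ennreal (exp (- q * (real m * h)))"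
      by (intro mult_right_mono overshoot_le[OF \<nu> \<theta>]) simp
    also have "\<dots>
        = ennreal (exp (q * h) * (\<theta> / \<Phi>)) * (ennreal (exp (- (q * h) * (real m + 1))) * overshoot \<nu> m \<Phi>)"
      using \<theta> by (simp only: ex ennreal_mult exp_ge_zero divide_nonneg_pos) (simp only: mult_ac)
    finally show "?d m * ennreal (exp (- q * (real m * h)))
        \<le> ennreal (exp (q * h) * (\<theta> / \<Phi>)) * (ennreal (exp (- (q * h) * (real m + 1))) * overshoot \<nu> m \<Phi>)" .
  qed auto
  also have "\<dots> = ennreal (exp (q * h) * (\<theta> / \<Phi>)) * (\<Sum>m. ennreal (exp (- (q * h) * (real m + 1))) * overshoot \<nu> m \<Phi>)"
    by (rule ennreal_suminf_cmult)
  also have "\<dots> \<le> ennreal (exp (q * h) * (\<theta> / \<Phi>)) * 1"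
  proof (intro mult_left_mono suminf_le_const)
    fix N
    show "(\<Sum>m<N. ennreal (exp (- (q * h) * (real m + 1))) * overshoot \<nu> m \<Phi>) \<le> 1"
      unfolding discounted_overshoot[OF \<nu> less_imp_le[OF \<theta>(3)] b(2), of N, symmetric]
      by simp
  qed auto
  finally show ?thesis unfolding E_def by (simp add: add_left_mono)
qed

subsection \<open>Cadlag paths\<close>

lemma cadlag_local_bounds:
  assumes f: "cadlag_on_nonneg f" and x: "0 \<le> x" and \<epsilon>: "0 < \<epsilon>"
  obtains \<delta> l where "0 < \<delta>" "\<And>s. 0 \<le> s \<Longrightarrow> s < x \<Longrightarrow> x - \<delta> < s \<Longrightarrow> \<bar>f s - l\<bar> < \<epsilon>"
    "\<And>s. x \<le> s \<Longrightarrow> s < x + \<delta> \<Longrightarrow> \<bar>f s - f x\<bar> < \<epsilon>"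
    "0 < x \<Longrightarrow> (f \<longlongrightarrow> l) (at_left x)"
proof -
  have "(f \<longlongrightarrow> f x) (at_right x)" using f x by (simp add: cadlag_on_nonneg_def)
  from tendstoD[OF this \<epsilon>] obtain b where b: "x < b" "\<And>s. x < s \<Longrightarrow> s < b \<Longrightarrow> dist (f s) (f x) < \<epsilon>"
    unfolding eventually_at_right_field by blast
  obtain a l where a: "a < x" "\<And>s. 0 \<le> s \<Longrightarrow> a < s \<Longrightarrow> s < x \<Longrightarrow> dist (f s) l < \<epsilon>"
      "0 < x \<Longrightarrow> (f \<longlongrightarrow> l) (at_left x)"
  proof (cases "0 < x")
    case True
    then obtain l where l: "(f \<longlongrightarrow> l) (at_left x)" using f by (auto simp: cadlag_on_nonneg_def)
    from tendstoD[OF this \<epsilon>] obtain a where "a < x" "\<And>s. a < s \<Longrightarrow> s < x \<Longrightarrow> dist (f s) l < \<epsilon>"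
      unfolding eventually_at_left_field by blast
    then show ?thesis using l that by blast
  next
    case False
    \<comment> \<open>At 0 there are no points of the half-line to the left, so the values chosen
      here are arbitrary.\<close>
    then show ?thesis using that[of "x - 1" 0] by auto
  qed
  show ?thesis
  proof (rule that[of "min (b - x) (x - a)" l])
    fix s assume "x \<le> s" "s < x + min (b - x) (x - a)"
    then show "\<bar>f s - f x\<bar> < \<epsilon>" using b(2)[of s] \<epsilon> by (cases "s = x") (auto simp: dist_real_def)
  qed (use a b(1) in \<open>auto simp: dist_real_def\<close>)
qed

text \<open>Real infima are meaningful only for sets bounded below, so this underlies
  \<open>running_inf\<close>. Local bounds from the one-sided limits are combined over a finite
  subcover.\<close>

lemma cadlag_bounded_below:
  assumes f: "cadlag_on_nonneg f"
  shows "\<exists>B. \<forall>s\<in>{0..t}. B \<le> f s"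
proof -
  define D where "D = (\<lambda>x \<delta>. 0 < \<delta> \<and> (\<exists>B. \<forall>s\<ge>0. \<bar>s - x\<bar> < \<delta> \<longrightarrow> B \<le> f s))"
  have "\<forall>x\<in>{0..t}. \<exists>\<delta>. D x \<delta>"
  proof
    fix x assume "x \<in> {0..t}"
    then have x: "0 \<le> x" by simp
    from cadlag_local_bounds[OF f x zero_less_one] obtain \<delta> l where
      d: "0 < \<delta>" "\<And>s. 0 \<le> s \<Longrightarrow> s < x \<Longrightarrow> x - \<delta> < s \<Longrightarrow> \<bar>f s - l\<bar> < 1"
         "\<And>s. x \<le> s \<Longrightarrow> s < x + \<delta> \<Longrightarrow> \<bar>f s - f x\<bar> < 1" by metis
    have "min (l - 1) (f x - 1) \<le> f s" if "0 \<le> s" "\<bar>s - x\<bar> < \<delta>" for s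
      using d(2)[of s] d(3)[of s] that by (cases "s < x") (auto simp: min_def abs_if split: if_splits)
    then have "D x \<delta>" using d(1) unfolding D_def by blast
    then show "\<exists>\<delta>. D x \<delta>" ..
  qed
  then obtain \<delta> where \<delta>: "\<And>x. x \<in> {0..t} \<Longrightarrow> D x (\<delta> x)" by metis
  have "compact {0..t}" by simp
  then obtain C where C: "C \<subseteq> {0..t}" "finite C" "{0..t} \<subseteq> (\<Union>x\<in>C. ball x (\<delta> x))"
    by (rule compactE_image[where C = "{0..t}" and f = "\<lambda>x. ball x (\<delta> x)"])
       (use \<delta> in \<open>auto simp: D_def intro!: bexI[of _ _ "{0..t}"]\<close>)
  have "\<forall>x\<in>C. \<exists>B. \<forall>s\<ge>0. \<bar>s - x\<bar> < \<delta> x \<longrightarrow> B \<le> f s" using \<delta> C(1) by (auto simp: D_def)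
  then obtain B where B: "\<And>x s. x \<in> C \<Longrightarrow> 0 \<le> s \<Longrightarrow> \<bar>s - x\<bar> < \<delta> x \<Longrightarrow> B x \<le> f s" by metis
  have "Min (insert 0 (B ` C)) \<le> f s" if s: "s \<in> {0..t}" for s
  proof -
    obtain x where x: "x \<in> C" "s \<in> ball x (\<delta> x)" using C(3) s by blast
    have "Min (insert 0 (B ` C)) \<le> B x" using C(2) x by (intro Min_le) auto
    also have "\<dots> \<le> f s" using B[of x s] x s by (auto simp: dist_real_def abs_minus_commute)
    finally show ?thesis .
  qed
  then show ?thesis by blast
qed

text \<open>Close to a point x the values are near the left limit before x and near f x from x on.
  Since f x is not above the left limit, passing x raises the function only slightly. A Lebesgue
  number of the cover makes this uniform.\<close>

lemma cadlag_no_jumps_modulus: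
  assumes f: "cadlag_on_nonneg f" and jumps: "\<And>t. 0 < t \<Longrightarrow> f t \<le> Lim (at_left t) f" and \<epsilon>: "0 < \<epsilon>"
  shows "\<exists>e>0. \<forall>s u. 0 \<le> s \<longrightarrow> s \<le> u \<longrightarrow> u \<le> t \<longrightarrow> u - s < e \<longrightarrow> f u - f s \<le> \<epsilon>"
proof -
  define D where "D = (\<lambda>x \<delta>. 0 < \<delta> \<and> (\<forall>s u. 0 \<le> s \<longrightarrow> s \<le> u \<longrightarrow> \<bar>s - x\<bar> < \<delta> \<longrightarrow> \<bar>u - x\<bar> < \<delta> \<longrightarrow> f u - f s \<le> \<epsilon>))"
  have "\<forall>x\<in>{0..t}. \<exists>\<delta>. D x \<delta>"
  proof
    fix x assume "x \<in> {0..t}"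
    then have x: "0 \<le> x" by simp
    have \<epsilon>2: "0 < \<epsilon> / 2" using \<epsilon> by simp
    from cadlag_local_bounds[OF f x \<epsilon>2] obtain \<delta> l where
      d: "0 < \<delta>" "\<And>s. 0 \<le> s \<Longrightarrow> s < x \<Longrightarrow> x - \<delta> < s \<Longrightarrow> \<bar>f s - l\<bar> < \<epsilon> / 2"
         "\<And>s. x \<le> s \<Longrightarrow> s < x + \<delta> \<Longrightarrow> \<bar>f s - f x\<bar> < \<epsilon> / 2"
         "0 < x \<Longrightarrow> (f \<longlongrightarrow> l) (at_left x)" by metis
    have l: "f x \<le> l" if "0 < x"
      using jumps[OF that] tendsto_Lim[OF _ d(4)[OF that]] by simp
    have "f u - f s \<le> \<epsilon>" if su: "0 \<le> s" "s \<le> u" "\<bar>s - x\<bar> < \<delta>" "\<bar>u - x\<bar> < \<delta>" for s u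
    proof (cases "x \<le> s")
      case True
      then show ?thesis using d(3)[of s] d(3)[of u] su by (auto simp: abs_if split: if_splits)
    next
      case False
      then have s: "\<bar>f s - l\<bar> < \<epsilon> / 2" using d(2)[of s] su by auto
      show ?thesis
      proof (cases "x \<le> u")
        case True
        then have "\<bar>f u - f x\<bar> < \<epsilon> / 2" using d(3)[of u] su by auto
        moreover have "f x \<le> l" using l False su by auto
        ultimately show ?thesis using s by linarith
      next
        case False
        then have "\<bar>f u - l\<bar> < \<epsilon> / 2" using d(2)[of u] su by auto
        then show ?thesis using s by linarith
      qed
    qed
    then have "D x \<delta>" using d(1) unfolding D_def by blast
    then show "\<exists>\<delta>. D x \<delta>" ..
  qed
  then obtain \<delta> where \<delta>: "\<And>x. x \<in> {0..t} \<Longrightarrow> D x (\<delta> x)" by metis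
  have "compact {0..t}" by simp
  then obtain e where e: "0 < e" "\<And>x. x \<in> {0..t} \<Longrightarrow> \<exists>G\<in>(\<lambda>x. ball x (\<delta> x)) ` {0..t}. ball x e \<subseteq> G"
    by (rule Heine_Borel_lemma[where \<G> = "(\<lambda>x. ball x (\<delta> x)) ` {0..t}"])
       (use \<delta> in \<open>auto simp: D_def\<close>)
  show ?thesis
  proof (intro exI[of _ e] conjI allI impI e(1))
    fix s u assume su: "0 \<le> s" "s \<le> u" "u \<le> t" "u - s < e"
    then obtain x where x: "x \<in> {0..t}" "ball s e \<subseteq> ball x (\<delta> x)" using e(2)[of s] by auto
    have "s \<in> ball x (\<delta> x)" "u \<in> ball x (\<delta> x)" using x(2) e(1) su by (auto simp: dist_real_def subset_eq)
    then show "f u - f s \<le> \<epsilon>"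
      using \<delta>[OF x(1)] su by (auto simp: D_def dist_real_def abs_minus_commute)
  qed
qed

lemma walk_snd_mono:
  "(\<And>i. x i \<le> y i) \<Longrightarrow> snd (walk x k m) \<le> snd (walk y k m)"
proof (induction m arbitrary: k)
  case (Suc m)
  have "x k + snd (walk x (Suc k) m) \<le> y k + snd (walk y (Suc k) m)"
    using Suc by (intro add_mono) auto
  then show ?case by (simp add: min.coboundedI2)
qed simp

subsection \<open>Spectrally negative Levy processes\<close>

context
  fixes P :: "'w measure" and X :: "real \<Rightarrow> 'w \<Rightarrow> real"
  assumes levy: "levy_process P X"
begin

interpretation P: prob_space P
  using levy by (simp add: levy_process_def)

lemma levy_measurable: "0 \<le> t \<Longrightarrow> X t \<in> borel_measurable P"
  using levy by (simp add: levy_process_def)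

lemma levy_start: "AE \<omega> in P. X 0 \<omega> = 0"
  using levy by (simp add: levy_process_def)

lemma levy_cadlag: "\<omega> \<in> space P \<Longrightarrow> cadlag_on_nonneg (\<lambda>t. X t \<omega>)"
  using levy by (simp add: levy_process_def)

definition increment :: "real \<Rightarrow> nat \<Rightarrow> 'w \<Rightarrow> real" where
  "increment h i \<omega> = X (real (Suc i) * h) \<omega> - X (real i * h) \<omega>"

lemma increment_measurable: "0 \<le> h \<Longrightarrow> increment h i \<in> borel_measurable P"
  unfolding increment_def by (intro borel_measurable_diff levy_measurable) auto

lemma indep_increments: "0 \<le> h \<Longrightarrow> P.indep_vars (\<lambda>_. borel) (increment h) {..<N}"
proof -
  assume h: "0 \<le> h"
  have "\<forall>n (t :: nat \<Rightarrow> real). 0 \<le> t 0 \<longrightarrow> (\<forall>i<n. t i \<le> t (Suc i)) \<longrightarrow>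
        P.indep_vars (\<lambda>_. borel) (\<lambda>i \<omega>. X (t (Suc i)) \<omega> - X (t i) \<omega>) {..<n}"
    using levy by (simp add: levy_process_def)
  from this[rule_format, of "\<lambda>i. real i * h" N] h show ?thesis
    unfolding increment_def by (simp add: mult_right_mono)
qed

lemma distr_levy_diff: "0 \<le> s \<Longrightarrow> s \<le> t \<Longrightarrow> distr P borel (\<lambda>\<omega>. X t \<omega> - X s \<omega>) = distr P borel (X (t - s))"
  using levy by (simp add: levy_process_def)

lemma distr_increment: "0 \<le> h \<Longrightarrow> distr P borel (increment h i) = distr P borel (X h)"
  using distr_levy_diff[of "real i * h" "real (Suc i) * h"]
  unfolding increment_def[abs_def] by (simp add: algebra_simps)

lemma prob_space_levy_law: "0 \<le> t \<Longrightarrow> prob_space (distr P borel (X t))"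
  by (intro P.prob_space_distr levy_measurable)

lemma walk_increment:
  "walk (\<lambda>i. increment h i \<omega>) 0 m
    = (X (real m * h) \<omega> - X 0 \<omega>, Min ((\<lambda>j. X (real j * h) \<omega> - X 0 \<omega>) ` {..m}))"
  using walk_increments[of "\<lambda>i. X (real i * h) \<omega>" 0 m] by (simp add: increment_def)

lemma distr_walk_increment:
  assumes "0 \<le> h"
  shows "distr P (borel \<Otimes>\<^sub>M borel) (\<lambda>\<omega>. walk (\<lambda>i. increment h i \<omega>) 0 m) = walk_law (distr P borel (X h)) m"
  using assms by (intro P.distr_walk[OF indep_increments[of h m]])
    (auto simp: distr_increment prob_space_levy_law)

lemma walk_measurable_comp:
  assumes "\<And>i. \<xi> i \<in> borel_measurable M"
  shows "(\<lambda>\<omega>. walk (\<lambda>i. \<xi> i \<omega>) k m) \<in> M \<rightarrow>\<^sub>M borel \<Otimes>\<^sub>M borel"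
proof (induction m arbitrary: k)
  case (Suc m)
  note [measurable] = Suc assms
  show ?case by simp
qed simp

lemma nn_integral_walk_increment:
  assumes "0 \<le> h" and f: "f \<in> borel_measurable (borel \<Otimes>\<^sub>M borel)"
  shows "(\<integral>\<^sup>+\<omega>. f (walk (\<lambda>i. increment h i \<omega>) 0 m) \<partial>P) = (\<integral>\<^sup>+p. f p \<partial>walk_law (distr P borel (X h)) m)"
proof -
  have [measurable]: "(\<lambda>\<omega>. walk (\<lambda>i. increment h i \<omega>) 0 m) \<in> P \<rightarrow>\<^sub>M borel \<Otimes>\<^sub>M borel"
    using assms(1) by (intro walk_measurable_comp increment_measurable)
  show ?thesis
    unfolding distr_walk_increment[OF assms(1), symmetric]
    by (rule nn_integral_distr[symmetric]) (simp_all add: f)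
qed

definition levy_mgf :: "real \<Rightarrow> real \<Rightarrow> ennreal" where
  "levy_mgf t s = (\<integral>\<^sup>+\<omega>. ennreal (exp (s * X t \<omega>)) \<partial>P)"

lemma step_mgf_levy: "0 \<le> t \<Longrightarrow> step_mgf (distr P borel (X t)) s = levy_mgf t s"
  by (subst step_mgf_def) (auto simp: levy_mgf_def nn_integral_distr prob_space_levy_law levy_measurable)

lemma levy_mgf_mult:
  assumes "0 \<le> h"
  shows "levy_mgf (real m * h) s = levy_mgf h s ^ m"
proof -
  have "levy_mgf (real m * h) s = (\<integral>\<^sup>+\<omega>. ennreal (exp (s * fst (walk (\<lambda>i. increment h i \<omega>) 0 m))) \<partial>P)"
    unfolding levy_mgf_def walk_increment using levy_start by (intro nn_integral_cong_AE) auto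
  also have "\<dots> = step_mgf (distr P borel (X h)) s ^ m"
    using walk_law_mgf[OF prob_space_levy_law[OF assms], where \<theta> = s and m = m] assms
    by (subst nn_integral_walk_increment) auto
  finally show ?thesis using assms by (simp add: step_mgf_levy)
qed

lemma levy_mgf_dyadic: "levy_mgf 1 s = levy_mgf (1 / 2 ^ n) s ^ (2 ^ n)"
  using levy_mgf_mult[of "1 / 2 ^ n" "2 ^ n" s] by simp

text \<open>Right continuity at 0 excludes excursions above 1 in arbitrarily short initial
  intervals, so these decreasing events have empty intersection. Restricting to dyadic times makes
  them countable unions, hence measurable.\<close>

lemma levy_start_small_excursions:
  assumes "0 < p"
  shows "\<exists>n. P.prob {\<omega> \<in> space P. \<exists>k j. real j / 2 ^ k \<le> 1 / 2 ^ n \<and> 1 < X (real j / 2 ^ k) \<omega> - X 0 \<omega>} \<le> p"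
proof -
  note [measurable] = levy_measurable increment_measurable
  define A where "A = (\<lambda>n. {\<omega> \<in> space P. \<exists>k j. real j / 2 ^ k \<le> 1 / 2 ^ n \<and> 1 < X (real j / 2 ^ k) \<omega> - X 0 \<omega>})"
  have [measurable]: "A n \<in> sets P" for n unfolding A_def by measurable
  have "decseq A"
    unfolding decseq_def A_def
  proof (intro allI impI subsetI, clarsimp)
    fix m n k j :: nat and \<omega> assume "m \<le> n" "real j / 2 ^ k \<le> 1 / 2 ^ n" "1 < X (real j / 2 ^ k) \<omega> - X 0 \<omega>"
    moreover have "1 / 2 ^ n \<le> (1 / 2 ^ m :: real)" using \<open>m \<le> n\<close> by (simp add: frac_le power_increasing)
    ultimately show "\<exists>k j. real j / 2 ^ k \<le> 1 / 2 ^ m \<and> 1 < X (real j / 2 ^ k) \<omega> - X 0 \<omega>"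
      by (meson order_trans)
  qed
  moreover have "(\<Inter>n. A n) = {}"
  proof (rule ccontr)
    assume "(\<Inter>n. A n) \<noteq> {}"
    then obtain \<omega> where \<omega>: "\<omega> \<in> A n" for n by blast
    then have "\<omega> \<in> space P" by (auto simp: A_def)
    then have "((\<lambda>t. X t \<omega>) \<longlongrightarrow> X 0 \<omega>) (at_right 0)"
      using levy_cadlag by (auto simp: cadlag_on_nonneg_def)
    from tendstoD[OF this zero_less_one] obtain b where b: "0 < b" "\<And>s. 0 < s \<Longrightarrow> s < b \<Longrightarrow> dist (X s \<omega>) (X 0 \<omega>) < 1"
      unfolding eventually_at_right_field by blast
    have "(\<lambda>n. 1 / 2 ^ n :: real) \<longlonglongrightarrow> 0" using LIMSEQ_divide_realpow_zero[of 2 1] by simp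
    from order_tendstoD(2)[OF this b(1)] obtain n where n: "1 / 2 ^ n < b" by (auto simp: eventually_sequentially)
    from \<omega>[of n] obtain k j where kj: "real j / 2 ^ k \<le> 1 / 2 ^ n" "1 < X (real j / 2 ^ k) \<omega> - X 0 \<omega>"
      by (auto simp: A_def)
    then have "j \<noteq> 0" by (auto intro: gr0I)
    then have "dist (X (real j / 2 ^ k) \<omega>) (X 0 \<omega>) < 1" using kj(1) n by (intro b(2)) auto
    then show False using kj(2) by (auto simp: dist_real_def)
  qed
  ultimately have "(\<lambda>n. P.prob (A n)) \<longlonglongrightarrow> 0"
    using P.finite_Lim_measure_decseq[of A] by (simp add: image_subset_iff)
  from order_tendstoD(2)[OF this assms] obtain n where "P.prob (A n) < p" by (auto simp: eventually_sequentially)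
  then show ?thesis unfolding A_def by (intro exI[of _ n]) auto
qed

text \<open>On a fine grid the positive parts of the increments are at most 1 along almost every path, so the
  walk with truncated increments, whose exponential moments are bounded uniformly in the mesh,
  eventually coincides with the original one.\<close>

lemma levy_mgf_finite:
  assumes jumps: "no_positive_jumps P X" and s: "0 \<le> s"
  shows "levy_mgf 1 s < \<infinity>"
proof -
  note [measurable] = levy_measurable increment_measurable
  \<comment> \<open>Chosen so that \<open>p * exp (s * (1 + 1))\<close> equals 1/2, as
    \<open>min_exp_moment\<close> requires for l = e = 1.\<close>
  define p where "p = exp (- (s * 2)) / 2"
  have p: "0 < p" by (simp add: p_def)
  obtain n where n: "P.prob {\<omega> \<in> space P. \<exists>k j. real j / 2 ^ k \<le> 1 / 2 ^ n \<and> 1 < X (real j / 2 ^ k) \<omega> - X 0 \<omega>} \<le> p"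
    using levy_start_small_excursions[OF p] by blast
  define A where "A = {\<omega> \<in> space P. \<exists>k j. real j / 2 ^ k \<le> 1 / 2 ^ n \<and> 1 < X (real j / 2 ^ k) \<omega> - X 0 \<omega>}"
  have [measurable]: "A \<in> sets P" unfolding A_def by measurable
  define t where "t = (1 / 2 ^ n :: real)"
  define h where "h = (\<lambda>k. 1 / 2 ^ (n + k) :: real)"
  have h: "0 < h k" "real (2 ^ k) * h k = t" for k by (simp_all add: h_def t_def power_add)
  \<comment> \<open>The sign is reversed so that upward excursions become descents of the minimum;
    truncation at 1 gives steps of at least -1.\<close>
  define x where "x = (\<lambda>k i \<omega>. - min (increment (h k) i \<omega>) 1)"
  have x_meas[measurable]: "x k i \<in> borel_measurable P" for k i
    using increment_measurable[OF less_imp_le[OF h(1)[of k]], of i] unfolding x_def by measurable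
  define \<nu> where "\<nu> = (\<lambda>k. distr P borel (\<lambda>\<omega>. - min (X (h k) \<omega>) 1))"
  have \<nu>: "prob_space (\<nu> k)" "sets (\<nu> k) = sets borel" for k
    unfolding \<nu>_def using h[of k] by (auto intro!: P.prob_space_distr)
  have x_law: "distr P borel (x k i) = \<nu> k" for k i
  proof -
    have "distr P borel (x k i) = distr (distr P borel (increment (h k) i)) borel (\<lambda>x. - min x 1)"
      unfolding x_def using h[of k] by (subst distr_distr) (auto simp: o_def)
    also have "\<dots> = \<nu> k"
      unfolding \<nu>_def using h[of k] by (subst distr_increment) (auto simp: distr_distr o_def)
    finally show ?thesis .
  qed
  have x_indep: "P.indep_vars (\<lambda>_. borel) (x k) {..<N}" for k N
    unfolding x_def
    by (rule P.indep_vars_compose2[OF indep_increments[OF less_imp_le[OF h(1)[of k]], of N],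
          where Y = "\<lambda>_ x. - min x 1" and N = "\<lambda>_. borel"]) simp
  define W where "W = (\<lambda>k m \<omega>. walk (\<lambda>i. x k i \<omega>) 0 m)"
  have W_meas[measurable]: "W k m \<in> P \<rightarrow>\<^sub>M borel \<Otimes>\<^sub>M borel" for k m
    unfolding W_def by (intro walk_measurable_comp x_meas)
  have W_law: "distr P (borel \<Otimes>\<^sub>M borel) (W k m) = walk_law (\<nu> k) m" for k m
    unfolding W_def by (intro P.distr_walk[OF x_indep[of k m] x_law \<nu>]) auto
  \<comment> \<open>Truncation only reduces upward motion, so a descent of the reversed walk below
    -1 forces X itself to rise by more than 1 at a dyadic time in [0, t].\<close>
  have tail: "min_tail (\<nu> k) m 1 \<le> ennreal p" if m: "m \<le> 2 ^ k" for k m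
  proof -
    have "min_tail (\<nu> k) m 1 = (\<integral>\<^sup>+\<omega>. indicator {p. snd p < - 1} (W k m \<omega>) \<partial>P)"
      unfolding min_tail_def[OF \<nu>] W_law[symmetric] by (subst nn_integral_distr) auto
    also have "\<dots> \<le> (\<integral>\<^sup>+\<omega>. indicator A \<omega> \<partial>P)"
    proof (rule nn_integral_mono)
      fix \<omega> assume \<omega>: "\<omega> \<in> space P"
      have "\<omega> \<in> A" if neg: "snd (W k m \<omega>) < - 1"
      proof -
        let ?a = "\<lambda>i. - X (real i * h k) \<omega>"
        have "snd (walk (\<lambda>i. ?a (Suc i) - ?a i) 0 m) \<le> snd (W k m \<omega>)"
          unfolding W_def by (rule walk_snd_mono) (auto simp: x_def increment_def)
        then have "Min ((\<lambda>j. ?a j - ?a 0) ` {..m}) < - 1"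
          using neg walk_increments[of ?a 0 m] by simp
        then obtain j where j: "j \<le> m" "?a j - ?a 0 < - 1" by (subst (asm) Min_less_iff) auto
        have "real j * h k \<le> real (2 ^ k) * h k" using j(1) m h(1)[of k] by (intro mult_right_mono) auto
        then have "real j / 2 ^ (n + k) \<le> 1 / 2 ^ n" unfolding h(2) by (simp add: h_def t_def)
        moreover have "1 < X (real j / 2 ^ (n + k)) \<omega> - X 0 \<omega>" using j(2) by (simp add: h_def)
        ultimately show ?thesis using \<omega> unfolding A_def by blast
      qed
      then show "(indicator {p. snd p < - 1} (W k m \<omega>) :: ennreal) \<le> indicator A \<omega>"
        by (auto simp: indicator_def)
    qed
    also have "\<dots> \<le> ennreal p" using n by (simp add: A_def[symmetric] P.emeasure_eq_measure ennreal_leI)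
    finally show ?thesis .
  qed
  have mom: "(\<integral>\<^sup>+\<omega>. ennreal (exp (- s * fst (W k (2 ^ k) \<omega>))) \<partial>P) \<le> ennreal (2 * exp s)" for k
  proof -
    have "(\<integral>\<^sup>+\<omega>. ennreal (exp (- s * fst (W k (2 ^ k) \<omega>))) \<partial>P)
        \<le> (\<integral>\<^sup>+\<omega>. ennreal (exp (- s * snd (W k (2 ^ k) \<omega>))) \<partial>P)"
      using s by (intro nn_integral_mono ennreal_leI) (auto simp: W_def intro!: mult_left_mono walk_snd_le_fst)
    also have "\<dots> = (\<integral>\<^sup>+q. ennreal (exp (- s * snd q)) \<partial>walk_law (\<nu> k) (2 ^ k))"
      unfolding W_law[symmetric] by (subst nn_integral_distr) auto
    also have "\<dots> \<le> ennreal (2 * exp (s * 1))"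
    proof (rule min_exp_moment[OF \<nu>])
      show "AE x in \<nu> k. - 1 \<le> x"
        unfolding \<nu>_def using h(1)[of k] by (subst AE_distr_iff) auto
      show "p * exp (s * (1 + 1)) \<le> 1 / 2" by (simp add: p_def mult_exp_exp)
    qed (use tail p s in auto)
    finally show ?thesis by simp
  qed
  have conv: "AE \<omega> in P. eventually (\<lambda>k. - fst (W k (2 ^ k) \<omega>) = X t \<omega>) sequentially"
    using jumps[unfolded no_positive_jumps_def] levy_start AE_space
  proof eventually_elim
    case (elim \<omega>)
    obtain e where e: "0 < e" "\<And>u v. 0 \<le> u \<Longrightarrow> u \<le> v \<Longrightarrow> v \<le> t \<Longrightarrow> v - u < e \<Longrightarrow> X v \<omega> - X u \<omega> \<le> 1"
      using cadlag_no_jumps_modulus[OF levy_cadlag[OF elim(3)], of 1 t] elim(1) by auto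
    have "h \<longlonglongrightarrow> 0"
      unfolding h_def using LIMSEQ_ignore_initial_segment[OF LIMSEQ_divide_realpow_zero[of 2 1], of n]
      by (simp add: add.commute)
    from order_tendstoD(2)[OF this e(1)] show ?case
    proof eventually_elim
      case (elim k)
      let ?a = "\<lambda>i. - X (real i * h k) \<omega>"
      have "W k (2 ^ k) \<omega> = walk (\<lambda>i. ?a (Suc i) - ?a i) 0 (2 ^ k)"
        unfolding W_def
      proof (rule walk_cong)
        fix i :: nat assume i: "i < 0 + 2 ^ k"
        have "real (Suc i) \<le> real (2 ^ k)" using i by (intro of_nat_mono) simp
        then have "real (Suc i) * h k \<le> real (2 ^ k) * h k" by (rule mult_right_mono) (use h(1)[of k] in simp)
        then have "real (Suc i) * h k \<le> t" unfolding h(2) .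
        moreover have "real (Suc i) * h k - real i * h k < e" using elim by (simp add: algebra_simps)
        ultimately have "increment (h k) i \<omega> \<le> 1"
          unfolding increment_def using h(1)[of k] by (intro e(2)) (auto intro: mult_right_mono)
        then show "x k i \<omega> = ?a (Suc i) - ?a i" by (simp add: x_def increment_def)
      qed
      then have "- fst (W k (2 ^ k) \<omega>) = X (real (2 ^ k) * h k) \<omega> - X 0 \<omega>"
        using walk_increments[of ?a 0 "2 ^ k"] by simp
      then show ?case using \<open>X 0 \<omega> = 0\<close> unfolding h(2) by simp
    qed
  qed
  \<comment> \<open>Fatou transfers the uniform bound, since on fine grids the truncated walk ends
    at X t up to sign. As t = 2^-n, time 1 then follows by a 2^n-th power.\<close>
  have "levy_mgf t s \<le> (\<integral>\<^sup>+\<omega>. liminf (\<lambda>k. ennreal (exp (- s * fst (W k (2 ^ k) \<omega>)))) \<partial>P)"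
    unfolding levy_mgf_def
  proof (rule nn_integral_mono_AE, use conv in eventually_elim)
    case (elim \<omega>)
    then have "\<forall>\<^sub>F k in sequentially. ennreal (exp (s * X t \<omega>)) \<le> ennreal (exp (- s * fst (W k (2 ^ k) \<omega>)))"
      by eventually_elim (metis minus_mult_commute order_refl)
    then show ?case by (rule Liminf_bounded)
  qed
  also have "\<dots> \<le> liminf (\<lambda>k. (\<integral>\<^sup>+\<omega>. ennreal (exp (- s * fst (W k (2 ^ k) \<omega>))) \<partial>P))"
    by (rule nn_integral_liminf) measurable
  also have "\<dots> \<le> ennreal (2 * exp s)"
    using mom by (intro order_trans[OF Liminf_le_Limsup Limsup_bounded]) auto
  finally have "levy_mgf t s < \<infinity>" by (metis ennreal_less_top infinity_ennreal_def order_le_less_trans)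
  then show ?thesis
    using levy_mgf_dyadic[of s n] by (simp add: t_def power_less_top_ennreal)
qed

end

text \<open>\<open>dyadic n t / 2 ^ n\<close> is the first point of the dyadic grid to the right of \<open>t \<ge> 0\<close>.\<close>

abbreviation dyadic :: "nat \<Rightarrow> real \<Rightarrow> nat" where
  "dyadic n t \<equiv> nat \<lfloor>t * 2 ^ n\<rfloor> + 1"

lemma dyadic_from_right:
  assumes "0 \<le> s"
  shows "filterlim (\<lambda>n. real (dyadic n s) / 2 ^ n) (at_right s) sequentially"
proof -
  have r: "real (dyadic n s) = of_int \<lfloor>s * 2 ^ n\<rfloor> + 1" for n
    using assms by simp
  have gt: "s < real (dyadic n s) / 2 ^ n" for n
    unfolding r by (simp add: pos_less_divide_eq)
  have le: "real (dyadic n s) / 2 ^ n \<le> s + 1 / 2 ^ n" for n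
  proof -
    have "of_int \<lfloor>s * 2 ^ n\<rfloor> + 1 \<le> (s + 1 / 2 ^ n) * 2 ^ n"
      by (simp add: distrib_right)
    then show ?thesis unfolding r by (simp add: pos_divide_le_eq)
  qed
  have "(\<lambda>n. s + 1 / 2 ^ n) \<longlonglongrightarrow> s + 0"
    by (intro tendsto_add tendsto_const) (use LIMSEQ_divide_realpow_zero[of 2 1] in simp)
  then have "(\<lambda>n. s + 1 / 2 ^ n) \<longlonglongrightarrow> s" by simp
  from tendsto_sandwich[OF _ _ tendsto_const this]
  have "(\<lambda>n. real (dyadic n s) / 2 ^ n) \<longlonglongrightarrow> s"
    using gt le by (simp add: less_imp_le)
  then show ?thesis
    using gt by (intro tendsto_imp_filterlim_at_right) auto
qed

section \<open>The cumulant of a Levy process with finite exponential moments: convexity, growth,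
  roots\<close>

context
  fixes P :: "'w measure" and X :: "real \<Rightarrow> 'w \<Rightarrow> real"
  assumes levy: "levy_process P X"
    and fin: "\<And>s. 0 \<le> s \<Longrightarrow> levy_mgf P X 1 s < \<infinity>"
begin

interpretation P: prob_space P
  using levy by (simp add: levy_process_def)

definition cumulant :: "real \<Rightarrow> real" where
  "cumulant s = ln (enn2real (levy_mgf P X 1 s))"

lemma levy_mgf_pos: "0 < levy_mgf P X 1 s"
proof -
  have [measurable]: "X 1 \<in> borel_measurable P" using levy_measurable[OF levy, of 1] by simp
  have "levy_mgf P X 1 s \<noteq> 0"
  proof
    assume "levy_mgf P X 1 s = 0"
    then have "AE \<omega> in P. ennreal (exp (s * X 1 \<omega>)) = 0"
      unfolding levy_mgf_def[OF levy] by (subst (asm) nn_integral_0_iff_AE) measurable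
    then have "AE \<omega> in P. False" by eventually_elim simp
    then show False by simp
  qed
  then show ?thesis by (rule zero_less_iff_neq_zero[THEN iffD2])
qed

lemma levy_mgf_eq:
  assumes "0 \<le> s" shows "levy_mgf P X 1 s = ennreal (exp (cumulant s))"
proof -
  have "levy_mgf P X 1 s < top" using fin[OF assms] by simp
  then have "0 < enn2real (levy_mgf P X 1 s)" "ennreal (enn2real (levy_mgf P X 1 s)) = levy_mgf P X 1 s"
    using levy_mgf_pos[of s] by (simp_all add: enn2real_positive_iff)
  then show ?thesis by (simp add: cumulant_def)
qed

lemma levy_exponent_eq:
  assumes "0 \<le> s" shows "levy_exponent P X s = ereal (cumulant s)"
proof -
  have "levy_mgf P X 1 s \<noteq> \<infinity>" using fin[OF assms] by simp
  then show ?thesis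
    unfolding levy_exponent_def cumulant_def levy_mgf_def[OF levy, symmetric] Let_def by simp
qed

lemma cumulant_0 [simp]: "cumulant 0 = 0"
  unfolding cumulant_def levy_mgf_def[OF levy] by (simp add: P.emeasure_space_1)

text \<open>Write \<kappa> for \<open>cumulant\<close>. Convexity of exp is applied to the
  normalised exponents ax - \<kappa>(a) and bx - \<kappa>(b), whose exponentials have mean 1 at x =
  X 1. Hence the exponential of their convex combination has mean at most 1, and removing the
  constant \<open>d\<close> gives the claim.\<close>

lemma cumulant_convex: "convex_on {0..} cumulant"
proof (rule convex_onI)
  fix t a b :: real assume t: "0 < t" "t < 1" and ab: "a \<in> {0..}" "b \<in> {0..}"
  have [measurable]: "X 1 \<in> borel_measurable P" using levy_measurable[OF levy, of 1] by simp
  define c where "c = (1 - t) * a + t * b"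
  define d where "d = (1 - t) * cumulant a + t * cumulant b"
  have c: "0 \<le> c" using t ab by (simp add: c_def)
  have pt: "ennreal (exp (c * x)) \<le> ennreal (exp d) * (ennreal ((1 - t) * exp (- cumulant a)) * ennreal (exp (a * x))
      + ennreal (t * exp (- cumulant b)) * ennreal (exp (b * x)))" for x
  proof -
    have "exp ((1 - t) *\<^sub>R (a * x - cumulant a) + t *\<^sub>R (b * x - cumulant b))
        \<le> (1 - t) * exp (a * x - cumulant a) + t * exp (b * x - cumulant b)"
      using t by (intro convex_onD[OF exp_convex]) auto
    also have "(1 - t) *\<^sub>R (a * x - cumulant a) + t *\<^sub>R (b * x - cumulant b) = c * x - d"
      by (simp add: c_def d_def algebra_simps)
    finally have "exp d * exp (c * x - d) \<le> exp d * ((1 - t) * exp (a * x - cumulant a) + t * exp (b * x - cumulant b))"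
      by (intro mult_left_mono) auto
    moreover have "exp d * exp (c * x - d) = exp (c * x)" by (simp add: mult_exp_exp)
    moreover have "exp (a * x - cumulant a) = exp (- cumulant a) * exp (a * x)"
      "exp (b * x - cumulant b) = exp (- cumulant b) * exp (b * x)" by (simp_all add: mult_exp_exp)
    ultimately have "exp (c * x) \<le> exp d * ((1 - t) * exp (- cumulant a) * exp (a * x) + t * exp (- cumulant b) * exp (b * x))"
      by (simp only: mult.assoc)
    then show ?thesis
      using t by (simp add: ennreal_mult[symmetric] ennreal_plus[symmetric] ennreal_leI del: ennreal_plus)
  qed
  have "levy_mgf P X 1 c \<le> (\<integral>\<^sup>+\<omega>. ennreal (exp d) * (ennreal ((1 - t) * exp (- cumulant a)) * ennreal (exp (a * X 1 \<omega>))
      + ennreal (t * exp (- cumulant b)) * ennreal (exp (b * X 1 \<omega>))) \<partial>P)"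
    unfolding levy_mgf_def[OF levy] by (intro nn_integral_mono pt)
  also have "\<dots> = ennreal (exp d) * (ennreal ((1 - t) * exp (- cumulant a)) * levy_mgf P X 1 a
      + ennreal (t * exp (- cumulant b)) * levy_mgf P X 1 b)"
    unfolding levy_mgf_def[OF levy] by (simp add: nn_integral_cmult nn_integral_add)
  also have "\<dots> = ennreal (exp d * ((1 - t) * exp (- cumulant a) * exp (cumulant a) + t * exp (- cumulant b) * exp (cumulant b)))"
    using t ab by (simp add: levy_mgf_eq ennreal_mult[symmetric] ennreal_plus[symmetric] del: ennreal_plus)
  also have "(1 - t) * exp (- cumulant a) * exp (cumulant a) + t * exp (- cumulant b) * exp (cumulant b) = 1"
    by (simp add: mult.assoc mult_exp_exp)
  finally have "exp (cumulant c) \<le> exp d" using c by (simp add: levy_mgf_eq)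
  then show "cumulant ((1 - t) *\<^sub>R a + t *\<^sub>R b) \<le> (1 - t) * cumulant a + t * cumulant b"
    by (simp add: c_def d_def)
qed simp

lemma levy_process_uminus: "levy_process P (\<lambda>t \<omega>. - X t \<omega>)"
  unfolding levy_process_def
proof (intro conjI allI impI ballI)
  show "(\<lambda>\<omega>. - X t \<omega>) \<in> borel_measurable P" if "0 \<le> t" for t
    using levy_measurable[OF levy that] by measurable
  show "AE \<omega> in P. - X 0 \<omega> = 0" using levy_start[OF levy] by simp
  show "cadlag_on_nonneg (\<lambda>t. - X t \<omega>)" if "\<omega> \<in> space P" for \<omega>
    using levy_cadlag[OF levy that] unfolding cadlag_on_nonneg_def
    by (auto intro: tendsto_minus) (metis tendsto_minus)
  show "P.indep_vars (\<lambda>_. borel) (\<lambda>i \<omega>. - X (t (Suc i)) \<omega> - - X (t i) \<omega>) {..<n}"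
    if t: "0 \<le> t 0" "\<forall>i<n. t i \<le> t (Suc i)" for n and t :: "nat \<Rightarrow> real"
  proof -
    have "P.indep_vars (\<lambda>_. borel) (\<lambda>i \<omega>. X (t (Suc i)) \<omega> - X (t i) \<omega>) {..<n}"
      using levy t by (simp add: levy_process_def)
    from P.indep_vars_compose2[OF this, where Y = "\<lambda>_ x. - x" and N = "\<lambda>_. borel"]
    show ?thesis by (simp add: algebra_simps)
  qed
  show "distr P borel (\<lambda>\<omega>. - X t \<omega> - - X s \<omega>) = distr P borel (\<lambda>\<omega>. - X (t - s) \<omega>)" if st: "0 \<le> s" "s \<le> t" for s t
  proof -
    have [measurable]: "X s \<in> borel_measurable P" "X t \<in> borel_measurable P" "X (t - s) \<in> borel_measurable P"
      using levy_measurable[OF levy] st by auto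
    have "distr P borel (\<lambda>\<omega>. - X t \<omega> - - X s \<omega>) = distr (distr P borel (\<lambda>\<omega>. X t \<omega> - X s \<omega>)) borel uminus"
      by (subst distr_distr) (auto simp: o_def)
    also have "\<dots> = distr P borel (\<lambda>\<omega>. - X (t - s) \<omega>)"
      unfolding distr_levy_diff[OF levy st] by (subst distr_distr) (auto simp: o_def)
    finally show ?thesis .
  qed
qed (simp add: P.prob_space_axioms)

text \<open>Stationarity extends the sign to all dyadic increments, so almost every path decreases
  along each grid; approximating s and t from the right by grid points extends this to all
  times.\<close>

lemma nonpos_imp_subordinator:
  assumes nonpos: "\<And>n. AE \<omega> in P. X (1 / 2 ^ n) \<omega> \<le> 0"
  shows "subordinator P (\<lambda>t \<omega>. - X t \<omega>)"
  unfolding subordinator_def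
proof (intro conjI levy_process_uminus)
  have "AE \<omega> in P. increment X (1 / 2 ^ n) i \<omega> \<le> 0" for n i
  proof -
    have [measurable]: "X (1 / 2 ^ n) \<in> borel_measurable P" "increment X (1 / 2 ^ n) i \<in> borel_measurable P"
      using levy_measurable[OF levy] increment_measurable[OF levy] by auto
    have "AE x in distr P borel (X (1 / 2 ^ n)). x \<le> 0"
      using nonpos[of n] by (subst AE_distr_iff) auto
    moreover have "distr P borel (increment X (1 / 2 ^ n) i) = distr P borel (X (1 / 2 ^ n))"
      by (rule distr_increment[OF levy]) simp
    ultimately have "AE x in distr P borel (increment X (1 / 2 ^ n) i). x \<le> 0" by metis
    then show ?thesis by (subst (asm) AE_distr_iff) auto
  qed
  then have "AE \<omega> in P. \<forall>n i. increment X (1 / 2 ^ n) i \<omega> \<le> 0" by (simp add: AE_all_countable)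
  then show "AE \<omega> in P. \<forall>s t. 0 \<le> s \<longrightarrow> s \<le> t \<longrightarrow> - X s \<omega> \<le> - X t \<omega>"
    using AE_space
  proof eventually_elim
    case (elim \<omega>)
    have dy: "X (real j / 2 ^ n) \<omega> \<le> X (real i / 2 ^ n) \<omega>" if "i \<le> j" for i j n
      using lift_Suc_antimono_le[of "\<lambda>i. X (real i / 2 ^ n) \<omega>", OF _ that] elim(1)
      by (simp add: increment_def[OF levy] divide_inverse)
    show ?case
    proof (intro allI impI)
      fix s t :: real assume st: "0 \<le> s" "s \<le> t"
      let ?a = "\<lambda>r n. real (dyadic n r) / 2 ^ n"
      have lim: "(\<lambda>n. X (?a r n) \<omega>) \<longlonglongrightarrow> X r \<omega>" if "0 \<le> r" for r
        using levy_cadlag[OF levy elim(2)] dyadic_from_right[OF that] that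
        unfolding cadlag_on_nonneg_def by (auto intro: filterlim_compose)
      have "X t \<omega> \<le> X s \<omega>"
      proof (rule tendsto_le[OF _ lim lim])
        show "\<forall>\<^sub>F n in sequentially. X (?a t n) \<omega> \<le> X (?a s n) \<omega>"
          using st by (intro always_eventually allI dy) (auto intro!: nat_mono floor_mono mult_right_mono)
      qed (use st in auto)
      then show "- X s \<omega> \<le> - X t \<omega>" by simp
    qed
  qed
qed

text \<open>If the cumulant stayed below \<open>c\<close>, the moments of X at time 2^-n would be
  bounded in s as well, and Markov's inequality for s tending to infinity would leave no mass on
  positive values. Then -X would be a subordinator.\<close>

lemma cumulant_unbounded:
  assumes not_sub: "\<not> subordinator P (\<lambda>t \<omega>. - X t \<omega>)"
  shows "\<exists>s\<ge>0. c < cumulant s"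
proof (rule ccontr)
  assume "\<not> (\<exists>s\<ge>0. c < cumulant s)"
  then have le: "cumulant s \<le> c" if "0 \<le> s" for s using that by force
  have c0: "0 \<le> c" using le[of 0] by simp
  have "AE \<omega> in P. X (1 / 2 ^ n) \<omega> \<le> 0" for n
  proof -
    define h where "h = (1 / 2 ^ n :: real)"
    have [measurable]: "X h \<in> borel_measurable P" using levy_measurable[OF levy, of h] by (simp add: h_def)
    \<comment> \<open>A value above exp c \<ge> 1 does not shrink under the 2^n-th power, which
      would contradict the bound at time 1.\<close>
    have bd: "levy_mgf P X h s \<le> ennreal (exp c)" if "0 \<le> s" for s
    proof (rule ccontr)
      assume "\<not> levy_mgf P X h s \<le> ennreal (exp c)"
      then have gt: "ennreal (exp c) < levy_mgf P X h s" by simp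
      have one: "1 \<le> ennreal (exp c)" using c0 by (simp flip: ennreal_1)
      have "levy_mgf P X h s ^ 1 \<le> levy_mgf P X h s ^ (2 ^ n)"
        using order_trans[OF one less_imp_le[OF gt]] by (intro power_increasing) simp_all
      also have "\<dots> = levy_mgf P X 1 s" using levy_mgf_dyadic[OF levy, of s n] by (simp add: h_def)
      also have "\<dots> \<le> ennreal (exp c)" using le[OF that] that by (simp add: levy_mgf_eq)
      finally show False using gt by simp
    qed
    have "AE \<omega> in P. X h \<omega> < 1 / real (Suc k)" for k
    proof -
      let ?e = "1 / real (Suc k)"
      let ?A = "{\<omega> \<in> space P. ?e \<le> X h \<omega>}"
      have "P.prob ?A \<le> exp (c - s * ?e)" if s: "0 \<le> s" for s
      proof -
        have "emeasure P ?A * ennreal (exp (s * ?e)) = (\<integral>\<^sup>+\<omega>. ennreal (exp (s * ?e)) * indicator ?A \<omega> \<partial>P)"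
          by (subst nn_integral_cmult_indicator) (auto simp: mult.commute)
        also have "\<dots> \<le> levy_mgf P X h s"
          unfolding levy_mgf_def[OF levy]
        proof (rule nn_integral_mono)
          fix \<omega> show "ennreal (exp (s * ?e)) * indicator ?A \<omega> \<le> ennreal (exp (s * X h \<omega>))"
            using s mult_left_mono[of ?e "X h \<omega>" s] by (auto simp: indicator_def intro!: ennreal_leI)
        qed
        also have "\<dots> \<le> ennreal (exp c)" by (rule bd[OF s])
        finally have "P.prob ?A * exp (s * ?e) \<le> exp c"
          by (simp add: P.emeasure_eq_measure ennreal_mult[symmetric])
        then show ?thesis by (simp add: exp_diff pos_le_divide_eq)
      qed
      note bound = this
      have "((\<lambda>s. exp (c - s * ?e)) \<longlongrightarrow> 0) at_top" by real_asymp
      then have "P.prob ?A \<le> 0"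
        by (rule tendsto_lowerbound) (use bound in \<open>auto intro!: eventually_at_top_linorderI[of 0]\<close>)
      then have "AE \<omega> in P. \<omega> \<notin> ?A"
        by (intro AE_not_in) (simp add: P.emeasure_eq_measure null_sets_def measure_le_0_iff)
      then show ?thesis using AE_space by eventually_elim auto
    qed
    then have "AE \<omega> in P. \<forall>k. X h \<omega> < 1 / real (Suc k)" by (simp add: AE_all_countable)
    then show ?thesis unfolding h_def[symmetric]
    proof eventually_elim
      case (elim \<omega>)
      show ?case
      proof (rule ccontr)
        assume "\<not> X h \<omega> \<le> 0"
        then obtain k where "1 / real (Suc k) < X h \<omega>" using reals_Archimedean[of "X h \<omega>"] by (auto simp: inverse_eq_divide)
        with elim[rule_format, of k] show False by simp
      qed
    qed
  qed
  then show False using nonpos_imp_subordinator not_sub by blast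
qed

text \<open>A value below q at \<open>s0\<close> and unboundedness give a root r beyond
  \<open>s0\<close> by continuity. If there were a larger root y, then r would lie strictly between
  \<open>s0\<close> and y, and convexity would push the cumulant at r below q. The lemma serves q =
  0, with a point where the cumulant is negative, as well as q = a + \<lambda>.\<close>

lemma largest_root_above:
  assumes not_sub: "\<not> subordinator P (\<lambda>t \<omega>. - X t \<omega>)"
    and s0: "0 < s0" "cumulant s0 < q" and q: "0 \<le> q"
  shows "s0 < largest_root P X q" "cumulant (largest_root P X q) = q"
proof -
  obtain s1 where s1: "0 \<le> s1" "q < cumulant s1" using cumulant_unbounded[OF not_sub] by blast
  have conv: "cumulant ((1 - t) * a + t * b) \<le> (1 - t) * cumulant a + t * cumulant b"
    if "0 \<le> t" "t \<le> 1" "0 \<le> a" "0 \<le> b" for t a b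
    using convex_onD[OF cumulant_convex that(1,2)] that by simp
  \<comment> \<open>On [0, s0] the chord from 0 keeps the cumulant at most q; here q \<ge> 0
    enters.\<close>
  have "s0 < s1"
  proof (rule ccontr)
    assume "\<not> s0 < s1"
    then have t: "0 \<le> s1 / s0" "s1 / s0 \<le> 1" using s0 s1 by auto
    have "cumulant s1 \<le> (s1 / s0) * cumulant s0" using conv[OF t, of 0 s0] s0 by simp
    also have "\<dots> \<le> (s1 / s0) * q" using t s0 by (intro mult_left_mono) auto
    also have "\<dots> \<le> 1 * q" using t q by (intro mult_right_mono) auto
    finally show False using s1 by linarith
  qed
  have "convex_on {0<..} cumulant" by (rule convex_on_subset[OF cumulant_convex]) auto
  then have "continuous_on {0<..} cumulant" by (intro convex_on_continuous) auto
  then have "continuous_on {s0..s1} cumulant" by (rule continuous_on_subset) (use s0 in auto)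
  from IVT'[OF _ _ _ this, of q] obtain r where r: "s0 \<le> r" "r \<le> s1" "cumulant r = q"
    using s0 s1 \<open>s0 < s1\<close> by auto
  have "s0 < r" using r s0 by (metis less_eq_real_def less_irrefl)
  have "largest_root P X q = r"
    unfolding largest_root_def
  proof (rule Greatest_equality)
    show "levy_exponent P X r = ereal q" using r \<open>s0 < r\<close> s0 by (simp add: levy_exponent_eq)
    fix y assume y: "levy_exponent P X y = ereal q"
    show "y \<le> r"
    proof (rule ccontr)
      assume "\<not> y \<le> r"
      then have yr: "r < y" by simp
      have cy: "cumulant y = q" using y yr \<open>s0 < r\<close> s0 by (simp add: levy_exponent_eq)
      define t where "t = (r - s0) / (y - s0)"
      have t: "0 \<le> t" "t < 1" using \<open>s0 < r\<close> yr by (auto simp: t_def)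
      have "(1 - t) * s0 + t * y = s0 + t * (y - s0)" by (simp add: algebra_simps)
      also have "\<dots> = r" using \<open>s0 < r\<close> yr by (simp add: t_def)
      finally have "q \<le> (1 - t) * cumulant s0 + t * q"
        using conv[of t s0 y] t s0 yr \<open>s0 < r\<close> cy r by simp
      also have "\<dots> < (1 - t) * q + t * q" using t s0 by (intro add_strict_right_mono mult_strict_left_mono) auto
      finally show False by (simp add: algebra_simps)
    qed
  qed
  then show "s0 < largest_root P X q" "cumulant (largest_root P X q) = q" using r \<open>s0 < r\<close> by auto
qed

text \<open>The chord from 0 to 1 bounds the cumulant by s times its value at 1; the summand 1 in
  \<open>d\<close> keeps the quotient defined.\<close>

lemma cumulant_small:
  assumes "0 < q" obtains s where "0 < s" "cumulant s < q"
proof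
  define d where "d = \<bar>cumulant 1\<bar> + 1"
  define s where "s = min 1 (q / (2 * d))"
  have d: "0 < d" by (simp add: d_def add_nonneg_pos)
  have s: "0 < s" "s \<le> 1" "s \<le> q / (2 * d)" using assms d by (auto simp: s_def)
  show "0 < s" by fact
  have "cumulant s \<le> s * cumulant 1"
    using convex_onD[OF cumulant_convex, of s 0 1] s by simp
  also have "\<dots> \<le> s * d" using s by (intro mult_left_mono) (auto simp: d_def)
  also have "\<dots> \<le> q / (2 * d) * d" using s d by (intro mult_right_mono) auto
  also have "\<dots> < q" using d assms by simp
  finally show "cumulant s < q" .
qed

lemma cumulant_slope_mono:
  assumes "0 < s" "s \<le> t" shows "cumulant s / s \<le> cumulant t / t"
proof -
  have "cumulant s \<le> (s / t) * cumulant t"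
    using convex_onD[OF cumulant_convex, of "s / t" 0 t] assms by simp
  then show ?thesis using assms by (simp add: field_simps)
qed

text \<open>By convexity the slopes from 0 increase in s, so their limit at 0 is their infimum. The
  sign of the derivative thus becomes a statement about single points of the half-line: no negative
  value of the cumulant, or a negative value somewhere.\<close>

lemma levy_exponent_deriv0_eq:
  "levy_exponent_deriv0 P X = (INF s\<in>{0<..}. ereal (cumulant s / s))"
proof -
  let ?I = "INF s\<in>{0<..}. ereal (cumulant s / s)"
  let ?f = "\<lambda>s. (levy_exponent P X s - levy_exponent P X 0) / ereal s"
  have f: "?f s = ereal (cumulant s / s)" if "0 < s" for s
    using that by (simp add: levy_exponent_eq)
  have "(?f \<longlongrightarrow> ?I) (at_right 0)"
  proof (rule order_tendstoI)
    fix a assume a: "a < ?I"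
    have "a < ?f s" if "0 < s" for s
      using a INF_lower[of s "{0<..}" "\<lambda>s. ereal (cumulant s / s)"] that f[OF that] by (auto intro: less_le_trans)
    then show "\<forall>\<^sub>F s in at_right 0. a < ?f s"
      by (auto simp: eventually_at_right_field intro!: exI[of _ 1])
  next
    fix a assume "?I < a"
    then obtain s0 where s0: "0 < s0" "ereal (cumulant s0 / s0) < a" by (auto simp: INF_less_iff)
    have "?f s < a" if "0 < s" "s < s0" for s
      unfolding f[OF that(1)] using cumulant_slope_mono[of s s0] that s0(2)
      by (metis ereal_less_eq(3) less_imp_le order_le_less_trans)
    then show "\<forall>\<^sub>F s in at_right 0. ?f s < a"
      using s0(1) by (auto simp: eventually_at_right_field)
  qed
  then show ?thesis
    unfolding levy_exponent_deriv0_def by (intro tendsto_Lim) auto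
qed

lemma levy_exponent_deriv0_nonneg:
  assumes "0 \<le> levy_exponent_deriv0 P X" "0 \<le> s" shows "0 \<le> cumulant s"
proof (cases "s = 0")
  case False
  then have "0 < s" using assms by simp
  then have "(INF s\<in>{0<..}. ereal (cumulant s / s)) \<le> ereal (cumulant s / s)"
    by (intro INF_lower) simp
  with assms(1) have "0 \<le> ereal (cumulant s / s)"
    unfolding levy_exponent_deriv0_eq by (rule order_trans)
  then show ?thesis using False assms by (simp add: zero_le_divide_iff)
qed simp

lemma levy_exponent_deriv0_neg:
  assumes "levy_exponent_deriv0 P X < 0" obtains s where "0 < s" "cumulant s < 0"
proof -
  from assms obtain s where "0 < s" "ereal (cumulant s / s) < 0"
    unfolding levy_exponent_deriv0_eq by (auto simp: INF_less_iff)
  then show ?thesis by (intro that[of s]) (auto simp: divide_less_0_iff)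
qed

end

subsection \<open>The running infimum at an exponential time\<close>

definition grid_inf :: "(real \<Rightarrow> 'w \<Rightarrow> real) \<Rightarrow> nat \<Rightarrow> nat \<Rightarrow> 'w \<Rightarrow> real" where
  "grid_inf X n m \<omega> = Min ((\<lambda>j. min (X (real j / 2 ^ n) \<omega>) 0) ` {..m})"

lemma grid_inf_le: "j \<le> m \<Longrightarrow> grid_inf X n m \<omega> \<le> min (X (real j / 2 ^ n) \<omega>) 0"
  unfolding grid_inf_def by (intro Min_le finite_imageI finite_atMost image_eqI[of _ _ j]) auto

lemma grid_inf_nonpos: "grid_inf X n m \<omega> \<le> 0"
  using grid_inf_le[of 0 m X n \<omega>] by linarith

lemma grid_inf_measurable:
  assumes "\<And>j. j \<le> m \<Longrightarrow> X (real j / 2 ^ n) \<in> borel_measurable M"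
  shows "grid_inf X n m \<in> borel_measurable M"
proof -
  have "(\<lambda>\<omega>. Min ((\<lambda>j. min (X (real j / 2 ^ n) \<omega>) 0) ` {..m})) \<in> borel_measurable M"
    using assms by (intro borel_measurable_Min borel_measurable_min) auto
  then show ?thesis by (simp add: grid_inf_def[abs_def])
qed

lemma running_inf_lower:
  assumes "cadlag_on_nonneg (\<lambda>t. X t \<omega>)" "s \<in> {0..t}"
  shows "running_inf X t \<omega> \<le> min (X s \<omega>) 0"
proof -
  obtain B where B: "\<And>s. s \<in> {0..t} \<Longrightarrow> B \<le> X s \<omega>" using cadlag_bounded_below[OF assms(1), of t] by blast
  have "bdd_below ((\<lambda>s. min (X s \<omega>) 0) ` {0..t})"
    by (rule bdd_belowI[of _ "min B 0"]) (use B in \<open>fastforce simp: min_def\<close>)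
  then show ?thesis unfolding running_inf_def by (rule cINF_lower[OF _ assms(2)])
qed

text \<open>From below: all grid points but the last lie in [0, t], and right continuity at t
  handles the last one, just beyond t. From above: a near-minimiser s is approximated from the right
  by grid points, which never exceed the last one used for t.\<close>

lemma grid_inf_tendsto:
  assumes cad: "cadlag_on_nonneg (\<lambda>t. X t \<omega>)" and t: "0 \<le> t"
  shows "(\<lambda>n. grid_inf X n (dyadic n t) \<omega>) \<longlonglongrightarrow> running_inf X t \<omega>"
proof -
  let ?d = "\<lambda>r n. real (dyadic n r) / 2 ^ n"
  have lim: "(\<lambda>n. min (X (?d r n) \<omega>) 0) \<longlonglongrightarrow> min (X r \<omega>) 0" if "0 \<le> r" for r
  proof -
    have "((\<lambda>t. X t \<omega>) \<longlongrightarrow> X r \<omega>) (at_right r)" using cad that by (simp add: cadlag_on_nonneg_def)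
    from filterlim_compose[OF this dyadic_from_right[OF that]]
    show ?thesis by (intro tendsto_min tendsto_const)
  qed
  show ?thesis
  proof (rule order_tendstoI)
    fix a assume a: "a < running_inf X t \<omega>"
    have "a < min (X t \<omega>) 0" using running_inf_lower[where X = X, OF cad, of t t] t a by auto
    from order_tendstoD(1)[OF lim[OF t] this]
    show "\<forall>\<^sub>F n in sequentially. a < grid_inf X n (dyadic n t) \<omega>"
    proof eventually_elim
      case (elim n)
      have "a < min (X (real j / 2 ^ n) \<omega>) 0" if "j \<le> dyadic n t" for j
      proof (cases "j = dyadic n t")
        case False
        then have "j \<le> nat \<lfloor>t * 2 ^ n\<rfloor>" using that by simp
        then have "real j \<le> t * 2 ^ n" using t by (simp add: le_nat_floor le_floor_iff le_nat_iff)
        then have "real j / 2 ^ n \<in> {0..t}" by (simp add: pos_divide_le_eq)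
        from running_inf_lower[where X = X, OF cad this] show ?thesis using a by simp
      qed (use elim in simp)
      then show ?case unfolding grid_inf_def by (subst Min_gr_iff) auto
    qed
  next
    fix a assume "running_inf X t \<omega> < a"
    then obtain s where s: "s \<in> {0..t}" "min (X s \<omega>) 0 < a"
    proof (atomize_elim, unfold running_inf_def)
      assume less: "(INF s\<in>{0..t}. min (X s \<omega>) 0) < a"
      show "\<exists>s. s \<in> {0..t} \<and> min (X s \<omega>) 0 < a"
      proof (rule ccontr)
        assume "\<not> (\<exists>s. s \<in> {0..t} \<and> min (X s \<omega>) 0 < a)"
        then have "a \<le> (INF s\<in>{0..t}. min (X s \<omega>) 0)" using t by (intro cINF_greatest) (auto simp: not_less)
        then show False using less by simp
      qed
    qed
    then have "0 \<le> s" by simp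
    from order_tendstoD(2)[OF lim[OF this] s(2)]
    show "\<forall>\<^sub>F n in sequentially. grid_inf X n (dyadic n t) \<omega> < a"
    proof eventually_elim
      case (elim n)
      have "dyadic n s \<le> dyadic n t"
        using s(1) by (auto intro!: nat_mono floor_mono mult_right_mono)
      then have "grid_inf X n (dyadic n t) \<omega> \<le> min (X (?d s n) \<omega>) 0"
        by (rule grid_inf_le)
      then show ?case using elim by linarith
    qed
  qed
qed

lemma nat_floor_measurable:
  "(\<lambda>z :: 'w \<times> real. dyadic n (snd z)) \<in> M \<Otimes>\<^sub>M borel \<rightarrow>\<^sub>M count_space UNIV"
  by measurable

lemma grid_inf_joint_measurable:
  assumes "\<And>t. 0 \<le> t \<Longrightarrow> X t \<in> borel_measurable M"
  shows "(\<lambda>z. grid_inf X n (dyadic n (snd z)) (fst z)) \<in> borel_measurable (M \<Otimes>\<^sub>M (borel :: real measure))"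
proof (rule measurable_compose_countable[OF _ nat_floor_measurable])
  fix m
  have [measurable]: "grid_inf X n m \<in> borel_measurable M" using assms by (intro grid_inf_measurable) simp
  show "(\<lambda>z. grid_inf X n m (fst z)) \<in> borel_measurable (M \<Otimes>\<^sub>M borel)" by measurable
qed

lemma running_inf_joint_measurable:
  assumes meas: "\<And>t. 0 \<le> t \<Longrightarrow> X t \<in> borel_measurable M"
    and cad: "\<And>\<omega>. \<omega> \<in> space M \<Longrightarrow> cadlag_on_nonneg (\<lambda>t. X t \<omega>)"
  shows "(\<lambda>(\<omega>, t). running_inf X t \<omega>) \<in> borel_measurable (M \<Otimes>\<^sub>M borel)"
proof -
  note [measurable] = grid_inf_joint_measurable[where X = X and M = M, OF meas]
  have "(\<lambda>z. running_inf X (snd z) (fst z)) \<in> borel_measurable (M \<Otimes>\<^sub>M (borel :: real measure))"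
  proof (rule borel_measurable_LIMSEQ_real)
    \<comment> \<open>For negative t the running infimum ranges over the empty set and is the
      constant \<open>Inf {}\<close>.\<close>
    show "(\<lambda>z. if snd z < 0 then Inf {} else grid_inf X n (dyadic n (snd z)) (fst z))
        \<in> borel_measurable (M \<Otimes>\<^sub>M (borel :: real measure))" for n
      by measurable
    fix z assume z: "z \<in> space (M \<Otimes>\<^sub>M (borel :: real measure))"
    show "(\<lambda>n. if snd z < 0 then Inf {} else grid_inf X n (dyadic n (snd z)) (fst z))
        \<longlonglongrightarrow> running_inf X (snd z) (fst z)"
    proof (cases "snd z < 0")
      case True then show ?thesis by (simp add: running_inf_def)
    next
      case False
      then show ?thesis using grid_inf_tendsto[where X = X, OF cad[of "fst z"], of "snd z"] z
        by (auto simp: space_pair_measure)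
    qed
  qed
  then show ?thesis by (simp add: split_beta')
qed

section \<open>The law of the infimum for a general measurable cadlag process, so as to apply under
  both P and Q\<close>

context
  fixes M :: "'w measure" and X :: "real \<Rightarrow> 'w \<Rightarrow> real" and q :: real
  assumes prob: "prob_space M"
    and meas: "\<And>t. 0 \<le> t \<Longrightarrow> X t \<in> borel_measurable M"
    and cad: "\<And>\<omega>. \<omega> \<in> space M \<Longrightarrow> cadlag_on_nonneg (\<lambda>t. X t \<omega>)"
    and q: "0 < q"
begin

abbreviation exp_time :: "real measure" where
  "exp_time \<equiv> density lborel (\<lambda>x. ennreal (exponential_density q x))"

abbreviation clocked :: "('w \<times> real) measure" where
  "clocked \<equiv> M \<Otimes>\<^sub>M exp_time"

interpretation M: prob_space M by (rule prob)
interpretation E: prob_space exp_time using q by (rule prob_space_exponential_density)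
interpretation ME: pair_prob_space M exp_time ..

lemma sets_pair_exp_time: "sets clocked = sets (M \<Otimes>\<^sub>M borel)"
  by (intro sets_pair_measure_cong) auto

lemma grid_inf_pair_measurable:
  "(\<lambda>z. grid_inf X n (dyadic n (snd z)) (fst z)) \<in> borel_measurable clocked"
  using grid_inf_joint_measurable[where X = X and M = M, OF meas] measurable_cong_sets[OF sets_pair_exp_time refl] by blast

lemma running_inf_pair_measurable:
  "(\<lambda>(\<omega>, t). running_inf X t \<omega>) \<in> borel_measurable clocked"
  using running_inf_joint_measurable[where X = X and M = M, OF meas cad] measurable_cong_sets[OF sets_pair_exp_time refl] by blast

lemma running_inf_pair_measurable':
  "(\<lambda>z. running_inf X (snd z) (fst z)) \<in> borel_measurable clocked"
  using running_inf_pair_measurable by (simp add: split_beta')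

lemma neg_running_inf_measurable:
  "(\<lambda>(\<omega>, t). - running_inf X t \<omega>) \<in> clocked \<rightarrow>\<^sub>M borel"
  using running_inf_pair_measurable' by (simp add: split_beta')

lemma exp_time_inf_law_prob: "prob_space (exp_time_inf_law M X q)" "sets (exp_time_inf_law M X q) = sets borel"
  unfolding exp_time_inf_law_def
  by (auto intro!: ME.prob_space_distr neg_running_inf_measurable)

lemma nn_integral_exp_time_inf_law:
  assumes "f \<in> borel_measurable borel"
  shows "(\<integral>\<^sup>+x. f x \<partial>exp_time_inf_law M X q) = (\<integral>\<^sup>+z. f (- running_inf X (snd z) (fst z)) \<partial>clocked)"
  unfolding exp_time_inf_law_def
  by (subst nn_integral_distr[OF neg_running_inf_measurable]) (auto simp: assms split_beta')

lemma AE_exp_time_nonneg: "AE z in clocked. 0 \<le> snd z"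
proof (rule AE_I)
  have E0: "emeasure exp_time {..<0} = 0"
    by (subst emeasure_density) (auto simp: exponential_density_def indicator_def intro!: nn_integral_zero')
  show "{z \<in> space clocked. \<not> 0 \<le> snd z} \<subseteq> space M \<times> {..<0}"
    by (auto simp: space_pair_measure)
  show "emeasure clocked (space M \<times> {..<0}) = 0"
    by (subst E.emeasure_pair_measure_Times) (auto simp: E0)
  show "space M \<times> {..<0} \<in> sets clocked" by (intro pair_measureI) auto
qed

lemma AE_grid_inf_tendsto:
  "AE z in clocked. (\<lambda>n. grid_inf X n (dyadic n (snd z)) (fst z)) \<longlonglongrightarrow> running_inf X (snd z) (fst z)"
  using AE_exp_time_nonneg AE_space
proof eventually_elim
  case (elim z)
  then show ?case by (intro grid_inf_tendsto cad) (auto simp: space_pair_measure)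
qed

lemma nn_integral_grid_inf:
  fixes f :: "real \<Rightarrow> ennreal"
  assumes [measurable]: "f \<in> borel_measurable borel"
  shows "(\<integral>\<^sup>+z. f (grid_inf X n (dyadic n (snd z)) (fst z)) \<partial>clocked)
    = (\<integral>\<^sup>+t. (\<integral>\<^sup>+\<omega>. f (grid_inf X n (dyadic n t) \<omega>) \<partial>M) \<partial>exp_time)"
proof -
  have "(\<lambda>z. f (grid_inf X n (dyadic n (snd z)) (fst z))) \<in> borel_measurable clocked"
    by (rule measurable_compose[OF grid_inf_pair_measurable]) measurable
  from ME.nn_integral_snd[OF this] show ?thesis by simp
qed

lemma nn_integral_grid_inf_less:
  "(\<integral>\<^sup>+z. indicator {..< - y} (grid_inf X n (dyadic n (snd z)) (fst z)) \<partial>clocked)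
    = (\<integral>\<^sup>+t. emeasure M {\<omega> \<in> space M. grid_inf X n (dyadic n t) \<omega> < - y} \<partial>exp_time)"
proof -
  have "(\<integral>\<^sup>+\<omega>. indicator {..< - y} (grid_inf X n m \<omega>) \<partial>M) = emeasure M {\<omega> \<in> space M. grid_inf X n m \<omega> < - y}" for m
  proof -
    have [measurable]: "grid_inf X n m \<in> borel_measurable M"
      by (intro grid_inf_measurable meas) simp
    have "(\<integral>\<^sup>+\<omega>. indicator {..< - y} (grid_inf X n m \<omega>) \<partial>M)
        = (\<integral>\<^sup>+\<omega>. indicator {\<omega> \<in> space M. grid_inf X n m \<omega> < - y} \<omega> \<partial>M)"
      by (intro nn_integral_cong) (auto simp: indicator_def)
    also have "\<dots> = emeasure M {\<omega> \<in> space M. grid_inf X n m \<omega> < - y}"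
      by (rule nn_integral_indicator) measurable
    finally show ?thesis .
  qed
  then show ?thesis by (subst nn_integral_grid_inf) auto
qed

text \<open>Dominated convergence carries the grid bounds to the running infimum, as the integrands
  are at most 1. Since the limit is finite, it can be subtracted from the total mass 1.\<close>

lemma exp_time_inf_transform:
  assumes \<theta>: "0 \<le> \<theta>"
    and bound: "\<And>n. 1 \<le> (\<integral>\<^sup>+t. (\<integral>\<^sup>+\<omega>. ennreal (exp (\<theta> * grid_inf X n (dyadic n t) \<omega>)) \<partial>M) \<partial>exp_time) + ennreal (c n)"
    and c: "c \<longlonglongrightarrow> c0"
  shows "(\<integral>\<^sup>+x\<in>{0..}. ennreal (1 - exp (- \<theta> * x)) \<partial>exp_time_inf_law M X q) \<le> ennreal c0"
proof -
  note [measurable] = grid_inf_pair_measurable running_inf_pair_measurable'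
  let ?I = "\<lambda>z. running_inf X (snd z) (fst z)"
  let ?e = "\<lambda>z. ennreal (exp (\<theta> * ?I z))"
  have neg: "AE z in clocked. ?I z \<le> 0"
    using AE_grid_inf_tendsto
  proof eventually_elim
    case (elim z)
    then show ?case by (rule LIMSEQ_le_const2) (auto simp: grid_inf_nonpos)
  qed
  have "(\<lambda>n. (\<integral>\<^sup>+z. ennreal (exp (\<theta> * grid_inf X n (dyadic n (snd z)) (fst z))) \<partial>clocked))
      \<longlonglongrightarrow> (\<integral>\<^sup>+z. ?e z \<partial>clocked)"
  proof (rule nn_integral_dominated_convergence[where w = "\<lambda>_. 1"])
    show "AE z in clocked. ennreal (exp (\<theta> * grid_inf X n (dyadic n (snd z)) (fst z))) \<le> 1" for n
      using \<theta> by (intro AE_I2) (auto simp: grid_inf_nonpos mult_nonneg_nonpos simp flip: ennreal_1)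
    show "AE z in clocked. (\<lambda>n. ennreal (exp (\<theta> * grid_inf X n (dyadic n (snd z)) (fst z)))) \<longlonglongrightarrow> ?e z"
      using AE_grid_inf_tendsto by eventually_elim (intro tendsto_intros)
    show "(\<integral>\<^sup>+z. 1 \<partial>clocked) < \<infinity>" by (simp add: ME.P.emeasure_space_1)
  qed measurable
  then have lim: "(\<lambda>n. (\<integral>\<^sup>+t. (\<integral>\<^sup>+\<omega>. ennreal (exp (\<theta> * grid_inf X n (dyadic n t) \<omega>)) \<partial>M) \<partial>exp_time) + ennreal (c n))
      \<longlonglongrightarrow> (\<integral>\<^sup>+z. ?e z \<partial>clocked) + ennreal c0"
    using nn_integral_grid_inf[of "\<lambda>x. ennreal (exp (\<theta> * x))"] c by (intro tendsto_add tendsto_ennrealI) auto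
  have ge: "1 \<le> (\<integral>\<^sup>+z. ?e z \<partial>clocked) + ennreal c0"
    by (rule LIMSEQ_le_const[OF lim]) (use bound in auto)
  have "(\<integral>\<^sup>+x\<in>{0..}. ennreal (1 - exp (- \<theta> * x)) \<partial>exp_time_inf_law M X q)
      \<le> (\<integral>\<^sup>+x. ennreal (1 - exp (- \<theta> * x)) \<partial>exp_time_inf_law M X q)"
    by (intro nn_integral_mono) (auto simp: indicator_def)
  also have "\<dots> = (\<integral>\<^sup>+z. ennreal (1 - exp (\<theta> * ?I z)) \<partial>clocked)"
    by (subst nn_integral_exp_time_inf_law) auto
  finally have le: "(\<integral>\<^sup>+x\<in>{0..}. ennreal (1 - exp (- \<theta> * x)) \<partial>exp_time_inf_law M X q)
      \<le> (\<integral>\<^sup>+z. ennreal (1 - exp (\<theta> * ?I z)) \<partial>clocked)" .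
  have "(\<integral>\<^sup>+z. ennreal (1 - exp (\<theta> * ?I z)) \<partial>clocked) + (\<integral>\<^sup>+z. ?e z \<partial>clocked)
      = (\<integral>\<^sup>+z. ennreal (1 - exp (\<theta> * ?I z)) + ?e z \<partial>clocked)"
    by (rule nn_integral_add[symmetric]) measurable
  also have "\<dots> = (\<integral>\<^sup>+z. 1 \<partial>clocked)"
  proof (rule nn_integral_cong_AE, use neg in eventually_elim)
    case (elim z)
    then have "exp (\<theta> * ?I z) \<le> 1" using \<theta> by (simp add: mult_nonneg_nonpos)
    then show ?case by (simp flip: ennreal_plus ennreal_1)
  qed
  also have "\<dots> = 1" by (simp add: ME.P.emeasure_space_1)
  finally have sum1: "(\<integral>\<^sup>+z. ennreal (1 - exp (\<theta> * ?I z)) \<partial>clocked) + (\<integral>\<^sup>+z. ?e z \<partial>clocked) = 1" .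
  then have "(\<integral>\<^sup>+z. ?e z \<partial>clocked) \<noteq> \<infinity>" by auto
  moreover have "(\<integral>\<^sup>+z. ?e z \<partial>clocked) + (\<integral>\<^sup>+z. ennreal (1 - exp (\<theta> * ?I z)) \<partial>clocked)
      \<le> (\<integral>\<^sup>+z. ?e z \<partial>clocked) + ennreal c0"
    using ge sum1 by (simp add: add.commute)
  ultimately have "(\<integral>\<^sup>+z. ennreal (1 - exp (\<theta> * ?I z)) \<partial>clocked) \<le> ennreal c0"
    by (simp add: ennreal_add_left_cancel_le)
  with le show ?thesis by (rule order_trans)
qed

text \<open>A limit strictly below -y forces the grid infima below -y eventually, whereas grid
  infima below -y only force a limit of at most -y. Hence Fatou gives the open tail here, and
  reverse Fatou the closed tail in \<open>exp_time_inf_tail_ge\<close>.\<close>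

lemma exp_time_inf_tail_le:
  "emeasure (exp_time_inf_law M X q) {y<..}
    \<le> liminf (\<lambda>n. (\<integral>\<^sup>+t. emeasure M {\<omega> \<in> space M. grid_inf X n (dyadic n t) \<omega> < - y} \<partial>exp_time))"
proof -
  note [measurable] = grid_inf_pair_measurable running_inf_pair_measurable'
  let ?I = "\<lambda>z. running_inf X (snd z) (fst z)"
  let ?g = "\<lambda>n z. grid_inf X n (dyadic n (snd z)) (fst z)"
  have "emeasure (exp_time_inf_law M X q) {y<..} = (\<integral>\<^sup>+x. indicator {y<..} x \<partial>exp_time_inf_law M X q)"
    by (simp add: exp_time_inf_law_prob)
  also have "\<dots> = (\<integral>\<^sup>+z. indicator {y<..} (- ?I z) \<partial>clocked)"
    by (rule nn_integral_exp_time_inf_law) simp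
  also have "\<dots> \<le> (\<integral>\<^sup>+z. liminf (\<lambda>n. indicator {..< - y} (?g n z)) \<partial>clocked)"
  proof (rule nn_integral_mono_AE, use AE_grid_inf_tendsto in eventually_elim)
    case (elim z)
    show "indicator {y<..} (- ?I z) \<le> liminf (\<lambda>n. indicator {..< - y} (?g n z) :: ennreal)"
    proof (cases "?I z < - y")
      case True
      from order_tendstoD(2)[OF elim this]
      have "\<forall>\<^sub>F n in sequentially. (1 :: ennreal) \<le> indicator {..< - y} (?g n z)"
        by eventually_elim simp
      from Liminf_bounded[OF this] show ?thesis by (auto simp: indicator_def)
    qed auto
  qed
  also have "\<dots> \<le> liminf (\<lambda>n. (\<integral>\<^sup>+z. indicator {..< - y} (?g n z) \<partial>clocked))"
    by (rule nn_integral_liminf) measurable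
  finally show ?thesis unfolding nn_integral_grid_inf_less .
qed

lemma exp_time_inf_tail_ge:
  "limsup (\<lambda>n. (\<integral>\<^sup>+t. emeasure M {\<omega> \<in> space M. grid_inf X n (dyadic n t) \<omega> < - y} \<partial>exp_time))
    \<le> emeasure (exp_time_inf_law M X q) {y..}"
proof -
  note [measurable] = grid_inf_pair_measurable running_inf_pair_measurable'
  let ?I = "\<lambda>z. running_inf X (snd z) (fst z)"
  let ?g = "\<lambda>n z. grid_inf X n (dyadic n (snd z)) (fst z)"
  have "limsup (\<lambda>n. (\<integral>\<^sup>+t. emeasure M {\<omega> \<in> space M. grid_inf X n (dyadic n t) \<omega> < - y} \<partial>exp_time))
      = limsup (\<lambda>n. (\<integral>\<^sup>+z. indicator {..< - y} (?g n z) \<partial>clocked))"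
    unfolding nn_integral_grid_inf_less ..
  also have "\<dots> \<le> (\<integral>\<^sup>+z. limsup (\<lambda>n. indicator {..< - y} (?g n z)) \<partial>clocked)"
  proof (rule nn_integral_limsup[where w = "\<lambda>_. 1"])
    show "(\<integral>\<^sup>+z. 1 \<partial>clocked) < \<infinity>" by (simp add: ME.P.emeasure_space_1)
    show "AE z in clocked. indicator {..< - y} (?g n z) \<le> (1 :: ennreal)" for n
      by (auto simp: indicator_def)
  qed measurable
  also have "\<dots> \<le> (\<integral>\<^sup>+z. indicator {y..} (- ?I z) \<partial>clocked)"
  proof (rule nn_integral_mono_AE, use AE_grid_inf_tendsto in eventually_elim)
    case (elim z)
    show "limsup (\<lambda>n. indicator {..< - y} (?g n z) :: ennreal) \<le> indicator {y..} (- ?I z)"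
    proof (cases "- y < ?I z")
      case True
      from order_tendstoD(1)[OF elim this]
      have "\<forall>\<^sub>F n in sequentially. indicator {..< - y} (?g n z) \<le> (0 :: ennreal)"
        by eventually_elim simp
      from Limsup_bounded[OF this] show ?thesis using True by (auto simp: indicator_def)
    next
      case False
      have "limsup (\<lambda>n. indicator {..< - y} (?g n z) :: ennreal) \<le> 1"
        by (intro Limsup_bounded always_eventually) (auto simp: indicator_def)
      then show ?thesis using False by (auto simp: indicator_def)
    qed
  qed
  also have "\<dots> = (\<integral>\<^sup>+x. indicator {y..} x \<partial>exp_time_inf_law M X q)"
    by (rule nn_integral_exp_time_inf_law[symmetric]) simp
  also have "\<dots> = emeasure (exp_time_inf_law M X q) {y..}"
    by (simp add: exp_time_inf_law_prob)
  finally show ?thesis .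
qed

end

subsection \<open>Transform and tilting of the infimum\<close>

lemma Min_min_zero:
  fixes a :: "nat \<Rightarrow> real"
  assumes "a 0 = 0"
  shows "Min ((\<lambda>j. min (a j) 0) ` {..m}) = Min (a ` {..m})"
proof (rule antisym)
  show "Min ((\<lambda>j. min (a j) 0) ` {..m}) \<le> Min (a ` {..m})"
  proof (rule Min.boundedI)
    fix x assume "x \<in> a ` {..m}"
    then obtain j where j: "j \<le> m" "x = a j" by auto
    have "Min ((\<lambda>j. min (a j) 0) ` {..m}) \<le> min (a j) 0" using j by (intro Min_le) auto
    then show "Min ((\<lambda>j. min (a j) 0) ` {..m}) \<le> x" using j by linarith
  qed auto
  show "Min (a ` {..m}) \<le> Min ((\<lambda>j. min (a j) 0) ` {..m})"
  proof (rule Min.boundedI)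
    fix x assume "x \<in> (\<lambda>j. min (a j) 0) ` {..m}"
    then obtain j where j: "j \<le> m" "x = min (a j) 0" by auto
    have "Min (a ` {..m}) \<le> a j" "Min (a ` {..m}) \<le> a 0" using j by (auto intro!: Min_le)
    then show "Min (a ` {..m}) \<le> x" using j assms by simp
  qed auto
qed

lemma levy_grid_inf:
  assumes levy: "levy_process P X"
  shows "AE \<omega> in P. grid_inf X n m \<omega> = snd (walk (\<lambda>i. increment X (1 / 2 ^ n) i \<omega>) 0 m)"
  using levy_start[OF levy]
proof eventually_elim
  case (elim \<omega>)
  have "grid_inf X n m \<omega> = Min ((\<lambda>j. X (real j / 2 ^ n) \<omega>) ` {..m})"
    unfolding grid_inf_def by (rule Min_min_zero) (simp add: elim)
  then show ?case by (simp add: walk_increment[OF levy] elim)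
qed

text \<open>A positive number has only one positive root of order 2^n, and an infinite root would
  have an infinite power. So the moments on the grid are determined by those at time 1.\<close>

lemma levy_mgf_dyadic_eq:
  assumes levy: "levy_process P X" and "levy_mgf P X 1 s = ennreal (exp c)"
  shows "levy_mgf P X (1 / 2 ^ n) s = ennreal (exp (c / 2 ^ n))"
proof -
  define x where "x = levy_mgf P X (1 / 2 ^ n) s"
  have x: "x ^ (2 ^ n) = ennreal (exp c)" using levy_mgf_dyadic[OF levy, of s n] assms(2) by (simp add: x_def)
  show ?thesis
  proof (cases x)
    case (real r)
    then have "ennreal (r ^ (2 ^ n)) = ennreal (exp c)" using x by (simp add: ennreal_power)
    then have "r ^ (2 ^ n) = exp c" using real by simp
    also have "\<dots> = exp (c / 2 ^ n) ^ (2 ^ n)" by (simp flip: exp_of_nat_mult)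
    finally have "r = exp (c / 2 ^ n)" using real by (intro power_eq_imp_eq_base[of r "2 ^ n"]) auto
    then show ?thesis using real by (simp add: x_def)
  next
    case top
    then show ?thesis using x by (simp add: power_eq_top_ennreal)
  qed
qed

text \<open>The bound on the grid of mesh 2^-n carries the factor exp(q / 2^n), which disappears in
  the limit. The condition c \<ge> 0 makes the step factor at \<theta> at least 1 on every
  grid.\<close>

lemma levy_exp_time_transform:
  assumes levy: "levy_process P X" and q: "0 < q" and \<theta>: "0 \<le> \<theta>" "\<theta> \<le> \<Phi>" "0 < \<Phi>"
    and m\<theta>: "levy_mgf P X 1 \<theta> = ennreal (exp c)" "0 \<le> c" and m\<Phi>: "levy_mgf P X 1 \<Phi> = ennreal (exp q)"
  shows "(\<integral>\<^sup>+x\<in>{0..}. ennreal (1 - exp (- \<theta> * x)) \<partial>exp_time_inf_law P X q) \<le> ennreal (\<theta> / \<Phi>)"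
proof (rule exp_time_inf_transform[OF _ _ _ q \<theta>(1), where c = "\<lambda>n. exp (q * (1 / 2 ^ n)) * (\<theta> / \<Phi>)"])
  show "prob_space P" using levy by (simp add: levy_process_def)
  show "X t \<in> borel_measurable P" if "0 \<le> t" for t using levy_measurable[OF levy that] .
  show "cadlag_on_nonneg (\<lambda>t. X t \<omega>)" if "\<omega> \<in> space P" for \<omega> using levy_cadlag[OF levy that] .
  have "(\<lambda>n. 1 / 2 ^ n :: real) \<longlonglongrightarrow> 0" using LIMSEQ_divide_realpow_zero[of 2 1] by simp
  then have "(\<lambda>n. exp (q * (1 / 2 ^ n)) * (\<theta> / \<Phi>)) \<longlonglongrightarrow> exp (q * 0) * (\<theta> / \<Phi>)"
    by (intro tendsto_intros)
  then show "(\<lambda>n. exp (q * (1 / 2 ^ n)) * (\<theta> / \<Phi>)) \<longlonglongrightarrow> \<theta> / \<Phi>" by simp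
  fix n
  define h where "h = (1 / 2 ^ n :: real)"
  have h: "0 < h" "0 \<le> h" by (simp_all add: h_def)
  define \<nu> where "\<nu> = distr P borel (X h)"
  have \<nu>: "prob_space \<nu>" "sets \<nu> = sets borel"
    using prob_space_levy_law[OF levy h(2)] by (simp_all add: \<nu>_def)
  have step: "step_mgf \<nu> s = levy_mgf P X h s" for s
    unfolding \<nu>_def by (rule step_mgf_levy[OF levy h(2)])
  have grid: "(\<integral>\<^sup>+\<omega>. ennreal (exp (\<theta> * grid_inf X n m \<omega>)) \<partial>P) = min_transform \<nu> m \<theta>" for m
  proof -
    have "(\<integral>\<^sup>+\<omega>. ennreal (exp (\<theta> * grid_inf X n m \<omega>)) \<partial>P)
        = (\<integral>\<^sup>+\<omega>. ennreal (exp (\<theta> * snd (walk (\<lambda>i. increment X h i \<omega>) 0 m))) \<partial>P)"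
      using levy_grid_inf[OF levy, of n m] by (intro nn_integral_cong_AE) (auto simp: h_def)
    also have "\<dots> = min_transform \<nu> m \<theta>"
      unfolding min_transform_def[OF \<nu>] unfolding \<nu>_def by (rule nn_integral_walk_increment[OF levy h(2)]) simp
    finally show ?thesis .
  qed
  have "1 \<le> (\<integral>\<^sup>+t. min_transform \<nu> (nat \<lfloor>t / h\<rfloor> + 1) \<theta> \<partial>density lborel (\<lambda>x. ennreal (exponential_density q x)))
      + ennreal (exp (q * h) * (\<theta> / \<Phi>))"
  proof (rule min_transform_exponential_time[OF \<nu> h(1) q \<theta>])
    have "0 \<le> c / 2 ^ n" using m\<theta>(2) by simp
    then show "1 \<le> step_mgf \<nu> \<theta>"
      unfolding step h_def levy_mgf_dyadic_eq[OF levy m\<theta>(1)] by (simp flip: ennreal_1)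
    show "step_mgf \<nu> \<Phi> = ennreal (exp (q * h))"
      unfolding step h_def levy_mgf_dyadic_eq[OF levy m\<Phi>] by simp
  qed
  then show "1 \<le> (\<integral>\<^sup>+t. (\<integral>\<^sup>+\<omega>. ennreal (exp (\<theta> * grid_inf X n (dyadic n t) \<omega>)) \<partial>P)
      \<partial>density lborel (\<lambda>x. ennreal (exponential_density q x))) + ennreal (exp (q * (1 / 2 ^ n)) * (\<theta> / \<Phi>))"
    unfolding grid by (simp add: h_def)
qed

lemma joint_filtration_measurable:
  assumes "0 \<le> s" "s \<le> t"
  shows "Y s \<in> borel_measurable (joint_filtration P X Y t)"
proof (rule measurableI)
  fix B :: "real set" assume "B \<in> sets borel"
  then have "Y s -` B \<inter> space P \<in> {X s -` B \<inter> space P | s B. s \<in> {0..t} \<and> B \<in> sets borel} \<union>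
        {Y s -` B \<inter> space P | s B. s \<in> {0..t} \<and> B \<in> sets borel}"
    using assms by auto
  then show "Y s -` B \<inter> space (joint_filtration P X Y t) \<in> sets (joint_filtration P X Y t)"
    unfolding joint_filtration_def by (auto simp: sets_measure_of_conv space_measure_of_conv intro!: sigma_sets.Basic)
qed simp

text \<open>\<open>Q\<close> may live on another sigma-algebra than \<open>P\<close>, so
  measurability is obtained from the filtration, whose sets belong to \<open>Q\<close>.\<close>

lemma exponential_tilt_measurable:
  assumes tilt: "exponential_tilt P X Y \<gamma> Q" and "0 \<le> t"
  shows "Y t \<in> borel_measurable Q"
proof (rule measurableI)
  have sp: "space Q = space P" and sub: "sets (joint_filtration P X Y t) \<subseteq> sets Q"
    using assms by (auto simp: exponential_tilt_def)
  fix B :: "real set" assume "B \<in> sets borel"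
  from measurable_sets[OF joint_filtration_measurable[OF assms(2) order_refl, of Y P X] this]
  have "Y t -` B \<inter> space P \<in> sets (joint_filtration P X Y t)"
    by (simp add: joint_filtration_def space_measure_of_conv)
  then show "Y t -` B \<inter> space Q \<in> sets Q" using sub sp by auto
qed simp

text \<open>The factor of the density that belongs to \<open>X\<close> has mean 1 because \<open>Q\<close> is a probability measure, so
  its exponent need not be computed.\<close>

lemma tilted_grid_inf_tail:
  assumes levy: "levy_process P Y" and ind: "indep_processes P X Y"
    and tilt: "exponential_tilt P X Y \<gamma> Q" and \<gamma>: "0 \<le> \<gamma>" and one: "levy_mgf P Y 1 \<gamma> = 1"
  shows "emeasure Q {\<omega> \<in> space Q. grid_inf Y n m \<omega> < - y}
    \<le> ennreal (exp (- \<gamma> * y)) * emeasure P {\<omega> \<in> space P. grid_inf Y n m \<omega> < - y}"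
proof -
  interpret P: prob_space P using levy by (simp add: levy_process_def)
  interpret Q: prob_space Q using tilt by (simp add: exponential_tilt_def)
  define h where "h = (1 / 2 ^ n :: real)"
  have h: "0 \<le> h" by (simp add: h_def)
  define T where "T = real m * h"
  have T: "0 \<le> T" using h by (simp add: T_def)
  define \<nu> where "\<nu> = distr P borel (Y h)"
  have \<nu>: "prob_space \<nu>" "sets \<nu> = sets borel"
    using prob_space_levy_law[OF levy h] by (simp_all add: \<nu>_def)
  have one_h: "levy_mgf P Y h \<gamma> = 1"
    using levy_mgf_dyadic_eq[OF levy, of \<gamma> 0 n] one by (simp add: h_def)
  have sp: "space Q = space P" using tilt by (simp add: exponential_tilt_def)
  define k where "k = real_of_ereal (levy_exponent P (\<lambda>u \<omega>. X u \<omega> + Y u \<omega>) \<gamma>)"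
  define A where "A = {\<omega> \<in> space P. grid_inf Y n m \<omega> < - y}"
  let ?J = "joint_filtration P X Y T"
  have spJ: "space ?J = space P" by (simp add: joint_filtration_def space_measure_of_conv)
  have "grid_inf Y n m \<in> borel_measurable ?J"
  proof (rule grid_inf_measurable, rule joint_filtration_measurable)
    fix j assume "j \<le> m"
    then show "real j / 2 ^ n \<le> T" by (simp add: T_def h_def divide_right_mono)
  qed simp
  then have "{\<omega> \<in> space ?J. grid_inf Y n m \<omega> < - y} \<in> sets ?J" by measurable
  then have A: "A \<in> sets ?J" by (simp add: A_def spJ)
  have top: "space P \<in> sets ?J" using sets.top[of ?J] by (simp add: spJ)
  have Q: "emeasure Q B = (\<integral>\<^sup>+\<omega>\<in>B. ennreal (exp (\<gamma> * (X T \<omega> + Y T \<omega>) - k * T)) \<partial>P)" if "B \<in> sets ?J" for B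
    using tilt T that by (auto simp: exponential_tilt_def k_def)
  let ?X = "\<lambda>\<omega>. \<lambda>t\<in>{0..}. X t \<omega>" and ?Y = "\<lambda>\<omega>. \<lambda>t\<in>{0..}. Y t \<omega>"
  have iv: "P.indep_var (\<Pi>\<^sub>M t\<in>{0..}. borel) ?X (\<Pi>\<^sub>M t\<in>{0..}. borel) ?Y"
    using ind by (simp add: indep_processes_def)
  have comp: "(\<lambda>x :: real \<Rightarrow> real. x t) \<in> borel_measurable (\<Pi>\<^sub>M t\<in>{0..}. borel)" if "0 \<le> t" for t
    using that by (intro measurable_component_singleton) simp
  have [measurable]: "(\<lambda>x :: real \<Rightarrow> real. x T) \<in> borel_measurable (\<Pi>\<^sub>M t\<in>{0..}. borel)"
    "grid_inf (\<lambda>t x. x t) n m \<in> borel_measurable (\<Pi>\<^sub>M t\<in>{0..}. borel)"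
    using T by (auto intro!: comp grid_inf_measurable)
  define C where "C = (\<integral>\<^sup>+\<omega>. ennreal (exp (\<gamma> * X T \<omega> - k * T)) \<partial>P)"
  \<comment> \<open>The level \<open>z\<close> is used twice: -y gives the event of interest, and 1,
    which exceeds every value of \<open>grid_inf\<close>, gives the total mass and thereby
    \<open>C = 1\<close>.\<close>
  have split: "(\<integral>\<^sup>+\<omega>. ennreal (exp (\<gamma> * (X T \<omega> + Y T \<omega>) - k * T)) * indicator {\<omega>. grid_inf Y n m \<omega> < z} \<omega> \<partial>P)
      = C * (\<integral>\<^sup>+\<omega>. ennreal (exp (\<gamma> * Y T \<omega>)) * indicator {\<omega>. grid_inf Y n m \<omega> < z} \<omega> \<partial>P)" for z
  proof -
    define f where "f = (\<lambda>x :: real \<Rightarrow> real. ennreal (exp (\<gamma> * x T - k * T)))"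
    define g where "g = (\<lambda>x :: real \<Rightarrow> real. ennreal (exp (\<gamma> * x T)) * indicator {..<z} (grid_inf (\<lambda>t x. x t) n m x))"
    have fg: "f \<in> borel_measurable (\<Pi>\<^sub>M t\<in>{0..}. borel)" "g \<in> borel_measurable (\<Pi>\<^sub>M t\<in>{0..}. borel)"
      unfolding f_def g_def by measurable
    have "grid_inf (\<lambda>t x. x t) n m (?Y \<omega>) = grid_inf Y n m \<omega>" for \<omega>
      by (simp add: grid_inf_def)
    then have g: "g (?Y \<omega>) = ennreal (exp (\<gamma> * Y T \<omega>)) * indicator {\<omega>. grid_inf Y n m \<omega> < z} \<omega>" for \<omega>
      using T by (simp add: g_def indicator_def)
    have f: "f (?X \<omega>) = ennreal (exp (\<gamma> * X T \<omega> - k * T))" for \<omega> using T by (simp add: f_def)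
    have "ennreal (exp (\<gamma> * (X T \<omega> + Y T \<omega>) - k * T)) * indicator {\<omega>. grid_inf Y n m \<omega> < z} \<omega> = f (?X \<omega>) * g (?Y \<omega>)" for \<omega>
    proof -
      have "exp (\<gamma> * (X T \<omega> + Y T \<omega>) - k * T) = exp (\<gamma> * X T \<omega> - k * T) * exp (\<gamma> * Y T \<omega>)"
        by (simp add: mult_exp_exp algebra_simps)
      then show ?thesis unfolding f g by (simp only: ennreal_mult[OF exp_ge_zero exp_ge_zero] mult.assoc)
    qed
    then show ?thesis
      using P.indep_var_nn_integral_mult[OF iv fg] unfolding C_def f g by (simp only:)
  qed
  have all: "indicator {\<omega>. grid_inf Y n m \<omega> < 1} \<omega> = (1 :: ennreal)" for \<omega>
    using grid_inf_nonpos[of Y n m \<omega>] by (simp add: indicator_def)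
  have "1 = emeasure Q (space P)" using Q.emeasure_space_1 sp by simp
  also have "\<dots> = (\<integral>\<^sup>+\<omega>. ennreal (exp (\<gamma> * (X T \<omega> + Y T \<omega>) - k * T)) * indicator {\<omega>. grid_inf Y n m \<omega> < 1} \<omega> \<partial>P)"
    unfolding Q[OF top] all by (intro nn_integral_cong) (simp add: indicator_def)
  also have "\<dots> = C * levy_mgf P Y T \<gamma>"
    unfolding split unfolding all by (simp add: levy_mgf_def[OF levy])
  also have "levy_mgf P Y T \<gamma> = 1"
    unfolding T_def levy_mgf_mult[OF levy h] one_h by simp
  finally have C: "C = 1" by simp
  let ?W = "\<lambda>\<omega>. walk (\<lambda>i. increment Y h i \<omega>) 0 m"
  have grid: "AE \<omega> in P. grid_inf Y n m \<omega> = snd (?W \<omega>) \<and> Y T \<omega> = fst (?W \<omega>)"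
    using levy_grid_inf[OF levy, of n m] levy_start[OF levy]
    by eventually_elim (simp add: h_def T_def walk_increment[OF levy])
  have [measurable]: "grid_inf Y n m \<in> borel_measurable P"
    by (intro grid_inf_measurable levy_measurable[OF levy]) simp
  have A_P: "A \<in> sets P" unfolding A_def by measurable
  have "emeasure Q {\<omega> \<in> space Q. grid_inf Y n m \<omega> < - y} = emeasure Q A" by (simp add: A_def sp)
  also have "\<dots> = (\<integral>\<^sup>+\<omega>. ennreal (exp (\<gamma> * (X T \<omega> + Y T \<omega>) - k * T)) * indicator {\<omega>. grid_inf Y n m \<omega> < - y} \<omega> \<partial>P)"
    unfolding Q[OF A] by (intro nn_integral_cong) (auto simp: indicator_def A_def)
  also have "\<dots> = (\<integral>\<^sup>+\<omega>. ennreal (exp (\<gamma> * Y T \<omega>)) * indicator {\<omega>. grid_inf Y n m \<omega> < - y} \<omega> \<partial>P)"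
    unfolding split C by simp
  also have "\<dots> = (\<integral>\<^sup>+\<omega>. ennreal (exp (\<gamma> * fst (?W \<omega>))) * indicator {p. snd p < - y} (?W \<omega>) \<partial>P)"
    using grid by (intro nn_integral_cong_AE) (auto simp: indicator_def)
  also have "\<dots> = (\<integral>\<^sup>+p. ennreal (exp (\<gamma> * fst p)) * indicator {p. snd p < - y} p \<partial>walk_law \<nu> m)"
    unfolding \<nu>_def by (rule nn_integral_walk_increment[OF levy h]) measurable
  also have "\<dots> \<le> ennreal (exp (- \<gamma> * y)) * min_tail \<nu> m y"
    by (rule tilted_min_tail[OF \<nu> \<gamma>]) (simp add: \<nu>_def step_mgf_levy[OF levy h] one_h)
  also have "min_tail \<nu> m y = (\<integral>\<^sup>+\<omega>. indicator {p. snd p < - y} (?W \<omega>) \<partial>P)"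
    unfolding min_tail_def[OF \<nu>] unfolding \<nu>_def by (rule nn_integral_walk_increment[OF levy h, symmetric]) measurable
  also have "\<dots> = (\<integral>\<^sup>+\<omega>. indicator A \<omega> \<partial>P)"
  proof (rule nn_integral_cong_AE)
    show "AE \<omega> in P. indicator {p. snd p < - y} (?W \<omega>) = (indicator A \<omega> :: ennreal)"
      using grid AE_space by eventually_elim (auto simp: indicator_def A_def)
  qed
  also have "\<dots> = emeasure P A" using A_P by (rule nn_integral_indicator)
  finally show ?thesis by (simp add: A_def)
qed

text \<open>Integrating the grid bound over the exponential time and refining the grid leaves a
  liminf on the side of Q and a limsup on the side of P; the open and the closed tail are those for
  which these limits point the right way.\<close>

lemma tilted_exp_time_inf_tail:
  assumes levy: "levy_process P Y" and ind: "indep_processes P X Y" and q: "0 < q"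
    and tilt: "exponential_tilt P X Y \<gamma> Q" and \<gamma>: "0 \<le> \<gamma>" and one: "levy_mgf P Y 1 \<gamma> = 1"
  shows "emeasure (exp_time_inf_law Q Y q) {y<..}
    \<le> ennreal (exp (- \<gamma> * y)) * emeasure (exp_time_inf_law P Y q) {y..}"
proof -
  define E where "E = density lborel (\<lambda>x. ennreal (exponential_density q x))"
  have P: "prob_space P" and Q: "prob_space Q" and sp: "space Q = space P"
    using levy tilt by (auto simp: levy_process_def exponential_tilt_def)
  define p where "p = (\<lambda>n. (\<integral>\<^sup>+t. emeasure P {\<omega> \<in> space P. grid_inf Y n (dyadic n t) \<omega> < - y} \<partial>E))"
  define r where "r = (\<lambda>n. (\<integral>\<^sup>+t. emeasure Q {\<omega> \<in> space Q. grid_inf Y n (dyadic n t) \<omega> < - y} \<partial>E))"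
  let ?c = "ennreal (exp (- \<gamma> * y))"
  have rp: "r n \<le> ?c * p n" for n
  proof -
    have "r n \<le> (\<integral>\<^sup>+t. ?c * emeasure P {\<omega> \<in> space P. grid_inf Y n (dyadic n t) \<omega> < - y} \<partial>E)"
      unfolding r_def by (intro nn_integral_mono tilted_grid_inf_tail[OF levy ind tilt \<gamma> one])
    also have "\<dots> = ?c * p n"
      unfolding p_def E_def by (rule nn_integral_cmult) measurable
    finally show ?thesis .
  qed
  have "emeasure (exp_time_inf_law Q Y q) {y<..} \<le> liminf r"
    unfolding r_def E_def
    by (rule exp_time_inf_tail_le[OF Q exponential_tilt_measurable[OF tilt] _ q])
       (auto simp: sp levy_cadlag[OF levy])
  also have "\<dots> \<le> limsup r" by (rule Liminf_le_Limsup) simp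
  also have "\<dots> \<le> limsup (\<lambda>n. ?c * p n)" using rp by (intro Limsup_mono) simp
  also have "\<dots> = ?c * limsup p"
  proof (rule Limsup_compose_continuous_mono)
    show "continuous_on UNIV ((*) ?c)"
      unfolding continuous_on_def by (auto intro!: ennreal_tendsto_cmult)
    show "mono ((*) ?c)" by (auto intro!: monoI mult_left_mono)
  qed simp
  also have "\<dots> \<le> ?c * emeasure (exp_time_inf_law P Y q) {y..}"
    unfolding p_def E_def
    by (intro mult_left_mono exp_time_inf_tail_ge[OF P levy_measurable[OF levy] levy_cadlag[OF levy] q]) simp_all
  finally show ?thesis .
qed

subsection \<open>Exponential moments of the jumps\<close>

text \<open>In \<^const>\<open>compound_poisson\<close> the Poisson process is coerced to a sequence, so independence of the jumps is available at
  integer times only; time 1 is enough.\<close>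

lemma compound_poisson_jump_mgf:
  assumes P: "prob_space P" and comp: "compound_poisson P lam F X" and lam: "0 < lam"
    and fin: "(\<integral>\<^sup>+\<omega>. ennreal (exp (\<gamma> * X 1 \<omega>)) \<partial>P) < \<infinity>"
  shows "(\<integral>\<^sup>+u. ennreal (exp (\<gamma> * u)) \<partial>F) < \<infinity>"
proof -
  interpret P: prob_space P by (rule P)
  obtain N U where pois: "poisson_process P lam N" and U: "P.indep_vars (\<lambda>_. borel) U (UNIV :: nat set)"
    "\<And>i. distr P borel (U i) = F"
    and iv: "P.indep_var (\<Pi>\<^sub>M n\<in>{0..}. count_space UNIV) (\<lambda>\<omega> n. real ((\<lambda>t\<in>{0..}. N t \<omega>) (real n)))
          (\<Pi>\<^sub>M i\<in>UNIV. borel) (\<lambda>\<omega> i. U i \<omega>)"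
    and X: "\<And>t \<omega>. 0 \<le> t \<Longrightarrow> \<omega> \<in> space P \<Longrightarrow> X t \<omega> = (\<Sum>i<N t \<omega>. U i \<omega>)"
    using comp unfolding compound_poisson_def by auto
  have U0: "U 0 \<in> borel_measurable P" using U(1) by (auto simp: P.indep_vars_def)
  have "(\<lambda>\<omega>. real (N 1 \<omega>)) \<in> borel_measurable P"
    using pois by (auto simp: poisson_process_def levy_process_def)
  then have "(\<lambda>\<omega>. nat \<lfloor>real (N 1 \<omega>)\<rfloor>) \<in> P \<rightarrow>\<^sub>M count_space UNIV" by measurable
  then have N1[measurable]: "N 1 \<in> P \<rightarrow>\<^sub>M count_space UNIV" by simp
  \<comment> \<open>On the event of exactly one jump up to time 1, X 1 equals U 0. The event has
    positive probability and is independent of U 0, so this probability times the jump moment is at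
    most the moment of X 1.\<close>
  define f where "f = (\<lambda>x :: nat \<Rightarrow> real. indicator {1} (x 1) :: ennreal)"
  define g where "g = (\<lambda>x :: nat \<Rightarrow> real. ennreal (exp (\<gamma> * x 0)))"
  have fm: "f \<in> borel_measurable (\<Pi>\<^sub>M n\<in>{0..}. count_space UNIV)"
    unfolding f_def by (rule measurable_compose[OF measurable_component_singleton[of 1]]) auto
  have gm: "g \<in> borel_measurable (\<Pi>\<^sub>M i\<in>UNIV. borel)"
    unfolding g_def by (rule measurable_compose[OF measurable_component_singleton[of 0]]) auto
  have f: "f (\<lambda>n. real ((\<lambda>t\<in>{0..}. N t \<omega>) (real n))) = indicator {\<omega>. N 1 \<omega> = 1} \<omega>" for \<omega>
    by (simp add: f_def indicator_def)
  define p where "p = emeasure P {\<omega> \<in> space P. N 1 \<omega> = 1}"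
  define I where "I = (\<integral>\<^sup>+\<omega>. ennreal (exp (\<gamma> * U 0 \<omega>)) \<partial>P)"
  have "distr P (count_space UNIV) (N 1) = measure_pmf (poisson_pmf (lam * 1))"
    using pois by (auto simp: poisson_process_def)
  then have "emeasure (distr P (count_space UNIV) (N 1)) {1} = ennreal (pmf (poisson_pmf lam) 1)"
    by (simp add: emeasure_pmf_single)
  moreover have "emeasure (distr P (count_space UNIV) (N 1)) {1} = p"
    by (subst emeasure_distr) (auto simp: p_def intro!: arg_cong[where f = "emeasure P"])
  ultimately have "p = ennreal (pmf (poisson_pmf lam) 1)" by metis
  moreover have "0 < pmf (poisson_pmf lam) 1" using lam by simp
  ultimately have p: "0 < p" by (simp only: ennreal_less_zero_iff)
  have "(\<integral>\<^sup>+\<omega>. indicator {\<omega>. N 1 \<omega> = 1} \<omega> \<partial>P) = (\<integral>\<^sup>+\<omega>. indicator {\<omega> \<in> space P. N 1 \<omega> = 1} \<omega> \<partial>P)"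
    by (intro nn_integral_cong) (auto simp: indicator_def)
  also have "\<dots> = p" unfolding p_def by (rule nn_integral_indicator) measurable
  finally have "p * I = (\<integral>\<^sup>+\<omega>. indicator {\<omega>. N 1 \<omega> = 1} \<omega> * ennreal (exp (\<gamma> * U 0 \<omega>)) \<partial>P)"
    using P.indep_var_nn_integral_mult[OF iv fm gm] unfolding f by (simp add: g_def I_def)
  also have "\<dots> \<le> (\<integral>\<^sup>+\<omega>. ennreal (exp (\<gamma> * X 1 \<omega>)) \<partial>P)"
    by (intro nn_integral_mono) (auto simp: indicator_def X)
  finally have "p * I < \<infinity>" using fin by (rule order_le_less_trans)
  then have "I < \<infinity>" using p by (auto simp: ennreal_mult_less_top)
  also have "I = (\<integral>\<^sup>+u. ennreal (exp (\<gamma> * u)) \<partial>F)"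
    unfolding I_def U(2)[of 0, symmetric] by (rule nn_integral_distr[symmetric, OF U0]) simp
  finally show ?thesis .
qed

text \<open>Weighting F by exp(\<gamma>u) gives a finite measure \<open>D\<close>, whose tails
  vanish. Beyond x the weight is at least exp(\<gamma>x), so the weighted tail of F is at most the
  tail of \<open>D\<close>.\<close>

lemma phase_type_tail_decay:
  assumes law: "phase_type_law \<alpha> T F" and \<gamma>: "0 \<le> \<gamma>"
    and fin: "(\<integral>\<^sup>+u. ennreal (exp (\<gamma> * u)) \<partial>F) < \<infinity>"
  shows "((\<lambda>x. exp (\<gamma> * x) * phase_type_tail \<alpha> T x) \<longlongrightarrow> 0) at_top"
proof -
  have F: "prob_space F" "sets F = sets borel" and tail: "\<And>x. 0 \<le> x \<Longrightarrow> measure F {x<..} = phase_type_tail \<alpha> T x"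
    using law by (auto simp: phase_type_law_def)
  interpret F: prob_space F by (rule F)
  note [measurable_cong] = F(2)
  define D where "D = density F (\<lambda>u. ennreal (exp (\<gamma> * u)))"
  have sets_D[measurable_cong]: "sets D = sets borel" by (simp add: D_def F)
  have D: "emeasure D A = (\<integral>\<^sup>+u\<in>A. ennreal (exp (\<gamma> * u)) \<partial>F)" if "A \<in> sets borel" for A
    unfolding D_def using that F(2) by (subst emeasure_density) auto
  interpret D: finite_measure D
  proof
    have "space D = UNIV" using sets_eq_imp_space_eq[OF sets_D] by simp
    then show "emeasure D (space D) \<noteq> \<infinity>" using fin by (simp add: D)
  qed
  have le: "exp (\<gamma> * x) * measure F {x<..} \<le> measure D {x<..}" for x
  proof -
    have "ennreal (exp (\<gamma> * x) * measure F {x<..}) = ennreal (exp (\<gamma> * x)) * emeasure F {x<..}"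
      by (simp add: F.emeasure_eq_measure ennreal_mult)
    also have "\<dots> = (\<integral>\<^sup>+u\<in>{x<..}. ennreal (exp (\<gamma> * x)) \<partial>F)"
      by (subst nn_integral_cmult_indicator) (auto simp: F)
    also have "\<dots> \<le> emeasure D {x<..}"
      using \<gamma> by (subst D) (auto intro!: nn_integral_mono ennreal_leI mult_left_mono simp: indicator_def)
    finally show ?thesis by (simp add: D.emeasure_eq_measure)
  qed
  have "(\<lambda>n. measure D {real n<..}) \<longlonglongrightarrow> measure D (\<Inter>n. {real n<..})"
    by (rule D.finite_Lim_measure_decseq) (auto simp: sets_D decseq_def)
  also have "(\<Inter>n. {real n<..}) = {}"
  proof (rule ccontr)
    assume "(\<Inter>n. {real n<..}) \<noteq> {}"
    then obtain x where x: "real n < x" for n by auto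
    obtain n where "x < real n" using reals_Archimedean2 by blast
    with x[of n] show False by simp
  qed
  finally have lim: "(\<lambda>n. measure D {real n<..}) \<longlonglongrightarrow> 0" by simp
  show ?thesis
  proof (rule order_tendstoI)
    fix a :: real assume "a < 0"
    then show "\<forall>\<^sub>F x in at_top. a < exp (\<gamma> * x) * phase_type_tail \<alpha> T x"
      by (intro eventually_at_top_linorderI[of 0]) (simp add: tail[symmetric] less_le_trans)
  next
    fix a :: real assume "0 < a"
    from order_tendstoD(2)[OF lim this] obtain n where n: "measure D {real n<..} < a"
      by (auto simp: eventually_sequentially)
    show "\<forall>\<^sub>F x in at_top. exp (\<gamma> * x) * phase_type_tail \<alpha> T x < a"
    proof (rule eventually_at_top_linorderI)
      fix x assume x: "real n \<le> x"
      then have "0 \<le> x" by (rule order_trans[rotated]) simp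
      have "exp (\<gamma> * x) * phase_type_tail \<alpha> T x \<le> measure D {x<..}"
        using le[of x] by (simp add: tail[OF \<open>0 \<le> x\<close>])
      also have "\<dots> \<le> measure D {real n<..}"
        using x by (intro D.finite_measure_mono) (auto simp: sets_D)
      finally show "exp (\<gamma> * x) * phase_type_tail \<alpha> T x < a" using n by linarith
    qed
  qed
qed

section \<open>The analytic hypotheses of the two contraction lemmas, verified for the given
  process\<close>

theorem theorem6:
  fixes P :: "'w measure" and Xp Xm :: "real \<Rightarrow> 'w \<Rightarrow> real"
    and \<alpha> :: "real^'m" and T :: "real^'m^'m" and F :: "real measure" and lam a :: real
  assumes params: "phase_type_params \<alpha> T"
    and minimal: "phase_type_minimal \<alpha> T"
    and law: "phase_type_law \<alpha> T F"
    and levy: "levy_process P Xm"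
    and spectrally_negative: "no_positive_jumps P Xm"
    and not_subordinator: "\<not> subordinator P (\<lambda>t \<omega>. - Xm t \<omega>)"
    and lam_pos: "lam > 0"
    and compound: "compound_poisson P lam F Xp"
    and indep: "indep_processes P Xp Xm"
    and a_pos: "a > 0"
  shows "(levy_exponent_deriv0 P Xm \<ge> 0 \<longrightarrow>
            l1_contraction_on subprob_vectors (psi P Xm \<alpha> T lam a)) \<and>
         (levy_exponent_deriv0 P Xm < 0 \<and>
          levy_exponent P (\<lambda>t \<omega>. Xp t \<omega> + Xm t \<omega>) (largest_root P Xm 0) < \<infinity> \<longrightarrow>
            (\<forall>Q. exponential_tilt P Xp Xm (largest_root P Xm 0) Q \<longrightarrow>
               l1_contraction_on subprob_vectors
                 (psi_tilted P Q (largest_root P Xm 0) Xm \<alpha> T lam a)))"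
proof -
  interpret P: prob_space P using levy by (simp add: levy_process_def)
  define q where "q = a + lam"
  have q: "0 < q" "lam < q" using a_pos lam_pos by (auto simp: q_def)
  note fin = levy_mgf_finite[OF levy spectrally_negative]
  have mgf: "levy_mgf P Xm 1 s = ennreal (exp (cumulant P Xm s))" if "0 \<le> s" for s
    by (rule levy_mgf_eq[OF levy fin that])
  define \<Phi> where "\<Phi> = largest_root P Xm q"
  \<comment> \<open>This gives \<Phi> > 0 here and \<gamma> < \<Phi> in the tilted case, where the
    cumulant at \<gamma> is 0 < q.\<close>
  have root: "s < \<Phi>" if "0 < s" "cumulant P Xm s < q" for s
    using largest_root_above(1)[OF levy fin not_subordinator that] q by (simp add: \<Phi>_def)
  obtain s0 where s0: "0 < s0" "cumulant P Xm s0 < q" by (rule cumulant_small[OF levy fin q(1)])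
  have \<Phi>: "0 < \<Phi>" "cumulant P Xm \<Phi> = q"
    using root[OF s0] s0 largest_root_above(2)[OF levy fin not_subordinator s0] q by (auto simp: \<Phi>_def)
  have mgf_\<Phi>: "levy_mgf P Xm 1 \<Phi> = ennreal (exp q)" using mgf[of \<Phi>] \<Phi> by simp
  define \<mu> where "\<mu> = exp_time_inf_law P Xm q"
  have \<mu>: "finite_measure \<mu>" "sets \<mu> = sets borel"
    using exp_time_inf_law_prob[OF P.prob_space_axioms levy_measurable[OF levy] levy_cadlag[OF levy] q(1)]
    by (auto simp: \<mu>_def prob_space.finite_measure)
  have transform: "(\<integral>\<^sup>+x\<in>{0..}. ennreal (1 - exp (- \<theta> * x)) \<partial>\<mu>) \<le> ennreal (\<theta> / \<Phi>)"
    if "0 \<le> \<theta>" "\<theta> \<le> \<Phi>" "0 \<le> cumulant P Xm \<theta>" for \<theta>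
    unfolding \<mu>_def
    by (rule levy_exp_time_transform[OF levy q(1) that(1,2) \<Phi>(1) mgf[OF that(1)] that(3) mgf_\<Phi>])
  show ?thesis
  proof (intro conjI impI allI)
    assume "0 \<le> levy_exponent_deriv0 P Xm"
    then have nonneg: "0 \<le> cumulant P Xm \<theta>" if "0 \<le> \<theta>" for \<theta>
      using levy_exponent_deriv0_nonneg[OF levy fin] that by blast
    \<comment> \<open>These functions are (1 - exp(-\<theta>x)) / \<theta> with \<theta> = 1 / (n +
      1) and tend to x, so Fatou turns the transform bound \<theta> / \<Phi> into the bound 1 /
      \<Phi> on the mean. The transform bound needs \<theta> \<le> \<Phi> and is therefore available
      for large n.\<close>
    define u where "u = (\<lambda>n x. ennreal (real (Suc n) * (1 - exp (- (1 / real (Suc n)) * x))) * indicator {0..} (x :: real))"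
    have [measurable]: "u n \<in> borel_measurable \<mu>" for n
      unfolding u_def by (simp add: measurable_cong_sets[OF \<mu>(2) refl])
    have "(\<integral>\<^sup>+x\<in>{0..}. ennreal x \<partial>\<mu>) \<le> (\<integral>\<^sup>+x. liminf (\<lambda>n. u n x) \<partial>\<mu>)"
    proof (rule nn_integral_mono)
      fix x :: real
      have "(\<lambda>n. real (Suc n) * (1 - exp (- (1 / real (Suc n)) * x))) \<longlonglongrightarrow> x" by real_asymp
      then have "(\<lambda>n. u n x) \<longlonglongrightarrow> ennreal x * indicator {0..} x" if "0 \<le> x"
        using that unfolding u_def by (auto intro!: tendsto_ennrealI)
      then have "liminf (\<lambda>n. u n x) = ennreal x * indicator {0..} x" if "0 \<le> x"
        using that by (intro lim_imp_Liminf) auto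
      then show "ennreal x * indicator {0..} x \<le> liminf (\<lambda>n. u n x)" by (cases "0 \<le> x") auto
    qed
    also have "\<dots> \<le> liminf (\<lambda>n. (\<integral>\<^sup>+x. u n x \<partial>\<mu>))" by (rule nn_integral_liminf) measurable
    also have "\<dots> \<le> ennreal (1 / \<Phi>)"
    proof (rule order_trans[OF Liminf_le_Limsup Limsup_bounded])
      have "(\<lambda>n. 1 / real (Suc n)) \<longlonglongrightarrow> 0" by real_asymp
      from order_tendstoD(2)[OF this \<Phi>(1)]
      show "\<forall>\<^sub>F n in sequentially. (\<integral>\<^sup>+x. u n x \<partial>\<mu>) \<le> ennreal (1 / \<Phi>)"
      proof eventually_elim
        case (elim n)
        define \<theta> where "\<theta> = 1 / real (Suc n)"
        have "(\<integral>\<^sup>+x. u n x \<partial>\<mu>) = (\<integral>\<^sup>+x. ennreal (real (Suc n)) * (ennreal (1 - exp (- \<theta> * x)) * indicator {0..} x) \<partial>\<mu>)"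
          unfolding u_def \<theta>_def by (intro nn_integral_cong) (simp add: ennreal_mult' mult.assoc del: of_nat_Suc)
        also have "\<dots> = ennreal (real (Suc n)) * (\<integral>\<^sup>+x\<in>{0..}. ennreal (1 - exp (- \<theta> * x)) \<partial>\<mu>)"
          by (rule nn_integral_cmult) (simp add: measurable_cong_sets[OF \<mu>(2) refl])
        also have "\<dots> \<le> ennreal (real (Suc n)) * ennreal (\<theta> / \<Phi>)"
          using elim by (intro mult_left_mono transform nonneg) (auto simp: \<theta>_def)
        also have "\<dots> = ennreal (1 / \<Phi>)"
          using \<Phi> by (simp add: ennreal_mult[symmetric] \<theta>_def del: of_nat_Suc)
        finally show ?case .
      qed
    qed simp
    finally have mean: "(\<integral>\<^sup>+x\<in>{0..}. ennreal x \<partial>\<mu>) \<le> ennreal (1 / \<Phi>)" .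
    show "l1_contraction_on subprob_vectors (psi P Xm \<alpha> T lam a)"
      unfolding psi_def q_def[symmetric] \<Phi>_def[symmetric] \<mu>_def[symmetric]
      by (rule l1_contraction_block_generator[OF params \<Phi>(1) \<mu> _ _ mean]) (use q lam_pos in auto)
  next
    fix Q
    define \<gamma> where "\<gamma> = largest_root P Xm 0"
    assume "levy_exponent_deriv0 P Xm < 0 \<and>
        levy_exponent P (\<lambda>t \<omega>. Xp t \<omega> + Xm t \<omega>) (largest_root P Xm 0) < \<infinity>"
      and "exponential_tilt P Xp Xm (largest_root P Xm 0) Q"
    then have neg: "levy_exponent_deriv0 P Xm < 0"
      and finX: "levy_exponent P (\<lambda>t \<omega>. Xp t \<omega> + Xm t \<omega>) \<gamma> < \<infinity>"
      and tilt: "exponential_tilt P Xp Xm \<gamma> Q" by (auto simp: \<gamma>_def)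
    obtain s where s: "0 < s" "cumulant P Xm s < 0" by (rule levy_exponent_deriv0_neg[OF levy fin neg])
    have \<gamma>: "0 < \<gamma>" "cumulant P Xm \<gamma> = 0"
      using largest_root_above[OF levy fin not_subordinator s] s by (auto simp: \<gamma>_def)
    have one: "levy_mgf P Xm 1 \<gamma> = 1" using mgf[of \<gamma>] \<gamma> by simp
    define \<phi> where "\<phi> = \<Phi> - \<gamma>"
    have \<phi>: "0 < \<phi>" using root[of \<gamma>] \<gamma> q by (simp add: \<phi>_def)
    define \<nu> where "\<nu> = exp_time_inf_law Q Xm q"
    have Q: "prob_space Q" "space Q = space P" using tilt by (auto simp: exponential_tilt_def)
    have \<nu>: "finite_measure \<nu>" "sets \<nu> = sets borel"
      using exp_time_inf_law_prob[OF Q(1) exponential_tilt_measurable[OF tilt] _ q(1)] levy_cadlag[OF levy] Q(2)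
      by (auto simp: \<nu>_def prob_space.finite_measure)
    have iv: "P.indep_var (\<Pi>\<^sub>M t\<in>{0..}. borel) (\<lambda>\<omega>. \<lambda>t\<in>{0..}. Xp t \<omega>) (\<Pi>\<^sub>M t\<in>{0..}. borel) (\<lambda>\<omega>. \<lambda>t\<in>{0..}. Xm t \<omega>)"
      using indep by (simp add: indep_processes_def)
    have ev: "(\<lambda>x :: real \<Rightarrow> real. ennreal (exp (\<gamma> * x 1))) \<in> borel_measurable (\<Pi>\<^sub>M t\<in>{0..}. borel)"
      by (rule measurable_compose[OF measurable_component_singleton[of 1]]) auto
    \<comment> \<open>Independence factors the moment of Xp 1 + Xm 1, and the factor of Xm is 1
      because \<gamma> is a root of the cumulant. The finiteness assumption thus passes to the
      compound Poisson part.\<close>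
    have "(\<integral>\<^sup>+\<omega>. ennreal (exp (\<gamma> * (Xp 1 \<omega> + Xm 1 \<omega>))) \<partial>P)
        = (\<integral>\<^sup>+\<omega>. ennreal (exp (\<gamma> * Xp 1 \<omega>)) * ennreal (exp (\<gamma> * Xm 1 \<omega>)) \<partial>P)"
      by (intro nn_integral_cong) (simp add: ennreal_mult[symmetric] mult_exp_exp distrib_left)
    also have "\<dots> = (\<integral>\<^sup>+\<omega>. ennreal (exp (\<gamma> * Xp 1 \<omega>)) \<partial>P) * levy_mgf P Xm 1 \<gamma>"
      using P.indep_var_nn_integral_mult[OF iv ev ev] by (simp add: levy_mgf_def[OF levy])
    finally have "(\<integral>\<^sup>+\<omega>. ennreal (exp (\<gamma> * Xp 1 \<omega>)) \<partial>P) < \<infinity>"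
      using finX one unfolding levy_exponent_def Let_def by (simp add: less_top split: if_splits)
    from phase_type_tail_decay[OF law less_imp_le[OF \<gamma>(1)] compound_poisson_jump_mgf[OF P.prob_space_axioms compound lam_pos this]]
    have decay: "((\<lambda>x. exp (\<gamma> * x) * phase_type_tail \<alpha> T x) \<longlongrightarrow> 0) at_top" .
    define k where "k = phase_type_resolvent T (- \<gamma>)"
    note res = phase_type_resolvent_props[OF params minimal less_imp_le[OF \<gamma>(1)] decay, folded k_def]
    obtain l where l: "T *v l + \<gamma> *\<^sub>R l = k" using res(3) by blast
    have "l1_contraction_on subprob_vectors (mixture_map (lam * (\<alpha> \<bullet> k) / q)
        (extend_row ((1 / (\<alpha> \<bullet> k)) *\<^sub>R (\<alpha> v* diag_matrix k)))
        (block_generator \<phi> (matrix_inv (diag_matrix k) *v exit_vector T)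
                  (matrix_inv (diag_matrix k) ** T ** diag_matrix k + mat \<gamma>)) \<nu>)"
    proof (rule l1_contraction_tilted_block_generator[OF params \<phi> \<gamma>(1) res(1,2) l \<nu> \<mu> _ _ lam_pos q(2)])
      show "emeasure \<nu> {y<..} \<le> ennreal (exp (- \<gamma> * y)) * emeasure \<mu> {y..}" for y
        unfolding \<nu>_def \<mu>_def
        by (rule tilted_exp_time_inf_tail[OF levy indep q(1) tilt less_imp_le[OF \<gamma>(1)] one])
      show "(\<integral>\<^sup>+x\<in>{0..}. ennreal (1 - exp (- \<gamma> * x)) \<partial>\<mu>) \<le> ennreal (\<gamma> / (\<phi> + \<gamma>))"
        using transform[of \<gamma>] \<gamma> \<phi> by (simp add: \<phi>_def)
    qed
    \<comment> \<open>Tilting leaves the total rate unchanged, so both maps involve the same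
      q.\<close>
    moreover have "a + lam * (1 - \<alpha> \<bullet> k) + lam * (\<alpha> \<bullet> k) = q" by (simp add: q_def algebra_simps)
    ultimately show "l1_contraction_on subprob_vectors (psi_tilted P Q (largest_root P Xm 0) Xm \<alpha> T lam a)"
      unfolding psi_tilted_def Let_def \<gamma>_def[symmetric] phase_type_transform_def k_def[symmetric]
      by (simp only: \<phi>_def \<Phi>_def \<nu>_def q_def)
  qed
qed

end
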